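(* Let $E$ be a real Banach space with norm dual $E^\ast$. For $x\in E$, define $j(x):E^\ast\to\mathbb{R}$ by $[j(x)](x^\ast):=x^\ast(x)$ for $x^\ast\in E^\ast$, and let $\mathcal{F}$ be the vector sublattice of the vector lattice of all real-valued functions on $E^\ast$ that is generated by $\{j(x):x\in E\}$, so that $(j,\mathcal{F})$ is a free vector lattice over the vector space $E$. For each contraction $\varphi:E\to G$ into a Banach lattice $G$, let $\overline{\varphi}:\mathcal{F}\to G$ be the unique vector lattice homomorphism such that $\overline{\varphi}\circ j=\varphi$. For $\xi\in\mathcal{F}$, set \[ \rho(\xi):=\sup\{\|\overline{\varphi}(\xi)\|: G \text{ is a Banach lattice and } \varphi:E\to G \text{ is a contraction}\}. \] Then $\rho$ is a (finite-valued) vector lattice norm on $\mathcal{F}$, and the completion of $\mathcal{F}$ in the norm $\rho$, together with the map from $E$ into it induced by $j$, is a free Banach lattice over the Banach space $E$.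
   Context: All spaces are over $\mathbb{R}$. A contraction is a linear map of operator norm at most $1$. A vector lattice norm on a vector lattice is a norm $\rho$ such that $|\xi|\leq|\eta|$ implies $\rho(\xi)\leq\rho(\eta)$. The vector sublattice generated by a subset of a vector lattice is the smallest vector sublattice containing that subset; function spaces carry the pointwise operations and ordering. A free vector lattice over a real vector space $V$ is a pair $(j,F)$, where $F$ is a vector lattice and $j:V\to F$ is a linear map, such that for every vector lattice $G$ and every linear map $\varphi:V\to G$ there exists a unique vector lattice homomorphism $\overline{\varphi}:F\to G$ with $\overline{\varphi}\circ j=\varphi$. A free Banach lattice over a Banach space $E$ is a pair $(i,B)$, where $B$ is a Banach lattice and $i:E\to B$ is a contraction, such that for every Banach lattice $G$ and every contraction $\varphi:E\to G$ there exists a unique contractive vector lattice homomorphism $\widetilde{\varphi}:B\to G$ with $\widetilde{\varphi}\circ i=\varphi$. *)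

theory Defs
  imports "HOL-Analysis.Analysis"
begin

section \<open>Vector lattices\<close>

text \<open>Vector lattices and Banach lattices are structures on carrier sets, not type classes: the
  supremum defining the norm below ranges over Banach lattices, and HOL cannot quantify over types
  inside a term.\<close>

record 'a vlat =
  vcarrier :: "'a set"
  vzero :: 'a
  vadd :: "'a \<Rightarrow> 'a \<Rightarrow> 'a"
  vscale :: "real \<Rightarrow> 'a \<Rightarrow> 'a"
  vle :: "'a \<Rightarrow> 'a \<Rightarrow> bool"

definition vneg :: "('a, 'm) vlat_scheme \<Rightarrow> 'a \<Rightarrow> 'a"
  where "vneg X a = vscale X (- 1) a"

definition vdiff :: "('a, 'm) vlat_scheme \<Rightarrow> 'a \<Rightarrow> 'a \<Rightarrow> 'a"
  where "vdiff X a b = vadd X a (vneg X b)"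

definition is_vsup :: "('a, 'm) vlat_scheme \<Rightarrow> 'a \<Rightarrow> 'a \<Rightarrow> 'a \<Rightarrow> bool"
  where "is_vsup X a b s \<longleftrightarrow> s \<in> vcarrier X \<and> vle X a s \<and> vle X b s \<and>
    (\<forall>u\<in>vcarrier X. vle X a u \<and> vle X b u \<longrightarrow> vle X s u)"

definition is_vinf :: "('a, 'm) vlat_scheme \<Rightarrow> 'a \<Rightarrow> 'a \<Rightarrow> 'a \<Rightarrow> bool"
  where "is_vinf X a b s \<longleftrightarrow> s \<in> vcarrier X \<and> vle X s a \<and> vle X s b \<and>
    (\<forall>u\<in>vcarrier X. vle X u a \<and> vle X u b \<longrightarrow> vle X u s)"

definition vsup :: "('a, 'm) vlat_scheme \<Rightarrow> 'a \<Rightarrow> 'a \<Rightarrow> 'a"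
  where "vsup X a b = (THE s. is_vsup X a b s)"

definition vinf :: "('a, 'm) vlat_scheme \<Rightarrow> 'a \<Rightarrow> 'a \<Rightarrow> 'a"
  where "vinf X a b = (THE s. is_vinf X a b s)"

definition vabs :: "('a, 'm) vlat_scheme \<Rightarrow> 'a \<Rightarrow> 'a"
  where "vabs X a = vsup X a (vneg X a)"

locale vector_lattice =
  fixes X :: "('a, 'm) vlat_scheme"
  assumes zero_closed: "vzero X \<in> vcarrier X"
    and add_closed: "\<lbrakk>a \<in> vcarrier X; b \<in> vcarrier X\<rbrakk> \<Longrightarrow> vadd X a b \<in> vcarrier X"
    and scale_closed: "a \<in> vcarrier X \<Longrightarrow> vscale X r a \<in> vcarrier X"
    and add_assoc: "\<lbrakk>a \<in> vcarrier X; b \<in> vcarrier X; c \<in> vcarrier X\<rbrakk>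
      \<Longrightarrow> vadd X (vadd X a b) c = vadd X a (vadd X b c)"
    and add_comm: "\<lbrakk>a \<in> vcarrier X; b \<in> vcarrier X\<rbrakk> \<Longrightarrow> vadd X a b = vadd X b a"
    and add_zero: "a \<in> vcarrier X \<Longrightarrow> vadd X a (vzero X) = a"
    and add_neg: "a \<in> vcarrier X \<Longrightarrow> vadd X a (vneg X a) = vzero X"
    and scale_add_right: "\<lbrakk>a \<in> vcarrier X; b \<in> vcarrier X\<rbrakk>
      \<Longrightarrow> vscale X r (vadd X a b) = vadd X (vscale X r a) (vscale X r b)"
    and scale_add_left: "a \<in> vcarrier X
      \<Longrightarrow> vscale X (r + s) a = vadd X (vscale X r a) (vscale X s a)"
    and scale_scale: "a \<in> vcarrier X \<Longrightarrow> vscale X r (vscale X s a) = vscale X (r * s) a"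
    and scale_one: "a \<in> vcarrier X \<Longrightarrow> vscale X 1 a = a"
    and le_refl: "a \<in> vcarrier X \<Longrightarrow> vle X a a"
    and le_antisym: "\<lbrakk>a \<in> vcarrier X; b \<in> vcarrier X; vle X a b; vle X b a\<rbrakk> \<Longrightarrow> a = b"
    and le_trans: "\<lbrakk>a \<in> vcarrier X; b \<in> vcarrier X; c \<in> vcarrier X; vle X a b; vle X b c\<rbrakk>
      \<Longrightarrow> vle X a c"
    and add_mono: "\<lbrakk>a \<in> vcarrier X; b \<in> vcarrier X; c \<in> vcarrier X; vle X a b\<rbrakk>
      \<Longrightarrow> vle X (vadd X a c) (vadd X b c)"
    and scale_mono: "\<lbrakk>a \<in> vcarrier X; b \<in> vcarrier X; vle X a b; 0 \<le> r\<rbrakk>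
      \<Longrightarrow> vle X (vscale X r a) (vscale X r b)"
    and sup_exists: "\<lbrakk>a \<in> vcarrier X; b \<in> vcarrier X\<rbrakk> \<Longrightarrow> \<exists>s. is_vsup X a b s"
    and inf_exists: "\<lbrakk>a \<in> vcarrier X; b \<in> vcarrier X\<rbrakk> \<Longrightarrow> \<exists>s. is_vinf X a b s"

definition vector_sublattice :: "('a, 'm) vlat_scheme \<Rightarrow> 'a set \<Rightarrow> bool"
  where "vector_sublattice X S \<longleftrightarrow> S \<subseteq> vcarrier X \<and> vzero X \<in> S \<and>
    (\<forall>a\<in>S. \<forall>b\<in>S. vadd X a b \<in> S) \<and> (\<forall>r. \<forall>a\<in>S. vscale X r a \<in> S) \<and>
    (\<forall>a\<in>S. \<forall>b\<in>S. vsup X a b \<in> S) \<and> (\<forall>a\<in>S. \<forall>b\<in>S. vinf X a b \<in> S)"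

definition generated_sublattice :: "('a, 'm) vlat_scheme \<Rightarrow> 'a set \<Rightarrow> 'a set"
  where "generated_sublattice X A = \<Inter> {S. vector_sublattice X S \<and> A \<subseteq> S}"

text \<open>Homomorphisms are extensional, so that uniqueness is uniqueness on the carrier.\<close>

definition vlat_hom :: "('a, 'm) vlat_scheme \<Rightarrow> ('b, 'n) vlat_scheme \<Rightarrow> ('a \<Rightarrow> 'b) set"
  where "vlat_hom X Y = {h \<in> vcarrier X \<rightarrow>\<^sub>E vcarrier Y.
    (\<forall>a\<in>vcarrier X. \<forall>b\<in>vcarrier X. h (vadd X a b) = vadd Y (h a) (h b)) \<and>
    (\<forall>r. \<forall>a\<in>vcarrier X. h (vscale X r a) = vscale Y r (h a)) \<and>
    (\<forall>a\<in>vcarrier X. \<forall>b\<in>vcarrier X. h (vsup X a b) = vsup Y (h a) (h b)) \<and>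
    (\<forall>a\<in>vcarrier X. \<forall>b\<in>vcarrier X. h (vinf X a b) = vinf Y (h a) (h b))}"

definition linear_into :: "('v::real_vector \<Rightarrow> 'b) \<Rightarrow> ('b, 'n) vlat_scheme \<Rightarrow> bool"
  where "linear_into \<phi> Y \<longleftrightarrow> (\<forall>x. \<phi> x \<in> vcarrier Y) \<and>
    (\<forall>x y. \<phi> (x + y) = vadd Y (\<phi> x) (\<phi> y)) \<and> (\<forall>r x. \<phi> (r *\<^sub>R x) = vscale Y r (\<phi> x))"

text \<open>The universal property is required for all test lattices with carrier in the type
  \<open>'g\<close>; a theorem stated for a free type variable \<open>'g\<close> covers all vector lattices.\<close>

definition free_vector_lattice ::
    "'g itself \<Rightarrow> ('v::real_vector \<Rightarrow> 'a) \<Rightarrow> ('a, 'm) vlat_scheme \<Rightarrow> bool"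
  where "free_vector_lattice (T :: 'g itself) j F \<longleftrightarrow> vector_lattice F \<and> linear_into j F \<and>
    (\<forall>(G :: 'g vlat) \<phi>. vector_lattice G \<and> linear_into \<phi> G \<longrightarrow>
      (\<exists>!h. h \<in> vlat_hom F G \<and> h \<circ> j = \<phi>))"


section \<open>Norms and Banach lattices\<close>

definition vector_lattice_norm :: "('a, 'm) vlat_scheme \<Rightarrow> ('a \<Rightarrow> real) \<Rightarrow> bool"
  where "vector_lattice_norm X \<rho> \<longleftrightarrow>
    (\<forall>a\<in>vcarrier X. 0 \<le> \<rho> a \<and> (\<rho> a = 0 \<longleftrightarrow> a = vzero X)) \<and>
    (\<forall>r. \<forall>a\<in>vcarrier X. \<rho> (vscale X r a) = \<bar>r\<bar> * \<rho> a) \<and>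
    (\<forall>a\<in>vcarrier X. \<forall>b\<in>vcarrier X. \<rho> (vadd X a b) \<le> \<rho> a + \<rho> b) \<and>
    (\<forall>a\<in>vcarrier X. \<forall>b\<in>vcarrier X. vle X (vabs X a) (vabs X b) \<longrightarrow> \<rho> a \<le> \<rho> b)"

definition cauchy_seqs :: "('a, 'm) vlat_scheme \<Rightarrow> ('a \<Rightarrow> real) \<Rightarrow> (nat \<Rightarrow> 'a) set"
  where "cauchy_seqs X \<rho> = {s. (\<forall>n. s n \<in> vcarrier X) \<and>
    (\<forall>e>0. \<exists>N. \<forall>m\<ge>N. \<forall>n\<ge>N. \<rho> (vdiff X (s m) (s n)) < e)}"

record 'a nvlat = "'a vlat" +
  vnorm :: "'a \<Rightarrow> real"

locale banach_lattice = vector_lattice X for X :: "('a, 'm) nvlat_scheme" +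
  assumes norm: "vector_lattice_norm X (vnorm X)"
    and complete: "s \<in> cauchy_seqs X (vnorm X) \<Longrightarrow>
      \<exists>a\<in>vcarrier X. (\<lambda>n. vnorm X (vdiff X (s n) a)) \<longlonglongrightarrow> 0"

definition contraction_into :: "('e::real_normed_vector \<Rightarrow> 'b) \<Rightarrow> ('b, 'n) nvlat_scheme \<Rightarrow> bool"
  where "contraction_into \<phi> Y \<longleftrightarrow> linear_into \<phi> Y \<and> (\<forall>x. vnorm Y (\<phi> x) \<le> norm x)"

definition contractive_vlat_hom ::
    "('a, 'm) nvlat_scheme \<Rightarrow> ('b, 'n) nvlat_scheme \<Rightarrow> ('a \<Rightarrow> 'b) set"
  where "contractive_vlat_hom X Y =
    {h \<in> vlat_hom X Y. \<forall>a\<in>vcarrier X. vnorm Y (h a) \<le> vnorm X a}"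

definition free_banach_lattice ::
    "'g itself \<Rightarrow> ('e::banach \<Rightarrow> 'b) \<Rightarrow> ('b, 'm) nvlat_scheme \<Rightarrow> bool"
  where "free_banach_lattice (T :: 'g itself) i B \<longleftrightarrow> banach_lattice B \<and> contraction_into i B \<and>
    (\<forall>(G :: 'g nvlat) \<phi>. banach_lattice G \<and> contraction_into \<phi> G \<longrightarrow>
      (\<exists>!h. h \<in> contractive_vlat_hom B G \<and> h \<circ> i = \<phi>))"


section \<open>Norm completion of a normed vector lattice\<close>

text \<open>Cauchy sequences modulo null sequences. The order is the one whose positive cone is the
  closure of the positive cone of \<open>X\<close>. Operations on classes are given by chosen
  representatives, on which they do not depend when \<open>\<rho>\<close> is a vector lattice norm.\<close>

definition null_rel :: "('a, 'm) vlat_scheme \<Rightarrow> ('a \<Rightarrow> real) \<Rightarrow> ((nat \<Rightarrow> 'a) \<times> (nat \<Rightarrow> 'a)) set"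
  where "null_rel X \<rho> = {(s, t). s \<in> cauchy_seqs X \<rho> \<and> t \<in> cauchy_seqs X \<rho> \<and>
    (\<lambda>n. \<rho> (vdiff X (s n) (t n))) \<longlonglongrightarrow> 0}"

definition seq_class :: "('a, 'm) vlat_scheme \<Rightarrow> ('a \<Rightarrow> real) \<Rightarrow> (nat \<Rightarrow> 'a) \<Rightarrow> (nat \<Rightarrow> 'a) set"
  where "seq_class X \<rho> s = null_rel X \<rho> `` {s}"

definition seq_rep :: "(nat \<Rightarrow> 'a) set \<Rightarrow> nat \<Rightarrow> 'a"
  where "seq_rep A = (SOME s. s \<in> A)"

definition norm_completion ::
    "('a, 'm) vlat_scheme \<Rightarrow> ('a \<Rightarrow> real) \<Rightarrow> ((nat \<Rightarrow> 'a) set) nvlat"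
  where "norm_completion X \<rho> =
    \<lparr> vcarrier = cauchy_seqs X \<rho> // null_rel X \<rho>,
      vzero = seq_class X \<rho> (\<lambda>_. vzero X),
      vadd = (\<lambda>A B. seq_class X \<rho> (\<lambda>n. vadd X (seq_rep A n) (seq_rep B n))),
      vscale = (\<lambda>r A. seq_class X \<rho> (\<lambda>n. vscale X r (seq_rep A n))),
      vle = (\<lambda>A B. \<exists>s\<in>A. \<exists>t\<in>B. \<forall>n. vle X (s n) (t n)),
      vnorm = (\<lambda>A. lim (\<lambda>n. \<rho> (seq_rep A n))) \<rparr>"

definition completion_embed :: "('a, 'm) vlat_scheme \<Rightarrow> ('a \<Rightarrow> real) \<Rightarrow> 'a \<Rightarrow> (nat \<Rightarrow> 'a) set"
  where "completion_embed X \<rho> a = seq_class X \<rho> (\<lambda>_. a)"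


section \<open>The lattice of functions on the dual and its norm\<close>

definition fun_vlat :: "('x \<Rightarrow> real) vlat"
  where "fun_vlat =
    \<lparr> vcarrier = UNIV, vzero = (\<lambda>_. 0), vadd = (\<lambda>f g x. f x + g x),
      vscale = (\<lambda>r f x. r * f x), vle = (\<lambda>f g. \<forall>x. f x \<le> g x) \<rparr>"

type_synonym 'e dual_fun = "('e \<Rightarrow>\<^sub>L real) \<Rightarrow> real"

definition ev :: "'e::banach \<Rightarrow> 'e dual_fun"
  where "ev x = (\<lambda>x'. blinfun_apply x' x)"

definition fvl :: "('e::banach) dual_fun vlat"
  where "fvl = fun_vlat \<lparr> vcarrier := generated_sublattice fun_vlat (range ev) \<rparr>"

definition lift :: "('e::banach \<Rightarrow> 'g) \<Rightarrow> 'g nvlat \<Rightarrow> 'e dual_fun \<Rightarrow> 'g"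
  where "lift \<phi> G = (THE h. h \<in> vlat_hom fvl G \<and> h \<circ> ev = \<phi>)"

definition rho_over :: "'g itself \<Rightarrow> ('e::banach) dual_fun \<Rightarrow> ereal"
  where "rho_over (T :: 'g itself) \<xi> = Sup {ereal (vnorm G (lift \<phi> G \<xi>)) |(G :: 'g nvlat) \<phi>.
    banach_lattice G \<and> contraction_into \<phi> G}"

text \<open>\<open>rho_over\<close> takes the supremum over the Banach lattices with carrier in a given type.
  For \<open>rho\<close> that type is one large enough to lose nothing: the value of
  \<open>\<parallel>lift \<phi> G \<xi>\<parallel>\<close> only depends on the closed sublattice of \<open>G\<close> generated by the
  range of \<open>\<phi>\<close>, and each of its elements is determined by the set of sequences in the
  generated lattice \<open>fvl\<close> whose images converge to it. The theorem itself asserts that no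
  Banach lattice over any other type gives a larger value.\<close>

definition rho :: "('e::banach) dual_fun \<Rightarrow> ereal"
  where "rho = rho_over TYPE((nat \<Rightarrow> 'e dual_fun) set)"

definition rho_norm :: "('e::banach) dual_fun \<Rightarrow> real"
  where "rho_norm \<xi> = real_of_ereal (rho \<xi>)"

end

theory Submission
  imports Defs
begin

text \<open>An inequality between lattice-linear expressions holds in every vector lattice if it holds for
  the functions on the dual: in the normal form \<open>sup\<^sub>i inf\<^sub>j x\<^sub>i\<^sub>j\<close> it says that no functional is positive
  on a whole row \<open>x\<^sub>i\<^sub>j\<close>, so by Hahn-Banach 0 is a convex combination of that row, and the infimum of
  its images is at most 0. This yields the homomorphic extensions of linear maps, and, for a
  finite-dimensional dual, the transfer of inequalities from the reals to all vector lattices.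

  Every extension of a contraction is bounded by \<open>rho_norm\<close>, whatever the type of its target,
  because the closure of its range is isometric to a Banach lattice over the type used in
  \<open>rho\<close>. Hence it extends uniquely to the completion. Definiteness of \<open>rho_norm\<close> follows from the
  contractions into the reals.\<close>

section \<open>Linear functionals below a sublinear one\<close>

text \<open>The obstacle is well-definedness. An element of \<open>fvl\<close> has many lattice
  expressions, and two that agree as functions on the norm dual must yield the same element of every
  vector lattice, Archimedean or not, under a linear map that may be discontinuous. Such a target
  need not consist of real functions, so points of the target cannot be used and normal forms are
  compared instead. Bounded functionals are enough for this: only the convex hull of one finite row,
  a compact set, has to be separated from 0, and a convex combination equal to 0 stays one under
  every linear map. That the normal forms are closed under all operations rests on the distributive
  law, which therefore has to be derived from the vector lattice axioms first. Finiteness of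
  \<open>rho\<close> needs a bound that is uniform in the target lattice; it is read off from the
  construction of an element out of the generators \<open>ev x\<close>, each of which contributes
  \<open>norm x\<close>.\<close>

definition sublinear :: "('v::real_vector \<Rightarrow> real) \<Rightarrow> bool"
  where "sublinear p \<longleftrightarrow> (\<forall>x y. p (x + y) \<le> p x + p y) \<and> (\<forall>r x. 0 \<le> r \<longrightarrow> p (r *\<^sub>R x) \<le> r * p x)"

lemma sublinear_zero:
  assumes "sublinear p"
  shows "p 0 = 0"
proof -
  have "p (0 + 0) \<le> p 0 + p 0" "p (0 *\<^sub>R 0) \<le> 0 * p 0"
    using assms unfolding sublinear_def by blast+
  then show ?thesis by simp
qed

lemma sublinear_minus:
  assumes "sublinear p"
  shows "- p (- x) \<le> p x"
proof -
  have "p (x + - x) \<le> p x + p (- x)"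
    using assms unfolding sublinear_def by blast
  then show ?thesis using sublinear_zero[OF assms] by simp
qed

text \<open>The index \<open>c\<close> may depend on the points as well as on \<open>a\<close> and
  \<open>b\<close>. This covers families indexed by a half-line, by a chain and by a convex cone,
  the three infima taken in this section.\<close>

lemma sublinear_INF:
  fixes F :: "'i \<Rightarrow> 'v::real_vector \<Rightarrow> real"
  assumes "A \<noteq> {}" and bdd: "\<And>x. bdd_below ((\<lambda>a. F a x) ` A)"
    and add: "\<And>a b x y. \<lbrakk>a \<in> A; b \<in> A\<rbrakk> \<Longrightarrow> \<exists>c\<in>A. F c (x + y) \<le> F a x + F b y"
    and scale: "\<And>r a x. \<lbrakk>0 \<le> r; a \<in> A\<rbrakk> \<Longrightarrow> \<exists>c\<in>A. F c (r *\<^sub>R x) \<le> r * F a x"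
  shows "sublinear (\<lambda>x. INF a\<in>A. F a x)"
  unfolding sublinear_def
proof (intro conjI allI impI)
  fix x y
  have *: "(INF a\<in>A. F a (x + y)) \<le> F a x + F b y" if ab: "a \<in> A" "b \<in> A" for a b
  proof -
    obtain c where "c \<in> A" "F c (x + y) \<le> F a x + F b y" using add[OF ab] by blast
    then show ?thesis using cINF_lower[OF bdd] by (meson order_trans)
  qed
  \<comment> \<open>The infimum is taken over \<open>b\<close> with \<open>a\<close> fixed, and then
    over \<open>a\<close>.\<close>
  have "(INF a\<in>A. F a (x + y)) - F a x \<le> (INF b\<in>A. F b y)" if "a \<in> A" for a
    using *[OF that] by (intro cINF_greatest \<open>A \<noteq> {}\<close>) (simp add: algebra_simps)
  then have "(INF a\<in>A. F a (x + y)) - (INF b\<in>A. F b y) \<le> (INF a\<in>A. F a x)"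
    by (intro cINF_greatest \<open>A \<noteq> {}\<close>) (simp add: algebra_simps)
  then show "(INF a\<in>A. F a (x + y)) \<le> (INF a\<in>A. F a x) + (INF a\<in>A. F a y)" by simp
next
  fix r :: real and x
  assume "0 \<le> r"
  have *: "(INF a\<in>A. F a (r *\<^sub>R x)) \<le> r * F a x" if a: "a \<in> A" for a
  proof -
    obtain c where "c \<in> A" "F c (r *\<^sub>R x) \<le> r * F a x" using scale[OF \<open>0 \<le> r\<close> a] by blast
    then show ?thesis using cINF_lower[OF bdd] by (meson order_trans)
  qed
  show "(INF a\<in>A. F a (r *\<^sub>R x)) \<le> r * (INF a\<in>A. F a x)"
  proof (cases "r = 0")
    case True
    then show ?thesis using * \<open>A \<noteq> {}\<close> by auto
  next
    case False
    with \<open>0 \<le> r\<close> have "0 < r" by simp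
    then have "(INF a\<in>A. F a (r *\<^sub>R x)) / r \<le> (INF a\<in>A. F a x)"
      using * by (intro cINF_greatest \<open>A \<noteq> {}\<close>) (simp add: field_simps)
    then show ?thesis using \<open>0 < r\<close> by (simp add: field_simps)
  qed
qed

text \<open>For a direction \<open>a\<close>, the infimum of
  \<open>q (x + t *\<^sub>R a) - t * q a\<close> over \<open>t \<ge> 0\<close> is sublinear and, by
  \<open>t = 0\<close>, below \<open>q\<close>; minimality makes it equal to \<open>q\<close>. Its
  value at \<open>- a\<close>, estimated with \<open>t = 1\<close>, gives
  \<open>q (- a) \<le> - q a\<close>. Once \<open>q\<close> is odd, subadditivity applied to
  \<open>x, y\<close> and to \<open>- x, - y\<close> is additivity.\<close>

lemma minimal_sublinear_imp_linear:
  assumes q: "sublinear q" and min: "\<And>q'. \<lbrakk>sublinear q'; q' \<le> q\<rbrakk> \<Longrightarrow> q' = q"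
  shows "linear q"
proof -
  have add: "q (x + y) \<le> q x + q y" and scale: "0 \<le> r \<Longrightarrow> q (r *\<^sub>R x) \<le> r * q x" for x y r
    using q unfolding sublinear_def by auto
  have neg: "q (- a) = - q a" for a
  proof -
    define F where "F = (\<lambda>t x. q (x + t *\<^sub>R a) - t * q a)"
    define q' where "q' = (\<lambda>x. INF t\<in>{0..}. F t x)"
    have pos: "0 * q a \<le> q (0 *\<^sub>R a)" by (simp add: sublinear_zero[OF q])
    have scale_eq: "q (t *\<^sub>R a) = t * q a" if "0 \<le> t" for t
    proof (cases "t = 0")
      case False
      with that have "0 < t" by simp
      then have "q ((1 / t) *\<^sub>R (t *\<^sub>R a)) \<le> 1 / t * q (t *\<^sub>R a)" by (intro scale) simp
      then have "t * q a \<le> q (t *\<^sub>R a)" using \<open>0 < t\<close> by (simp add: field_simps)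
      then show ?thesis using scale[OF that, of a] by simp
    qed (use sublinear_zero[OF q] in simp)
    have bdd: "bdd_below ((\<lambda>t. F t x) ` {0..})" for x
    proof (rule bdd_belowI2)
      fix t :: real assume "t \<in> {0..}"
      \<comment> \<open>From \<open>t * q a = q (t *\<^sub>R a)\<close> and subadditivity for the
        sum of \<open>x + t *\<^sub>R a\<close> and \<open>- x\<close>.\<close>
      then show "- q (- x) \<le> F t x"
        using add[of "x + t *\<^sub>R a" "- x"] scale_eq[of t] by (simp add: F_def)
    qed
    have "sublinear q'" unfolding q'_def
    proof (rule sublinear_INF[OF _ bdd])
      fix s t :: real and x y assume "s \<in> {0..}" "t \<in> {0..}"
      then show "\<exists>c\<in>{0..}. F c (x + y) \<le> F s x + F t y"
        using add[of "x + s *\<^sub>R a" "y + t *\<^sub>R a"]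
        by (intro bexI[of _ "s + t"]) (simp_all add: F_def algebra_simps)
    next
      fix r s :: real and x assume "0 \<le> r" "s \<in> {0..}"
      then show "\<exists>c\<in>{0..}. F c (r *\<^sub>R x) \<le> r * F s x"
        using scale[of r "x + s *\<^sub>R a"]
        by (intro bexI[of _ "r * s"]) (simp_all add: F_def algebra_simps)
    qed simp
    moreover have lower: "q' x \<le> F t x" if "0 \<le> t" for t x
      unfolding q'_def using that by (intro cINF_lower[OF bdd]) simp
    have "q' \<le> q"
      using lower[of 0] by (simp add: le_fun_def F_def)
    ultimately have "q' = q" by (rule min)
    then have "q (- a) \<le> - q a"
      using lower[of 1 "- a"] by (simp add: F_def sublinear_zero[OF q])
    then show ?thesis using sublinear_minus[OF q, of a] by simp
  qed
  have scale_eq: "q (r *\<^sub>R x) = r * q x" if "0 \<le> r" for r x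
    using scale[OF that, of x] scale[OF that, of "- x"] by (simp add: neg)
  show ?thesis
  proof (rule linearI)
    fix x y
    show "q (x + y) = q x + q y"
      using add[of x y] add[of "- x" "- y"] neg[of "x + y"] by (simp add: neg)
  next
    fix r :: real and x
    show "q (r *\<^sub>R x) = r *\<^sub>R q x"
    proof (cases "0 \<le> r")
      case False
      then have "q (- r *\<^sub>R x) = - r * q x" by (intro scale_eq) simp
      then show ?thesis by (simp add: neg)
    qed (simp add: scale_eq)
  qed
qed

text \<open>Zorn's lemma supplies a minimal sublinear functional below \<open>p\<close>, and minimal
  ones are linear. The order is reversed, so that the upper bound of a chain is its pointwise
  infimum.\<close>

lemma sublinear_dominates_linear:
  fixes p :: "'v::real_vector \<Rightarrow> real"
  assumes p: "sublinear p"
  shows "\<exists>f. linear f \<and> (\<forall>x. f x \<le> p x)"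
proof -
  define Q where "Q = {q. sublinear q \<and> q \<le> p}"
  have "partial_order_on Q (relation_of (\<lambda>a b. b \<le> a) Q)"
    by (rule partial_order_on_relation_ofI) auto
  moreover have "\<exists>u\<in>Q. \<forall>q\<in>C. u \<le> q" if C: "C \<in> Chains (relation_of (\<lambda>a b. b \<le> a) Q)" for C
  proof (cases "C = {}")
    case True
    then show ?thesis using p by (auto simp: Q_def)
  next
    case False
    have sub: "C \<subseteq> Q" and chain: "\<And>q q'. \<lbrakk>q \<in> C; q' \<in> C\<rbrakk> \<Longrightarrow> q \<le> q' \<or> q' \<le> q"
      using C by (auto simp: Chains_def relation_of_def)
    have bdd: "bdd_below ((\<lambda>q. q x) ` C)" for x
    proof (rule bdd_belowI2)
      fix q assume "q \<in> C"
      then have "sublinear q" "q (- x) \<le> p (- x)" using sub by (auto simp: Q_def le_fun_def)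
      \<comment> \<open>A lower bound independent of \<open>q\<close>, so the infimum over the chain
        is finite.\<close>
      then show "- p (- x) \<le> q x" using sublinear_minus[of q x] by simp
    qed
    have lower: "(\<lambda>x. INF q\<in>C. q x) \<le> q" if "q \<in> C" for q
      unfolding le_fun_def using cINF_lower[OF bdd that] by blast
    have "sublinear (\<lambda>x. INF q\<in>C. q x)"
    proof (rule sublinear_INF[OF False bdd])
      fix q q' x y assume qq: "q \<in> C" "q' \<in> C"
      \<comment> \<open>Of two members of a chain the smaller one serves as the common
        index.\<close>
      define m where "m = (if q \<le> q' then q else q')"
      have m: "m \<in> C" "m \<le> q" "m \<le> q'" using qq chain[OF qq] by (auto simp: m_def)
      then have "m (x + y) \<le> m x + m y" using sub by (auto simp: Q_def sublinear_def)
      also have "\<dots> \<le> q x + q' y" using m by (intro add_mono) (auto simp: le_fun_def)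
      finally show "\<exists>c\<in>C. c (x + y) \<le> q x + q' y" using m(1) by blast
    next
      fix r :: real and q x assume "0 \<le> r" "q \<in> C"
      then show "\<exists>c\<in>C. c (r *\<^sub>R x) \<le> r * q x" using sub by (auto simp: Q_def sublinear_def)
    qed
    then have "(\<lambda>x. INF q\<in>C. q x) \<in> Q"
      using False lower sub by (auto simp: Q_def intro: order_trans)
    then show ?thesis using lower by blast
  qed
  ultimately obtain q where "q \<in> Q" and min: "\<forall>q'\<in>Q. q' \<le> q \<longrightarrow> q' = q"
    using predicate_Zorn[of Q "\<lambda>a b. b \<le> a"] by blast
  then have q: "sublinear q" "q \<le> p" by (auto simp: Q_def)
  have "linear q"
    using q min by (intro minimal_sublinear_imp_linear) (auto simp: Q_def intro: order_trans)
  then show ?thesis using q(2) by (auto simp: le_fun_def)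
qed

text \<open>The functional is found below \<open>y \<mapsto> inf {norm (y + t *\<^sub>R c) - t * d |t c. 0 \<le> t \<and> c \<in> C}\<close>, where
  \<open>d\<close> is the distance of 0 from \<open>C\<close>; at \<open>- c\<close> this is at most \<open>- d\<close>.\<close>

lemma separate_zero_convex_compact:
  fixes C :: "'v::real_normed_vector set"
  assumes "convex C" "compact C" "0 \<notin> C"
  shows "\<exists>f :: 'v \<Rightarrow>\<^sub>L real. \<forall>c\<in>C. 0 < blinfun_apply f c"
proof (cases "C = {}")
  case False
  \<comment> \<open>Compactness enters here: the distance of 0 from \<open>C\<close> is attained,
    hence positive.\<close>
  obtain c0 where c0: "c0 \<in> C" "\<And>c. c \<in> C \<Longrightarrow> norm c0 \<le> norm c"
    using continuous_attains_inf[OF \<open>compact C\<close> False, of norm] by (auto intro: continuous_intros)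
  define d where "d = norm c0"
  have "0 < d" using c0 \<open>0 \<notin> C\<close> by (auto simp: d_def)
  define F :: "real \<times> 'v \<Rightarrow> 'v \<Rightarrow> real" where "F = (\<lambda>(t, c) y. norm (y + t *\<^sub>R c) - t * d)"
  have bound: "- norm y \<le> F (t, c) y" if "0 \<le> t" "c \<in> C" for t c y
  proof -
    have "t * d \<le> t * norm c" using that c0 by (intro mult_left_mono) (auto simp: d_def)
    also have "\<dots> = norm ((y + t *\<^sub>R c) - y)" using that by simp
    also have "\<dots> \<le> norm (y + t *\<^sub>R c) + norm y" by (rule norm_triangle_ineq4)
    finally show ?thesis by (simp add: F_def)
  qed
  have bdd: "bdd_below ((\<lambda>tc. F tc y) ` ({0..} \<times> C))" for y
    using bound by (intro bdd_belowI2[of _ "- norm y"]) auto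
  define p where "p = (\<lambda>y. INF tc\<in>{0..} \<times> C. F tc y)"
  have lower: "p y \<le> F (t, c) y" if "0 \<le> t" "c \<in> C" for t c y
    unfolding p_def using that by (intro cINF_lower[OF bdd]) simp
  have "sublinear p" unfolding p_def
  proof (rule sublinear_INF[OF _ bdd])
    show "{0::real..} \<times> C \<noteq> {}" using c0 by auto
  next
    fix a b :: "real \<times> 'v" and x y assume ab: "a \<in> {0..} \<times> C" "b \<in> {0..} \<times> C"
    obtain t c t' c' where tc: "a = (t, c)" "b = (t', c')" by (metis surj_pair)
    with ab have *: "0 \<le> t" "c \<in> C" "0 \<le> t'" "c' \<in> C" by auto
    show "\<exists>e\<in>{0..} \<times> C. F e (x + y) \<le> F a x + F b y"
    proof (cases "t + t' = 0")
      case True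
      with * have "t = 0" "t' = 0" by auto
      then show ?thesis using * norm_triangle_ineq[of x y]
        by (intro bexI[of _ "(0, c)"]) (auto simp: F_def tc)
    next
      case False
      with * have pos: "0 < t + t'" by simp
      \<comment> \<open>The weights make
        \<open>(t + t') *\<^sub>R e = t *\<^sub>R c + t' *\<^sub>R c'\<close>, so the two
        translations add up to one by a multiple of a point of \<open>C\<close>. The case
        \<open>t + t' = 0\<close> is apart because the weights are then undefined.\<close>
      define e where "e = (t / (t + t')) *\<^sub>R c + (t' / (t + t')) *\<^sub>R c'"
      have "e \<in> C" unfolding e_def using * pos
        by (intro convexD[OF \<open>convex C\<close>]) (auto simp flip: add_divide_distrib)
      have "(t + t') *\<^sub>R e = t *\<^sub>R c + t' *\<^sub>R c'"
        using pos by (simp add: e_def scaleR_right_distrib)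
      then have "x + y + (t + t') *\<^sub>R e = (x + t *\<^sub>R c) + (y + t' *\<^sub>R c')" by simp
      then have "norm (x + y + (t + t') *\<^sub>R e) \<le> norm (x + t *\<^sub>R c) + norm (y + t' *\<^sub>R c')"
        by (metis norm_triangle_ineq)
      then show ?thesis using * \<open>e \<in> C\<close>
        by (intro bexI[of _ "(t + t', e)"]) (auto simp: F_def tc algebra_simps)
    qed
  next
    fix r :: real and a :: "real \<times> 'v" and x assume "0 \<le> r" "a \<in> {0..} \<times> C"
    then obtain t c where tc: "a = (t, c)" "0 \<le> t" "c \<in> C" by auto
    have "norm (r *\<^sub>R x + (r * t) *\<^sub>R c) = r * norm (x + t *\<^sub>R c)"
      using \<open>0 \<le> r\<close> by (metis abs_of_nonneg norm_scaleR scaleR_right_distrib scaleR_scaleR)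
    then show "\<exists>e\<in>{0..} \<times> C. F e (r *\<^sub>R x) \<le> r * F a x"
      using tc \<open>0 \<le> r\<close> by (intro bexI[of _ "(r * t, c)"]) (auto simp: F_def algebra_simps)
  qed
  then obtain f where f: "linear f" "\<And>y. f y \<le> p y" using sublinear_dominates_linear by blast
  \<comment> \<open>The index \<open>t = 0\<close> bounds \<open>p\<close> by the norm, which makes
    \<open>f\<close> bounded.\<close>
  have le: "f y \<le> norm y" for y
    using f(2)[of y] lower[of 0 c0 y] c0 by (simp add: F_def)
  have "bounded_linear f"
  proof (rule bounded_linear_intro[of _ 1])
    fix x y r
    show "f (x + y) = f x + f y" "f (r *\<^sub>R x) = r *\<^sub>R f x"
      using f(1) by (simp_all add: linear_add linear_scale)
    show "norm (f x) \<le> norm x * 1"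
      using le[of x] le[of "- x"] linear_neg[OF f(1), of x] by simp
  qed
  moreover have "0 < f c" if "c \<in> C" for c
    using f(2)[of "- c"] lower[of 1 c "- c"] that linear_neg[OF f(1), of c] \<open>0 < d\<close>
    by (simp add: F_def)
  ultimately show ?thesis
    by (intro exI[of _ "Blinfun f"]) (simp add: bounded_linear_Blinfun_apply)
qed simp

text \<open>The convex hull of a finite set is compact in every normed space, so if it missed 0 some
  bounded functional would be strictly positive on all of \<open>A\<close>.\<close>

lemma zero_in_convex_hull_finite:
  fixes A :: "'v::real_normed_vector set"
  assumes "finite A" "\<And>f :: 'v \<Rightarrow>\<^sub>L real. \<exists>a\<in>A. blinfun_apply f a \<le> 0"
  shows "0 \<in> convex hull A"
proof (rule ccontr)
  assume "0 \<notin> convex hull A"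
  then obtain f :: "'v \<Rightarrow>\<^sub>L real" where "\<forall>c\<in>convex hull A. 0 < blinfun_apply f c"
    using separate_zero_convex_compact[of "convex hull A"] finite_imp_compact_convex_hull[OF assms(1)]
    by (auto simp: convex_convex_hull)
  then show False using assms(2)[of f] hull_subset[of A convex] by fastforce
qed


section \<open>Elementary identities in vector lattices\<close>

context vector_lattice
begin

lemma neg_closed: "a \<in> vcarrier X \<Longrightarrow> vneg X a \<in> vcarrier X"
  unfolding vneg_def by (rule scale_closed)

lemma diff_closed: "\<lbrakk>a \<in> vcarrier X; b \<in> vcarrier X\<rbrakk> \<Longrightarrow> vdiff X a b \<in> vcarrier X"
  unfolding vdiff_def by (intro add_closed neg_closed)

lemma vsup_eqI:
  assumes "is_vsup X a b s"
  shows "vsup X a b = s"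
  unfolding vsup_def
proof (rule the_equality, rule assms)
  fix t assume "is_vsup X a b t"
  with assms show "t = s" unfolding is_vsup_def by (blast intro: le_antisym)
qed

lemma vinf_eqI:
  assumes "is_vinf X a b s"
  shows "vinf X a b = s"
  unfolding vinf_def
proof (rule the_equality, rule assms)
  fix t assume "is_vinf X a b t"
  with assms show "t = s" unfolding is_vinf_def by (blast intro: le_antisym)
qed

lemma is_vsup_vsup: "\<lbrakk>a \<in> vcarrier X; b \<in> vcarrier X\<rbrakk> \<Longrightarrow> is_vsup X a b (vsup X a b)"
  using sup_exists vsup_eqI by metis

lemma is_vinf_vinf: "\<lbrakk>a \<in> vcarrier X; b \<in> vcarrier X\<rbrakk> \<Longrightarrow> is_vinf X a b (vinf X a b)"
  using inf_exists vinf_eqI by metis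

lemma
  assumes "a \<in> vcarrier X" "b \<in> vcarrier X"
  shows sup_closed: "vsup X a b \<in> vcarrier X"
    and sup_ge1: "vle X a (vsup X a b)"
    and sup_ge2: "vle X b (vsup X a b)"
    and sup_least: "\<lbrakk>u \<in> vcarrier X; vle X a u; vle X b u\<rbrakk> \<Longrightarrow> vle X (vsup X a b) u"
  using is_vsup_vsup[OF assms] unfolding is_vsup_def by auto

lemma
  assumes "a \<in> vcarrier X" "b \<in> vcarrier X"
  shows inf_closed: "vinf X a b \<in> vcarrier X"
    and inf_le1: "vle X (vinf X a b) a"
    and inf_le2: "vle X (vinf X a b) b"
    and inf_greatest: "\<lbrakk>u \<in> vcarrier X; vle X u a; vle X u b\<rbrakk> \<Longrightarrow> vle X u (vinf X a b)"
  using is_vinf_vinf[OF assms] unfolding is_vinf_def by auto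

lemma abs_closed: "a \<in> vcarrier X \<Longrightarrow> vabs X a \<in> vcarrier X"
  unfolding vabs_def by (intro sup_closed neg_closed)

lemmas closed = zero_closed add_closed scale_closed neg_closed diff_closed sup_closed inf_closed
  abs_closed

lemma vsup_commute: "vsup X a b = vsup X b a"
  unfolding vsup_def is_vsup_def by (rule arg_cong[of _ _ The]) blast

lemma vinf_commute: "vinf X a b = vinf X b a"
  unfolding vinf_def is_vinf_def by (rule arg_cong[of _ _ The]) blast

lemma vinf_absorb: "\<lbrakk>a \<in> vcarrier X; b \<in> vcarrier X; vle X a b\<rbrakk> \<Longrightarrow> vinf X a b = a"
  by (intro vinf_eqI) (simp add: is_vinf_def le_refl)

lemma vsup_absorb: "\<lbrakk>a \<in> vcarrier X; b \<in> vcarrier X; vle X a b\<rbrakk> \<Longrightarrow> vsup X a b = b"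
  by (intro vsup_eqI) (simp add: is_vsup_def le_refl)

lemma zero_add: "a \<in> vcarrier X \<Longrightarrow> vadd X (vzero X) a = a"
  using add_comm[OF zero_closed] add_zero by simp

lemma neg_add: "a \<in> vcarrier X \<Longrightarrow> vadd X (vneg X a) a = vzero X"
  using add_comm[OF neg_closed] add_neg by simp

lemma neg_neg: "a \<in> vcarrier X \<Longrightarrow> vneg X (vneg X a) = a"
  by (simp add: vneg_def scale_scale scale_one)

lemma scale_zero_left: "a \<in> vcarrier X \<Longrightarrow> vscale X 0 a = vzero X"
  using scale_add_left[of a 1 "- 1"] by (simp add: scale_one add_neg flip: vneg_def)

lemma scale_zero_right: "vscale X r (vzero X) = vzero X"
  using scale_scale[OF zero_closed, of r 0] scale_zero_left[OF zero_closed] by simp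

lemma add_neg_cancel: "\<lbrakk>a \<in> vcarrier X; x \<in> vcarrier X\<rbrakk> \<Longrightarrow> vadd X x (vadd X (vneg X x) a) = a"
  by (simp add: closed add_neg zero_add flip: add_assoc)

lemma neg_add_cancel: "\<lbrakk>a \<in> vcarrier X; x \<in> vcarrier X\<rbrakk> \<Longrightarrow> vadd X (vneg X x) (vadd X x a) = a"
  by (simp add: closed neg_add zero_add flip: add_assoc)

lemma add_mono_left:
  "\<lbrakk>a \<in> vcarrier X; b \<in> vcarrier X; c \<in> vcarrier X; vle X a b\<rbrakk> \<Longrightarrow> vle X (vadd X c a) (vadd X c b)"
  using add_mono[of a b c] by (simp add: add_comm)

text \<open>Translation is an order isomorphism. In this form bounds of translated elements become
  bounds of the original ones, which is how \<open>vadd\<close> is moved through suprema and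
  infima.\<close>

lemma add_le_iff:
  assumes "x \<in> vcarrier X" "a \<in> vcarrier X" "u \<in> vcarrier X"
  shows "vle X (vadd X x a) u \<longleftrightarrow> vle X a (vadd X (vneg X x) u)"
  using add_mono_left[of "vadd X x a" u "vneg X x"] add_mono_left[of a "vadd X (vneg X x) u" x] assms
  by (auto simp: closed add_neg_cancel neg_add_cancel)

lemma le_add_iff:
  assumes "x \<in> vcarrier X" "a \<in> vcarrier X" "u \<in> vcarrier X"
  shows "vle X u (vadd X x a) \<longleftrightarrow> vle X (vadd X (vneg X x) u) a"
  using add_le_iff[of "vneg X x" u a] assms by (simp add: closed neg_neg)

lemma neg_mono:
  assumes "a \<in> vcarrier X" "b \<in> vcarrier X" "vle X a b"
  shows "vle X (vneg X b) (vneg X a)"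
proof -
  have "vle X (vadd X a (vneg X b)) (vzero X)"
    using add_mono[of a b "vneg X b"] assms by (simp add: closed add_neg)
  then show ?thesis using assms add_le_iff[of a "vneg X b" "vzero X"] by (simp add: closed add_zero)
qed

lemma le_neg_iff:
  "\<lbrakk>a \<in> vcarrier X; b \<in> vcarrier X\<rbrakk> \<Longrightarrow> vle X a (vneg X b) \<longleftrightarrow> vle X b (vneg X a)"
  using neg_mono[of b "vneg X a"] neg_mono[of a "vneg X b"] by (auto simp: closed neg_neg)

lemma add_sup:
  assumes "x \<in> vcarrier X" "a \<in> vcarrier X" "b \<in> vcarrier X"
  shows "vadd X x (vsup X a b) = vsup X (vadd X x a) (vadd X x b)"
  using assms by (intro vsup_eqI[symmetric])
    (auto simp: is_vsup_def closed add_le_iff neg_add_cancel sup_ge1 sup_ge2 intro: sup_least)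

lemma add_inf:
  assumes "x \<in> vcarrier X" "a \<in> vcarrier X" "b \<in> vcarrier X"
  shows "vadd X x (vinf X a b) = vinf X (vadd X x a) (vadd X x b)"
  using assms by (intro vinf_eqI[symmetric])
    (auto simp: is_vinf_def closed le_add_iff neg_add_cancel inf_le1 inf_le2 intro: inf_greatest)

lemma neg_sup:
  assumes a: "a \<in> vcarrier X" and b: "b \<in> vcarrier X"
  shows "vneg X (vsup X a b) = vinf X (vneg X a) (vneg X b)"
proof (rule vinf_eqI[symmetric], unfold is_vinf_def, intro conjI ballI impI)
  fix u assume u: "u \<in> vcarrier X" and le: "vle X u (vneg X a) \<and> vle X u (vneg X b)"
  then have "vle X (vsup X a b) (vneg X u)"
    using a b by (intro sup_least) (simp_all add: neg_closed le_neg_iff[of u])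
  then show "vle X u (vneg X (vsup X a b))"
    using a b u by (simp add: sup_closed le_neg_iff[of u])
qed (use assms in \<open>simp_all add: closed neg_mono sup_ge1 sup_ge2\<close>)

lemma neg_inf:
  assumes "a \<in> vcarrier X" "b \<in> vcarrier X"
  shows "vneg X (vinf X a b) = vsup X (vneg X a) (vneg X b)"
  using neg_sup[of "vneg X a" "vneg X b"] assms neg_neg[of "vsup X (vneg X a) (vneg X b)"]
  by (simp add: closed neg_neg)

lemma scale_le_iff:
  assumes "a \<in> vcarrier X" "u \<in> vcarrier X" "0 < r"
  shows "vle X (vscale X r a) u \<longleftrightarrow> vle X a (vscale X (1 / r) u)"
  using scale_mono[of "vscale X r a" u "1 / r"] scale_mono[of a "vscale X (1 / r) u" r] assms
  by (auto simp: closed scale_scale scale_one)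

lemma le_scale_iff:
  assumes "a \<in> vcarrier X" "u \<in> vcarrier X" "0 < r"
  shows "vle X u (vscale X r a) \<longleftrightarrow> vle X (vscale X (1 / r) u) a"
  using scale_le_iff[of u a "1 / r"] assms by simp

lemma scale_sup:
  assumes "0 \<le> r" "a \<in> vcarrier X" "b \<in> vcarrier X"
  shows "vscale X r (vsup X a b) = vsup X (vscale X r a) (vscale X r b)"
proof (cases "r = 0")
  case True
  then show ?thesis
    using assms by (simp add: closed scale_zero_left vsup_absorb le_refl)
next
  case False
  with assms have "0 < r" by simp
  then show ?thesis using assms by (intro vsup_eqI[symmetric])
    (auto simp: is_vsup_def closed scale_le_iff scale_scale scale_one sup_ge1 sup_ge2 intro: sup_least)
qed

lemma scale_inf:
  assumes "0 \<le> r" "a \<in> vcarrier X" "b \<in> vcarrier X"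
  shows "vscale X r (vinf X a b) = vinf X (vscale X r a) (vscale X r b)"
proof (cases "r = 0")
  case True
  then show ?thesis
    using assms by (simp add: closed scale_zero_left vinf_absorb le_refl)
next
  case False
  with assms have "0 < r" by simp
  then show ?thesis using assms by (intro vinf_eqI[symmetric])
    (auto simp: is_vinf_def closed le_scale_iff scale_scale scale_one inf_le1 inf_le2 intro: inf_greatest)
qed

lemma add_left_comm: "\<lbrakk>a \<in> vcarrier X; b \<in> vcarrier X; c \<in> vcarrier X\<rbrakk>
    \<Longrightarrow> vadd X a (vadd X b c) = vadd X b (vadd X a c)"
  by (metis add_assoc add_comm)

text \<open>The identity \<open>a + b = sup a b + inf a b\<close>, solved for the infimum: negation
  turns the supremum into an infimum of negatives, and adding \<open>a + b\<close> leaves the two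
  elements interchanged.\<close>

lemma neg_sup_add:
  assumes "a \<in> vcarrier X" "b \<in> vcarrier X"
  shows "vadd X (vneg X (vsup X a b)) (vadd X a b) = vinf X a b"
proof -
  have "vadd X a (vadd X b (vneg X (vsup X a b)))
      = vinf X (vadd X a (vadd X b (vneg X a))) (vadd X a (vadd X b (vneg X b)))"
    using assms by (simp add: closed neg_sup add_inf)
  also have "\<dots> = vinf X b a"
    using assms by (simp add: closed add_neg add_zero add_comm[of b "vneg X a"] add_neg_cancel)
  finally show ?thesis
    using assms
    by (simp add: vinf_commute add_assoc closed add_comm[of "vneg X (vsup X a b)" "vadd X a b"])
qed

lemma inf_mono_right:
  assumes "a \<in> vcarrier X" "b \<in> vcarrier X" "c \<in> vcarrier X" "vle X b c"
  shows "vle X (vinf X a b) (vinf X a c)"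
  using assms le_trans[of "vinf X a b" b c] by (simp add: inf_greatest closed inf_le1 inf_le2)

lemma sup_mono_right:
  assumes "a \<in> vcarrier X" "b \<in> vcarrier X" "c \<in> vcarrier X" "vle X b c"
  shows "vle X (vsup X a b) (vsup X a c)"
  using assms le_trans[of b c "vsup X a c"] by (simp add: sup_least closed sup_ge1 sup_ge2)

text \<open>For an upper bound \<open>u\<close> of the two infima, \<open>neg_sup_add\<close> turns
  \<open>inf a d \<le> u\<close> into \<open>a + d \<le> sup a d + u\<close>. Enlarging
  \<open>sup a d\<close> to \<open>sup a ?s\<close> gives \<open>d \<le> ?t\<close> with
  \<open>?t\<close> independent of \<open>d\<close>. This holds for \<open>d = b\<close> and
  \<open>d = c\<close>, hence for their supremum \<open>?s\<close>, and for \<open>?s\<close> the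
  reformulation can be read backwards.\<close>

lemma inf_sup_distrib:
  assumes a: "a \<in> vcarrier X" and b: "b \<in> vcarrier X" and c: "c \<in> vcarrier X"
  shows "vinf X a (vsup X b c) = vsup X (vinf X a b) (vinf X a c)"
proof (rule vsup_eqI[symmetric], unfold is_vsup_def, intro conjI ballI impI)
  show "vinf X a (vsup X b c) \<in> vcarrier X" using assms by (simp add: closed)
  show "vle X (vinf X a b) (vinf X a (vsup X b c))"
    using assms by (simp add: inf_mono_right closed sup_ge1)
  show "vle X (vinf X a c) (vinf X a (vsup X b c))"
    using assms by (simp add: inf_mono_right closed sup_ge2)
next
  fix u assume u: "u \<in> vcarrier X" and le: "vle X (vinf X a b) u \<and> vle X (vinf X a c) u"
  let ?s = "vsup X b c"
  let ?t = "vadd X (vneg X a) (vadd X (vsup X a ?s) u)"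
  have step: "vle X d ?t" if d: "d \<in> vcarrier X" "vle X (vinf X a d) u" "vle X d ?s" for d
  proof -
    have "vle X (vsup X a d) (vsup X a ?s)"
      using assms d by (simp add: sup_mono_right closed)
    then have "vle X (vadd X (vsup X a d) u) (vadd X (vsup X a ?s) u)"
      using assms d u by (intro add_mono) (simp_all add: closed)
    moreover have "vle X (vadd X (vneg X (vsup X a d)) (vadd X a d)) u"
      using d(2) a d(1) by (simp add: neg_sup_add)
    then have "vle X (vadd X a d) (vadd X (vsup X a d) u)"
      using a d(1) u by (simp add: le_add_iff closed)
    ultimately have "vle X (vadd X a d) (vadd X (vsup X a ?s) u)"
      using assms d u
        le_trans[of "vadd X a d" "vadd X (vsup X a d) u" "vadd X (vsup X a ?s) u"]
      by (simp add: closed)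
    then show ?thesis using assms d u by (simp add: add_le_iff closed)
  qed
  have "vle X ?s ?t"
    using assms u le by (intro sup_least step) (auto simp: closed sup_ge1 sup_ge2)
  then have "vle X (vadd X a ?s) (vadd X (vsup X a ?s) u)"
    using assms u by (simp add: add_le_iff closed)
  then have "vle X (vadd X (vneg X (vsup X a ?s)) (vadd X a ?s)) u"
    using assms u by (simp add: le_add_iff closed)
  then show "vle X (vinf X a ?s) u"
    using assms by (simp add: neg_sup_add closed)
qed

end


section \<open>Extension of a linear map to lattice expressions\<close>

text \<open>Pairs of a function on the dual of \<open>'v\<close> and an element of \<open>G\<close> that are the values of one
  lattice-linear expression in normal form, a finite supremum of finite infima of generators.\<close>

inductive inf_graph ::
    "('v::real_normed_vector \<Rightarrow> 'g) \<Rightarrow> ('g, 'n) vlat_scheme \<Rightarrow> (('v \<Rightarrow>\<^sub>L real) \<Rightarrow> real) \<Rightarrow> 'g \<Rightarrow> bool"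
  for \<phi> :: "'v \<Rightarrow> 'g" and G :: "('g, 'n) vlat_scheme"
  where
    gen: "inf_graph \<phi> G (\<lambda>x'. blinfun_apply x' x) (\<phi> x)"
  | inf: "\<lbrakk>inf_graph \<phi> G f a; inf_graph \<phi> G g b\<rbrakk>
      \<Longrightarrow> inf_graph \<phi> G (\<lambda>x'. min (f x') (g x')) (vinf G a b)"

inductive lat_graph ::
    "('v::real_normed_vector \<Rightarrow> 'g) \<Rightarrow> ('g, 'n) vlat_scheme \<Rightarrow> (('v \<Rightarrow>\<^sub>L real) \<Rightarrow> real) \<Rightarrow> 'g \<Rightarrow> bool"
  for \<phi> :: "'v \<Rightarrow> 'g" and G :: "('g, 'n) vlat_scheme"
  where
    base: "inf_graph \<phi> G f a \<Longrightarrow> lat_graph \<phi> G f a"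
  | sup: "\<lbrakk>lat_graph \<phi> G f a; lat_graph \<phi> G g b\<rbrakk>
      \<Longrightarrow> lat_graph \<phi> G (\<lambda>x'. max (f x') (g x')) (vsup G a b)"

locale linear_into_vlat = vector_lattice X for X :: "('g, 'n) vlat_scheme" +
  fixes \<phi> :: "'v::real_normed_vector \<Rightarrow> 'g"
  assumes linear: "linear_into \<phi> X"
begin

lemma map_closed: "\<phi> x \<in> vcarrier X"
  and map_add: "\<phi> (x + y) = vadd X (\<phi> x) (\<phi> y)"
  and map_scale: "\<phi> (r *\<^sub>R x) = vscale X r (\<phi> x)"
  using linear by (simp_all add: linear_into_def)

lemma map_zero: "\<phi> 0 = vzero X"
  using map_scale[of 0 0] by (simp add: scale_zero_left map_closed)

lemma map_neg: "\<phi> (- x) = vneg X (\<phi> x)"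
  using map_scale[of "- 1" x] by (simp add: vneg_def)

lemma inf_graph_closed: "inf_graph \<phi> X f a \<Longrightarrow> a \<in> vcarrier X"
  by (induction rule: inf_graph.induct) (simp_all add: map_closed inf_closed)

lemma lat_graph_closed: "lat_graph \<phi> X f a \<Longrightarrow> a \<in> vcarrier X"
  by (induction rule: lat_graph.induct) (simp_all add: inf_graph_closed sup_closed)

lemma lat_graph_gen: "lat_graph \<phi> X (\<lambda>x'. blinfun_apply x' x) (\<phi> x)"
  by (intro lat_graph.base inf_graph.gen)

text \<open>Addition distributes over infima and suprema, so the normal form is kept if the sum is
  expanded one level at a time: a generator plus a row, two rows, a row plus a supremum of rows, two
  suprema of rows.\<close>

lemma inf_graph_add_gen:
  assumes "inf_graph \<phi> X f a"
  shows "inf_graph \<phi> X (\<lambda>x'. blinfun_apply x' x + f x') (vadd X (\<phi> x) a)"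
  using assms
proof induction
  case (gen y)
  show ?case using inf_graph.gen[of \<phi> X "x + y"] by (simp add: map_add blinfun.add_right)
next
  case (inf f a g b)
  then show ?case using inf_graph.inf[OF inf.IH]
    by (simp add: add_inf inf_graph_closed map_closed min_add_distrib_right)
qed

lemma inf_graph_add:
  assumes "inf_graph \<phi> X f a" "inf_graph \<phi> X g b"
  shows "inf_graph \<phi> X (\<lambda>x'. f x' + g x') (vadd X a b)"
  using assms(1)
proof induction
  case (gen x)
  show ?case using inf_graph_add_gen[OF assms(2)] .
next
  case (inf f1 a1 f2 a2)
  then show ?case using inf_graph.inf[OF inf.IH] assms(2)
    by (simp add: add_inf inf_graph_closed inf_closed min_add_distrib_left add_comm[of _ b])
qed

lemma lat_graph_add_inf_graph:
  assumes "lat_graph \<phi> X g b" "inf_graph \<phi> X f a"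
  shows "lat_graph \<phi> X (\<lambda>x'. f x' + g x') (vadd X a b)"
  using assms(1)
proof induction
  case (base g b)
  show ?case using inf_graph_add[OF assms(2) base] by (rule lat_graph.base)
next
  case (sup g1 b1 g2 b2)
  then show ?case using lat_graph.sup[OF sup.IH] assms(2)
    by (simp add: add_sup inf_graph_closed lat_graph_closed max_add_distrib_right)
qed

lemma lat_graph_add:
  assumes "lat_graph \<phi> X f a" "lat_graph \<phi> X g b"
  shows "lat_graph \<phi> X (\<lambda>x'. f x' + g x') (vadd X a b)"
  using assms(1)
proof induction
  case (base f a)
  show ?case using lat_graph_add_inf_graph[OF assms(2) base] .
next
  case (sup f1 a1 f2 a2)
  then show ?case using lat_graph.sup[OF sup.IH] assms(2)
    by (simp add: add_sup lat_graph_closed sup_closed max_add_distrib_left add_comm[of _ b])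
qed

text \<open>The distributive law is needed here: an infimum with a supremum of rows has to be
  rewritten as a supremum of rows.\<close>

lemma lat_graph_inf_inf_graph:
  assumes "lat_graph \<phi> X g b" "inf_graph \<phi> X f a"
  shows "lat_graph \<phi> X (\<lambda>x'. min (f x') (g x')) (vinf X a b)"
  using assms(1)
proof induction
  case (base g b)
  show ?case using inf_graph.inf[OF assms(2) base] by (rule lat_graph.base)
next
  case (sup g1 b1 g2 b2)
  then show ?case using lat_graph.sup[OF sup.IH] assms(2)
    by (simp add: inf_sup_distrib inf_graph_closed lat_graph_closed min_max_distrib2)
qed

lemma lat_graph_inf:
  assumes "lat_graph \<phi> X f a" "lat_graph \<phi> X g b"
  shows "lat_graph \<phi> X (\<lambda>x'. min (f x') (g x')) (vinf X a b)"
  using assms(1)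
proof induction
  case (base f a)
  show ?case using lat_graph_inf_inf_graph[OF assms(2) base] .
next
  case (sup f1 a1 f2 a2)
  then show ?case using lat_graph.sup[OF sup.IH] assms(2)
    by (simp add: inf_sup_distrib lat_graph_closed vinf_commute[of _ b] min_max_distrib1)
qed

text \<open>Negation exchanges the two levels. The negative of a row is a supremum of generators;
  the negative of a supremum becomes an infimum of such, which \<open>lat_graph_inf\<close> brings
  back to normal form.\<close>

lemma lat_graph_neg_inf_graph:
  assumes "inf_graph \<phi> X f a"
  shows "lat_graph \<phi> X (\<lambda>x'. - f x') (vneg X a)"
  using assms
proof induction
  case (gen x)
  show ?case using lat_graph_gen[of "- x"] by (simp add: map_neg blinfun.minus_right)
next
  case (inf f a g b)
  then show ?case using lat_graph.sup[OF inf.IH]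
    by (simp add: neg_inf inf_graph_closed minus_min_eq_max)
qed

lemma lat_graph_neg:
  assumes "lat_graph \<phi> X f a"
  shows "lat_graph \<phi> X (\<lambda>x'. - f x') (vneg X a)"
  using assms
proof induction
  case (base f a)
  then show ?case by (rule lat_graph_neg_inf_graph)
next
  case (sup f a g b)
  then show ?case using lat_graph_inf[OF sup.IH]
    by (simp add: neg_sup lat_graph_closed minus_max_eq_min)
qed

lemma inf_graph_scale_nonneg:
  assumes "inf_graph \<phi> X f a" "0 \<le> r"
  shows "inf_graph \<phi> X (\<lambda>x'. r * f x') (vscale X r a)"
  using assms(1)
proof induction
  case (gen x)
  show ?case using inf_graph.gen[of \<phi> X "r *\<^sub>R x"] by (simp add: map_scale blinfun.scaleR_right)
next
  case (inf f a g b)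
  then show ?case using inf_graph.inf[OF inf.IH] \<open>0 \<le> r\<close>
    by (simp add: scale_inf inf_graph_closed min_mult_distrib_left)
qed

lemma lat_graph_scale_nonneg:
  assumes "lat_graph \<phi> X f a" "0 \<le> r"
  shows "lat_graph \<phi> X (\<lambda>x'. r * f x') (vscale X r a)"
  using assms(1)
proof induction
  case (base f a)
  then show ?case using inf_graph_scale_nonneg \<open>0 \<le> r\<close> by (intro lat_graph.base)
next
  case (sup f a g b)
  then show ?case using lat_graph.sup[OF sup.IH] \<open>0 \<le> r\<close>
    by (simp add: scale_sup lat_graph_closed max_mult_distrib_left)
qed

lemma lat_graph_scale:
  assumes "lat_graph \<phi> X f a"
  shows "lat_graph \<phi> X (\<lambda>x'. r * f x') (vscale X r a)"
proof (cases "0 \<le> r")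
  case True
  then show ?thesis using lat_graph_scale_nonneg assms by blast
next
  case False
  then show ?thesis
    using lat_graph_neg[OF lat_graph_scale_nonneg[OF assms, of "- r"]] lat_graph_closed[OF assms]
    by (simp add: vneg_def scale_scale)
qed

text \<open>\<open>A\<close> is the set of generators of the row. Of the facts that \<open>f\<close>
  is their minimum and \<open>a\<close> the infimum of their images, only these two inequalities are
  kept; they pass to unions and spare an infimum over finite sets in \<open>X\<close>.\<close>

lemma inf_graph_lower:
  assumes "inf_graph \<phi> X f a"
  shows "\<exists>A. finite A \<and> (\<forall>x'. \<exists>x\<in>A. blinfun_apply x' x \<le> f x') \<and> (\<forall>x\<in>A. vle X a (\<phi> x))"
  using assms
proof induction
  case (gen x)
  show ?case by (intro exI[of _ "{x}"]) (simp add: le_refl map_closed)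
next
  case (inf f a g b)
  then have ab: "a \<in> vcarrier X" "b \<in> vcarrier X" by (simp_all add: inf_graph_closed)
  obtain A B where A: "finite A" "\<forall>x'. \<exists>x\<in>A. blinfun_apply x' x \<le> f x'" "\<forall>x\<in>A. vle X a (\<phi> x)"
    and B: "finite B" "\<forall>x'. \<exists>x\<in>B. blinfun_apply x' x \<le> g x'" "\<forall>x\<in>B. vle X b (\<phi> x)"
    using inf.IH by blast
  have "vle X (vinf X a b) (\<phi> x)" if "x \<in> A \<union> B" for x
    using that A(3) B(3) ab le_trans[of "vinf X a b" a "\<phi> x"] le_trans[of "vinf X a b" b "\<phi> x"]
    by (auto simp: closed map_closed inf_le1 inf_le2)
  moreover have "\<exists>x\<in>A \<union> B. blinfun_apply x' x \<le> min (f x') (g x')" for x'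
    using A(2)[rule_format, of x'] B(2)[rule_format, of x'] unfolding min_def by auto
  ultimately show ?case using A(1) B(1) by (intro exI[of _ "A \<union> B"]) blast
qed

text \<open>If an infimum of linear forms is nowhere positive, then 0 is a convex combination of them, and
  the elements above \<open>a\<close> form a convex set.\<close>

lemma inf_graph_nonpos:
  assumes "inf_graph \<phi> X f a" "\<And>x'. f x' \<le> 0"
  shows "vle X a (vzero X)"
proof -
  have a: "a \<in> vcarrier X" using assms(1) by (rule inf_graph_closed)
  obtain A where A: "finite A" "\<forall>x'. \<exists>x\<in>A. blinfun_apply x' x \<le> f x'" "\<forall>x\<in>A. vle X a (\<phi> x)"
    using inf_graph_lower[OF assms(1)] by blast
  then have "0 \<in> convex hull A"
    using assms(2) by (intro zero_in_convex_hull_finite) (metis order_trans)+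
  also have "convex hull A \<subseteq> {x. vle X a (\<phi> x)}"
  proof (rule hull_minimal)
    show "convex {x. vle X a (\<phi> x)}"
    proof (rule convexI)
      fix x y and u v :: real
      assume *: "x \<in> {x. vle X a (\<phi> x)}" "y \<in> {x. vle X a (\<phi> x)}" "0 \<le> u" "0 \<le> v" "u + v = 1"
      have "vadd X (vscale X u a) (vscale X v a) = a"
        using a *(5) by (simp add: scale_one flip: scale_add_left)
      moreover have "vle X (vadd X (vscale X u a) (vscale X v a))
          (vadd X (vscale X u (\<phi> x)) (vscale X v a))"
        using a * by (intro add_mono scale_mono) (auto simp: closed map_closed)
      moreover have "vle X (vadd X (vscale X u (\<phi> x)) (vscale X v a))
          (vadd X (vscale X u (\<phi> x)) (vscale X v (\<phi> y)))"
        using a * by (intro add_mono_left scale_mono) (auto simp: closed map_closed)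
      ultimately show "u *\<^sub>R x + v *\<^sub>R y \<in> {x. vle X a (\<phi> x)}"
        using a le_trans[of a "vadd X (vscale X u (\<phi> x)) (vscale X v a)"
            "vadd X (vscale X u (\<phi> x)) (vscale X v (\<phi> y))"]
        by (simp add: map_add map_scale closed map_closed)
    qed
  qed (use A(3) in auto)
  finally show ?thesis by (simp add: map_zero)
qed

text \<open>A supremum is nonpositive exactly when each of its members is, so the rows can be
  treated separately. This is the reason for having the supremum as the outer operation of the
  normal form.\<close>

lemma lat_graph_nonpos:
  assumes "lat_graph \<phi> X f a" "\<And>x'. f x' \<le> 0"
  shows "vle X a (vzero X)"
  using assms
proof induction
  case (base f a)
  then show ?case by (rule inf_graph_nonpos)
next
  case (sup f a g b)
  then show ?case by (intro sup_least) (simp_all add: lat_graph_closed zero_closed)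
qed

text \<open>The difference of the two expressions again has a normal form, which reduces the
  comparison to one with 0.\<close>

lemma lat_graph_le:
  assumes "lat_graph \<phi> X f a" "lat_graph \<phi> X g b" "\<And>x'. f x' \<le> g x'"
  shows "vle X a b"
proof -
  have ab: "a \<in> vcarrier X" "b \<in> vcarrier X" using assms by (simp_all add: lat_graph_closed)
  have "vle X (vadd X (vneg X b) a) (vzero X)"
    by (rule lat_graph_nonpos[OF lat_graph_add[OF lat_graph_neg[OF assms(2)] assms(1)]])
      (simp add: assms(3))
  then show ?thesis
    using ab by (simp add: add_le_iff closed neg_neg add_zero)
qed

text \<open>The well-definedness of the extension: the function on the dual alone determines the
  element of \<open>X\<close>, whatever expression produced it.\<close>

lemma lat_graph_unique:
  assumes "lat_graph \<phi> X f a" "lat_graph \<phi> X f b"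
  shows "a = b"
  using lat_graph_le[OF assms] lat_graph_le[OF assms(2,1)] assms
  by (simp add: le_antisym lat_graph_closed)

end


section \<open>Transfer of inequalities from the reals\<close>

text \<open>\<open>vl_expr a b c d f x\<close>: some lattice-linear expression in four variables has the value \<open>x\<close> at
  \<open>a, b, c, d\<close> and defines \<open>f\<close> on the reals.\<close>

context vector_lattice
begin

text \<open>A linear map from R^4 that sends the unit vectors to \<open>a, b, c, d\<close>. A
  functional on R^4 amounts to its four values at the unit vectors, so \<open>lat_graph\<close> over
  this map pairs elements of \<open>X\<close> with functions of four real variables. Four elements
  occur in the estimates for differences of sums, suprema and infima; shorter statements repeat an
  element.\<close>

definition lin_comb4 :: "'a \<Rightarrow> 'a \<Rightarrow> 'a \<Rightarrow> 'a \<Rightarrow> real \<times> real \<times> real \<times> real \<Rightarrow> 'a"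
  where "lin_comb4 a b c d = (\<lambda>(p, q, r, s).
    vadd X (vadd X (vscale X p a) (vscale X q b)) (vadd X (vscale X r c) (vscale X s d)))"

definition vl_expr ::
    "'a \<Rightarrow> 'a \<Rightarrow> 'a \<Rightarrow> 'a \<Rightarrow> (real \<Rightarrow> real \<Rightarrow> real \<Rightarrow> real \<Rightarrow> real) \<Rightarrow> 'a \<Rightarrow> bool"
  where "vl_expr a b c d f x \<longleftrightarrow> {a, b, c, d} \<subseteq> vcarrier X \<and>
    lat_graph (lin_comb4 a b c d) X
      (\<lambda>x'. f (blinfun_apply x' (1, 0, 0, 0)) (blinfun_apply x' (0, 1, 0, 0))
        (blinfun_apply x' (0, 0, 1, 0)) (blinfun_apply x' (0, 0, 0, 1))) x"

lemma linear_into_lin_comb4: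
  assumes "{a, b, c, d} \<subseteq> vcarrier X"
  shows "linear_into_vlat X (lin_comb4 a b c d)"
proof unfold_locales
  show "linear_into (lin_comb4 a b c d) X"
    unfolding linear_into_def
  proof (intro conjI allI)
    fix x y :: "real \<times> real \<times> real \<times> real" and t :: real
    obtain p q r s p' q' r' s' where xy: "x = (p, q, r, s)" "y = (p', q', r', s')"
      by (metis surj_pair)
    have swap: "vadd X (vadd X u v) (vadd X w z) = vadd X (vadd X u w) (vadd X v z)"
      if "u \<in> vcarrier X" "v \<in> vcarrier X" "w \<in> vcarrier X" "z \<in> vcarrier X" for u v w z
      using that add_left_comm[of v w z] by (simp add: add_assoc closed)
    show "lin_comb4 a b c d x \<in> vcarrier X"
      using assms by (simp add: lin_comb4_def xy closed)
    show "lin_comb4 a b c d (t *\<^sub>R x) = vscale X t (lin_comb4 a b c d x)"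
      using assms by (simp add: lin_comb4_def xy closed scale_add_right scale_scale)
    show "lin_comb4 a b c d (x + y) = vadd X (lin_comb4 a b c d x) (lin_comb4 a b c d y)"
      using assms by (simp add: lin_comb4_def xy scale_add_left)
        (simp add: closed swap[of "vscale X p a" "vscale X p' a" "vscale X q b" "vscale X q' b"]
          swap[of "vscale X r c" "vscale X r' c" "vscale X s d" "vscale X s' d"]
          swap[of "vadd X (vscale X p a) (vscale X q b)" "vadd X (vscale X p' a) (vscale X q' b)"
            "vadd X (vscale X r c) (vscale X s d)" "vadd X (vscale X r' c) (vscale X s' d)"])
  qed
qed

lemma vl_expr_gens:
  assumes "a \<in> vcarrier X" "b \<in> vcarrier X" "c \<in> vcarrier X" "d \<in> vcarrier X"
  shows "vl_expr a b c d (\<lambda>p q r s. p) a" "vl_expr a b c d (\<lambda>p q r s. q) b"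
    "vl_expr a b c d (\<lambda>p q r s. r) c" "vl_expr a b c d (\<lambda>p q r s. s) d"
proof -
  interpret linear_into_vlat X "lin_comb4 a b c d"
    using assms by (intro linear_into_lin_comb4) simp
  show "vl_expr a b c d (\<lambda>p q r s. p) a" "vl_expr a b c d (\<lambda>p q r s. q) b"
    "vl_expr a b c d (\<lambda>p q r s. r) c" "vl_expr a b c d (\<lambda>p q r s. s) d"
    using assms lat_graph_gen[of "(1, 0, 0, 0)"] lat_graph_gen[of "(0, 1, 0, 0)"]
      lat_graph_gen[of "(0, 0, 1, 0)"] lat_graph_gen[of "(0, 0, 0, 1)"]
    by (simp_all add: vl_expr_def lin_comb4_def scale_one scale_zero_left add_zero zero_add closed)
qed

lemma
  assumes "vl_expr a b c d f x"
  shows vl_expr_carrier: "{a, b, c, d} \<subseteq> vcarrier X"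
    and vl_expr_graph: "lat_graph (lin_comb4 a b c d) X
      (\<lambda>x'. f (blinfun_apply x' (1, 0, 0, 0)) (blinfun_apply x' (0, 1, 0, 0))
        (blinfun_apply x' (0, 0, 1, 0)) (blinfun_apply x' (0, 0, 0, 1))) x"
  using assms by (simp_all add: vl_expr_def)

context
  fixes a b c d f x
  assumes f: "vl_expr a b c d f x"
begin

interpretation linear_into_vlat X "lin_comb4 a b c d"
  using f by (intro linear_into_lin_comb4) (rule vl_expr_carrier)

lemma vl_expr_scale: "vl_expr a b c d (\<lambda>p q r s. k * f p q r s) (vscale X k x)"
  unfolding vl_expr_def using vl_expr_carrier[OF f] lat_graph_scale[OF vl_expr_graph[OF f]] by blast

lemma vl_expr_neg: "vl_expr a b c d (\<lambda>p q r s. - f p q r s) (vneg X x)"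
  unfolding vl_expr_def using vl_expr_carrier[OF f] lat_graph_neg[OF vl_expr_graph[OF f]] by blast

context
  fixes g y
  assumes g: "vl_expr a b c d g y"
begin

lemma vl_expr_add: "vl_expr a b c d (\<lambda>p q r s. f p q r s + g p q r s) (vadd X x y)"
  unfolding vl_expr_def
  using vl_expr_carrier[OF f] lat_graph_add[OF vl_expr_graph[OF f] vl_expr_graph[OF g]] by blast

lemma vl_expr_sup: "vl_expr a b c d (\<lambda>p q r s. max (f p q r s) (g p q r s)) (vsup X x y)"
  unfolding vl_expr_def
  using vl_expr_carrier[OF f] lat_graph.sup[OF vl_expr_graph[OF f] vl_expr_graph[OF g]] by blast

lemma vl_expr_inf: "vl_expr a b c d (\<lambda>p q r s. min (f p q r s) (g p q r s)) (vinf X x y)"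
  unfolding vl_expr_def
  using vl_expr_carrier[OF f] lat_graph_inf[OF vl_expr_graph[OF f] vl_expr_graph[OF g]] by blast

text \<open>The transfer principle. In applications the introduction rules build \<open>f\<close>
  and \<open>g\<close> from the shape of \<open>x\<close> and \<open>y\<close>, and what remains is
  an inequality between real numbers.\<close>

lemma vl_expr_le:
  assumes "\<And>p q r s. f p q r s \<le> g p q r s"
  shows "vle X x y"
  using lat_graph_le[OF vl_expr_graph[OF f] vl_expr_graph[OF g]] assms by simp

end

end

lemma vl_expr_zero:
  assumes "a \<in> vcarrier X" "b \<in> vcarrier X" "c \<in> vcarrier X" "d \<in> vcarrier X"
  shows "vl_expr a b c d (\<lambda>p q r s. 0) (vzero X)"
  using vl_expr_scale[OF vl_expr_gens(1)[OF assms], of 0] assms by (simp add: scale_zero_left)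

lemma vl_expr_diff:
  assumes "vl_expr a b c d f x" "vl_expr a b c d g y"
  shows "vl_expr a b c d (\<lambda>p q r s. f p q r s - g p q r s) (vdiff X x y)"
  using vl_expr_add[OF assms(1) vl_expr_neg[OF assms(2)]] by (simp add: vdiff_def)

lemma vl_expr_abs:
  assumes "vl_expr a b c d f x"
  shows "vl_expr a b c d (\<lambda>p q r s. \<bar>f p q r s\<bar>) (vabs X x)"
proof -
  have "(\<lambda>p q r s. max (f p q r s) (- f p q r s)) = (\<lambda>p q r s. \<bar>f p q r s\<bar>)"
    by (auto simp: fun_eq_iff max_def)
  then show ?thesis using vl_expr_sup[OF assms vl_expr_neg[OF assms]] by (simp add: vabs_def)
qed

lemmas vl_expr_intros = vl_expr_gens vl_expr_zero vl_expr_add vl_expr_scale vl_expr_neg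
  vl_expr_diff vl_expr_sup vl_expr_inf vl_expr_abs

lemma vl_expr_eq:
  assumes "vl_expr a b c d f x" "vl_expr a b c d g y" "\<And>p q r s. f p q r s = g p q r s"
  shows "x = y"
proof -
  interpret linear_into_vlat X "lin_comb4 a b c d"
    using assms(1) by (intro linear_into_lin_comb4) (rule vl_expr_carrier)
  show ?thesis
    using vl_expr_graph[OF assms(1)] vl_expr_graph[OF assms(2)]
    unfolding assms(3) by (rule lat_graph_unique)
qed

end


section \<open>The free vector lattice\<close>

lemma fun_vlat_simps [simp]:
  "vcarrier fun_vlat = UNIV" "vzero fun_vlat = (\<lambda>_. 0)"
  "vadd fun_vlat f g = (\<lambda>x. f x + g x)" "vscale fun_vlat r f = (\<lambda>x. r * f x)"
  "vle fun_vlat f g \<longleftrightarrow> (\<forall>x. f x \<le> g x)"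
  by (simp_all add: fun_vlat_def)

lemma is_vsup_fun_vlat: "is_vsup fun_vlat f g (\<lambda>x. max (f x) (g x))"
  by (auto simp: is_vsup_def)

lemma is_vinf_fun_vlat: "is_vinf fun_vlat f g (\<lambda>x. min (f x) (g x))"
  by (auto simp: is_vinf_def)

lemma vector_lattice_fun_vlat: "vector_lattice fun_vlat"
proof
  show "\<exists>s. is_vsup fun_vlat f g s" "\<exists>s. is_vinf fun_vlat f g s" for f g :: "'x \<Rightarrow> real"
    using is_vsup_fun_vlat is_vinf_fun_vlat by blast+
qed (auto simp: vneg_def algebra_simps fun_eq_iff intro: order_trans antisym mult_left_mono)

lemma vsup_fun_vlat: "vsup fun_vlat f g = (\<lambda>x. max (f x) (g x))"
  using vector_lattice.vsup_eqI[OF vector_lattice_fun_vlat is_vsup_fun_vlat] .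

lemma vinf_fun_vlat: "vinf fun_vlat f g = (\<lambda>x. min (f x) (g x))"
  using vector_lattice.vinf_eqI[OF vector_lattice_fun_vlat is_vinf_fun_vlat] .

lemma fvl_ops [simp]:
  "vzero fvl = (\<lambda>_. 0)" "vadd fvl f g = (\<lambda>x. f x + g x)" "vscale fvl r f = (\<lambda>x. r * f x)"
  "vle fvl f g \<longleftrightarrow> (\<forall>x. f x \<le> g x)" "vneg fvl f = (\<lambda>x. - f x)" "vdiff fvl f g = (\<lambda>x. f x - g x)"
  by (simp_all add: fvl_def vneg_def vdiff_def)

lemma ev_add: "ev (x + y) = (\<lambda>x'. ev x x' + ev y x')"
  by (simp add: ev_def blinfun.add_right)

lemma ev_scale: "ev (r *\<^sub>R x) = (\<lambda>x'. r * ev x x')"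
  by (simp add: ev_def blinfun.scaleR_right)

lemma fvl_closed:
  shows ev_in_fvl: "ev x \<in> vcarrier fvl"
    and zero_in_fvl: "(\<lambda>_. 0) \<in> vcarrier fvl"
    and add_in_fvl: "\<lbrakk>f \<in> vcarrier fvl; g \<in> vcarrier fvl\<rbrakk> \<Longrightarrow> (\<lambda>x'. f x' + g x') \<in> vcarrier fvl"
    and scale_in_fvl: "f \<in> vcarrier fvl \<Longrightarrow> (\<lambda>x'. r * f x') \<in> vcarrier fvl"
    and max_in_fvl: "\<lbrakk>f \<in> vcarrier fvl; g \<in> vcarrier fvl\<rbrakk> \<Longrightarrow> (\<lambda>x'. max (f x') (g x')) \<in> vcarrier fvl"
    and min_in_fvl: "\<lbrakk>f \<in> vcarrier fvl; g \<in> vcarrier fvl\<rbrakk> \<Longrightarrow> (\<lambda>x'. min (f x') (g x')) \<in> vcarrier fvl"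
  unfolding fvl_def
  by (auto simp: generated_sublattice_def vector_sublattice_def vsup_fun_vlat vinf_fun_vlat)

text \<open>The members of \<open>fvl\<close> with property \<open>P\<close> form a sublattice that
  contains the generators. The zero function is covered by the case of \<open>ev 0\<close>.\<close>

lemma fvl_induct [consumes 1, case_names ev add scale max min]:
  assumes "f \<in> vcarrier fvl"
    and ev: "\<And>x. P (ev x)"
    and add: "\<And>f g. \<lbrakk>f \<in> vcarrier fvl; g \<in> vcarrier fvl; P f; P g\<rbrakk> \<Longrightarrow> P (\<lambda>x'. f x' + g x')"
    and scale: "\<And>r f. \<lbrakk>f \<in> vcarrier fvl; P f\<rbrakk> \<Longrightarrow> P (\<lambda>x'. r * f x')"
    and max: "\<And>f g. \<lbrakk>f \<in> vcarrier fvl; g \<in> vcarrier fvl; P f; P g\<rbrakk> \<Longrightarrow> P (\<lambda>x'. max (f x') (g x'))"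
    and min: "\<And>f g. \<lbrakk>f \<in> vcarrier fvl; g \<in> vcarrier fvl; P f; P g\<rbrakk> \<Longrightarrow> P (\<lambda>x'. min (f x') (g x'))"
  shows "P f"
proof -
  have "P (\<lambda>_. 0)" using ev[of 0] by (simp add: ev_def)
  then have "vector_sublattice fun_vlat {f \<in> vcarrier fvl. P f}"
    unfolding vector_sublattice_def
    by (simp add: vsup_fun_vlat vinf_fun_vlat fvl_closed add scale max min)
  moreover have "range ev \<subseteq> {f \<in> vcarrier fvl. P f}" using ev ev_in_fvl by auto
  ultimately show ?thesis
    using assms(1) unfolding fvl_def by (auto simp: generated_sublattice_def)
qed

lemma is_vsup_fvl:
  "\<lbrakk>f \<in> vcarrier fvl; g \<in> vcarrier fvl\<rbrakk> \<Longrightarrow> is_vsup fvl f g (\<lambda>x'. max (f x') (g x'))"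
  by (auto simp: is_vsup_def max_in_fvl)

lemma is_vinf_fvl:
  "\<lbrakk>f \<in> vcarrier fvl; g \<in> vcarrier fvl\<rbrakk> \<Longrightarrow> is_vinf fvl f g (\<lambda>x'. min (f x') (g x'))"
  by (auto simp: is_vinf_def min_in_fvl)

interpretation fvl: vector_lattice fvl
proof
  fix f g :: "'e::banach dual_fun" assume "f \<in> vcarrier fvl" "g \<in> vcarrier fvl"
  then show "\<exists>s. is_vsup fvl f g s" "\<exists>s. is_vinf fvl f g s"
    using is_vsup_fvl is_vinf_fvl by blast+
qed (auto simp: fvl_closed algebra_simps fun_eq_iff intro: order_trans antisym mult_left_mono)

lemma vsup_fvl: "\<lbrakk>f \<in> vcarrier fvl; g \<in> vcarrier fvl\<rbrakk> \<Longrightarrow> vsup fvl f g = (\<lambda>x'. max (f x') (g x'))"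
  using fvl.vsup_eqI is_vsup_fvl by blast

lemma vinf_fvl: "\<lbrakk>f \<in> vcarrier fvl; g \<in> vcarrier fvl\<rbrakk> \<Longrightarrow> vinf fvl f g = (\<lambda>x'. min (f x') (g x'))"
  using fvl.vinf_eqI is_vinf_fvl by blast

lemma linear_into_ev: "linear_into ev fvl"
  by (simp add: linear_into_def ev_in_fvl ev_add ev_scale)

lemma vlat_hom_fvl_iff:
  "h \<in> vlat_hom fvl G \<longleftrightarrow> h \<in> vcarrier fvl \<rightarrow>\<^sub>E vcarrier G \<and>
    (\<forall>f\<in>vcarrier fvl. \<forall>g\<in>vcarrier fvl. h (\<lambda>x'. f x' + g x') = vadd G (h f) (h g)) \<and>
    (\<forall>r. \<forall>f\<in>vcarrier fvl. h (\<lambda>x'. r * f x') = vscale G r (h f)) \<and>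
    (\<forall>f\<in>vcarrier fvl. \<forall>g\<in>vcarrier fvl. h (\<lambda>x'. max (f x') (g x')) = vsup G (h f) (h g)) \<and>
    (\<forall>f\<in>vcarrier fvl. \<forall>g\<in>vcarrier fvl. h (\<lambda>x'. min (f x') (g x')) = vinf G (h f) (h g))"
  by (simp add: vlat_hom_def vsup_fvl vinf_fvl)

lemma vlat_hom_fvl_ext:
  fixes h k :: "'e::banach dual_fun \<Rightarrow> 'g"
  assumes "h \<in> vlat_hom fvl G" "k \<in> vlat_hom fvl G" "h \<circ> ev = k \<circ> ev"
  shows "h = k"
proof (rule PiE_ext)
  show "h \<in> vcarrier fvl \<rightarrow>\<^sub>E vcarrier G" "k \<in> vcarrier fvl \<rightarrow>\<^sub>E vcarrier G"
    using assms by (simp_all add: vlat_hom_def)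
  fix f :: "'e dual_fun" assume "f \<in> vcarrier fvl"
  then show "h f = k f"
  proof (induction rule: fvl_induct)
    case (ev x)
    show ?case using assms(3) by (simp add: fun_eq_iff)
  qed (use assms(1,2) in \<open>simp_all add: vlat_hom_fvl_iff\<close>)
qed

text \<open>\<open>lat_graph \<phi> G\<close> is the graph of the extension: it is total on
  \<open>fvl\<close> by induction, single-valued by \<open>lat_graph_unique\<close>, and its closure
  properties are the homomorphism laws.\<close>

lemma ex1_vlat_hom_fvl:
  fixes G :: "('g, 'n) vlat_scheme" and \<phi> :: "'e::banach \<Rightarrow> 'g"
  assumes "vector_lattice G" "linear_into \<phi> G"
  shows "\<exists>!h. h \<in> vlat_hom fvl G \<and> h \<circ> ev = \<phi>"
proof -
  interpret linear_into_vlat G \<phi>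
    using assms by (simp add: linear_into_vlat_def linear_into_vlat_axioms_def)
  have ex: "\<exists>a. lat_graph \<phi> G f a" if "f \<in> vcarrier fvl" for f
    using that
  proof (induction rule: fvl_induct)
    case (ev x)
    show ?case using lat_graph_gen unfolding ev_def by blast
  qed (blast intro: lat_graph_add lat_graph_scale lat_graph.sup lat_graph_inf)+
  define h where "h = (\<lambda>f\<in>vcarrier fvl. THE a. lat_graph \<phi> G f a)"
  have h_eq: "h f = a" if "f \<in> vcarrier fvl" "lat_graph \<phi> G f a" for f a
    using that lat_graph_unique by (auto simp: h_def)
  have h_graph: "lat_graph \<phi> G f (h f)" if "f \<in> vcarrier fvl" for f
    using ex[OF that] h_eq[OF that] by auto
  have "h \<in> vlat_hom fvl G"
    unfolding vlat_hom_fvl_iff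
  proof (intro conjI ballI allI)
    show "h \<in> vcarrier fvl \<rightarrow>\<^sub>E vcarrier G"
      using h_graph lat_graph_closed by (auto simp: h_def)
  qed (simp_all add: h_eq fvl_closed h_graph lat_graph_add lat_graph_scale lat_graph.sup
      lat_graph_inf)
  moreover have "h \<circ> ev = \<phi>"
    using h_eq[OF ev_in_fvl] lat_graph_gen by (auto simp: fun_eq_iff ev_def)
  ultimately show ?thesis using vlat_hom_fvl_ext by blast
qed

lemma free_vector_lattice_fvl: "free_vector_lattice TYPE('g) (ev :: 'e::banach \<Rightarrow> 'e dual_fun) fvl"
  unfolding free_vector_lattice_def
  using fvl.vector_lattice_axioms linear_into_ev ex1_vlat_hom_fvl by blast

lemma
  assumes "vector_lattice G" "linear_into \<phi> G"
  shows lift_hom: "lift \<phi> G \<in> vlat_hom fvl G"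
    and lift_ev: "lift \<phi> G (ev x) = \<phi> x"
  using theI'[OF ex1_vlat_hom_fvl[OF assms]] unfolding lift_def by (auto simp: fun_eq_iff)

lemma lift_eqI:
  assumes "vector_lattice G" "linear_into \<phi> G" "h \<in> vlat_hom fvl G" "\<And>x. h (ev x) = \<phi> x"
  shows "lift \<phi> G = h"
  using assms lift_hom[OF assms(1,2)] lift_ev[OF assms(1,2)]
  by (intro vlat_hom_fvl_ext) (auto simp: fun_eq_iff)


section \<open>Normed vector lattices\<close>

locale normed_vector_lattice = vector_lattice X for X :: "('a, 'm) vlat_scheme" +
  fixes \<rho> :: "'a \<Rightarrow> real"
  assumes vlnorm: "vector_lattice_norm X \<rho>"
begin

lemma
  assumes "a \<in> vcarrier X"
  shows norm_nonneg: "0 \<le> \<rho> a"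
    and norm_eq_zero_iff: "\<rho> a = 0 \<longleftrightarrow> a = vzero X"
    and norm_scale: "\<rho> (vscale X r a) = \<bar>r\<bar> * \<rho> a"
    and norm_triangle: "b \<in> vcarrier X \<Longrightarrow> \<rho> (vadd X a b) \<le> \<rho> a + \<rho> b"
    and norm_mono: "\<lbrakk>b \<in> vcarrier X; vle X (vabs X a) (vabs X b)\<rbrakk> \<Longrightarrow> \<rho> a \<le> \<rho> b"
  using vlnorm assms unfolding vector_lattice_norm_def by blast+

lemma norm_zero: "\<rho> (vzero X) = 0"
  using norm_eq_zero_iff[OF zero_closed] by simp

text \<open>The bridge from order to norm used for nearly all estimates below: it leaves an
  inequality between absolute values in \<open>X\<close>, which \<open>vl_expr_le\<close> reduces to
  the reals.\<close>

lemma norm_le_add: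
  assumes x: "x \<in> vcarrier X" and y: "y \<in> vcarrier X" and z: "z \<in> vcarrier X"
    and le: "vle X (vabs X x) (vadd X (vabs X y) (vabs X z))"
  shows "\<rho> x \<le> \<rho> y + \<rho> z"
proof -
  have abs_abs: "vabs X (vabs X w) = vabs X w" if w: "w \<in> vcarrier X" for w
    by (rule vl_expr_eq[of w w w w], (rule vl_expr_intros w)+, simp)
  have "vabs X (vadd X (vabs X y) (vabs X z)) = vadd X (vabs X y) (vabs X z)"
    by (rule vl_expr_eq[of y z y z], (rule vl_expr_intros y z)+, simp)
  then have "\<rho> x \<le> \<rho> (vadd X (vabs X y) (vabs X z))"
    using assms by (intro norm_mono) (simp_all add: closed)
  also have "\<dots> \<le> \<rho> (vabs X y) + \<rho> (vabs X z)"
    using y z by (intro norm_triangle closed)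
  \<comment> \<open>An element and its absolute value have the same absolute value, so monotonicity
    of the norm compares them.\<close>
  also have "\<dots> \<le> \<rho> y + \<rho> z"
    using y z by (intro add_mono_thms_linordered_semiring(1) conjI norm_mono closed)
      (simp_all add: abs_abs le_refl closed)
  finally show ?thesis .
qed

lemma norm_neg: "a \<in> vcarrier X \<Longrightarrow> \<rho> (vneg X a) = \<rho> a"
  by (simp add: vneg_def norm_scale)

lemma
  assumes "a \<in> vcarrier X" "b \<in> vcarrier X"
  shows norm_sup_le: "\<rho> (vsup X a b) \<le> \<rho> a + \<rho> b"
    and norm_inf_le: "\<rho> (vinf X a b) \<le> \<rho> a + \<rho> b"
  by (rule norm_le_add, (intro closed assms)+, rule vl_expr_le[of a b a b],
      (rule vl_expr_intros assms)+, linarith)+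

lemma norm_diff_eq_zero_iff:
  assumes "a \<in> vcarrier X" "b \<in> vcarrier X"
  shows "\<rho> (vdiff X a b) = 0 \<longleftrightarrow> a = b"
proof
  assume "\<rho> (vdiff X a b) = 0"
  then have "vadd X b (vdiff X a b) = vadd X b (vzero X)"
    using assms by (simp add: norm_eq_zero_iff closed)
  moreover have "vadd X b (vdiff X a b) = a"
    by (rule vl_expr_eq[of a b a b], (rule vl_expr_intros assms)+, simp)
  ultimately show "a = b" using assms by (simp add: add_zero)
qed (use assms in \<open>simp add: vdiff_def add_neg norm_zero\<close>)

lemma norm_diff_commute:
  assumes "a \<in> vcarrier X" "b \<in> vcarrier X"
  shows "\<rho> (vdiff X a b) = \<rho> (vdiff X b a)"
proof -
  have "vdiff X a b = vneg X (vdiff X b a)"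
    by (rule vl_expr_eq[of a b a b], (rule vl_expr_intros assms)+, simp)
  then show ?thesis using assms by (simp add: norm_neg closed)
qed

lemma norm_diff_triangle:
  assumes "a \<in> vcarrier X" "b \<in> vcarrier X" "c \<in> vcarrier X"
  shows "\<rho> (vdiff X a c) \<le> \<rho> (vdiff X a b) + \<rho> (vdiff X b c)"
  by (rule norm_le_add, (intro closed assms)+, rule vl_expr_le[of a b c a],
      (rule vl_expr_intros assms)+, linarith)

lemma norm_le_norm_add_diff:
  assumes "a \<in> vcarrier X" "b \<in> vcarrier X"
  shows "\<rho> a \<le> \<rho> b + \<rho> (vdiff X a b)"
  by (rule norm_le_add, (intro closed assms)+, rule vl_expr_le[of a b a b],
      (rule vl_expr_intros assms)+, linarith)

lemma abs_norm_diff_le: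
  assumes "a \<in> vcarrier X" "b \<in> vcarrier X"
  shows "\<bar>\<rho> a - \<rho> b\<bar> \<le> \<rho> (vdiff X a b)"
  using norm_le_norm_add_diff[OF assms] norm_le_norm_add_diff[OF assms(2,1)]
    norm_diff_commute[OF assms] by simp

lemma norm_diff_scale:
  assumes "a \<in> vcarrier X" "b \<in> vcarrier X"
  shows "\<rho> (vdiff X (vscale X r a) (vscale X r b)) = \<bar>r\<bar> * \<rho> (vdiff X a b)"
proof -
  have "vdiff X (vscale X r a) (vscale X r b) = vscale X r (vdiff X a b)"
    by (rule vl_expr_eq[of a b a b], (rule vl_expr_intros assms)+,
        simp add: algebra_simps)
  then show ?thesis using assms by (simp add: norm_scale closed)
qed

context
  fixes a b c d
  assumes abcd: "a \<in> vcarrier X" "b \<in> vcarrier X" "c \<in> vcarrier X" "d \<in> vcarrier X"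
begin

lemma norm_diff_add: "\<rho> (vdiff X (vadd X a b) (vadd X c d)) \<le> \<rho> (vdiff X a c) + \<rho> (vdiff X b d)"
  by (rule norm_le_add, (intro closed abcd)+, rule vl_expr_le[of a b c d],
      (rule vl_expr_intros abcd)+, linarith)

text \<open>Uniform continuity of the lattice operations, from \<open>\<bar>max a b - max c d\<bar>
  \<le> \<bar>a - c\<bar> + \<bar>b - d\<bar>\<close>. It allows suprema in the completion and in
  limits to be computed termwise.\<close>

lemma norm_diff_sup: "\<rho> (vdiff X (vsup X a b) (vsup X c d)) \<le> \<rho> (vdiff X a c) + \<rho> (vdiff X b d)"
  by (rule norm_le_add, (intro closed abcd)+, rule vl_expr_le[of a b c d],
      (rule vl_expr_intros abcd)+, linarith)

lemma norm_diff_inf: "\<rho> (vdiff X (vinf X a b) (vinf X c d)) \<le> \<rho> (vdiff X a c) + \<rho> (vdiff X b d)"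
  by (rule norm_le_add, (intro closed abcd)+, rule vl_expr_le[of a b c d],
      (rule vl_expr_intros abcd)+, linarith)

end


subsection \<open>Sequences with vanishing difference\<close>

text \<open>One relation with two uses: between Cauchy sequences it is the equivalence that defines
  the completion, and against a constant sequence it is convergence. Independence of representatives
  and the limit laws are then the same lemmas.\<close>

definition asymp :: "(nat \<Rightarrow> 'a) \<Rightarrow> (nat \<Rightarrow> 'a) \<Rightarrow> bool"
  where "asymp s t \<longleftrightarrow> range s \<subseteq> vcarrier X \<and> range t \<subseteq> vcarrier X \<and>
    (\<lambda>n. \<rho> (vdiff X (s n) (t n))) \<longlonglongrightarrow> 0"

lemma asymp_closed:
  assumes "asymp s t"
  shows "s n \<in> vcarrier X" "t n \<in> vcarrier X"
  using assms by (auto simp: asymp_def)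

lemma asympI:
  assumes "\<And>n. s n \<in> vcarrier X" "\<And>n. t n \<in> vcarrier X"
    and "\<And>n. \<rho> (vdiff X (s n) (t n)) \<le> e n" "e \<longlonglongrightarrow> 0"
  shows "asymp s t"
proof -
  have "(\<lambda>n. \<rho> (vdiff X (s n) (t n))) \<longlonglongrightarrow> 0"
    by (rule tendsto_sandwich[OF _ _ tendsto_const assms(4)])
      (use assms(1-3) in \<open>auto simp: norm_nonneg closed\<close>)
  then show ?thesis using assms(1,2) by (auto simp: asymp_def)
qed

lemma asympD: "asymp s t \<Longrightarrow> (\<lambda>n. \<rho> (vdiff X (s n) (t n))) \<longlonglongrightarrow> 0"
  by (simp add: asymp_def)

lemma asymp_refl: "(\<And>n. s n \<in> vcarrier X) \<Longrightarrow> asymp s s"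
  by (rule asympI[of _ _ "\<lambda>_. 0"]) (simp_all add: norm_diff_eq_zero_iff[THEN iffD2, OF _ _ refl])

lemma asymp_sym: "asymp s t \<Longrightarrow> asymp t s"
  by (rule asympI[OF _ _ _ asympD]) (simp_all add: asymp_closed norm_diff_commute)

lemma asymp_trans:
  assumes "asymp s t" "asymp t u"
  shows "asymp s u"
  by (rule asympI[OF _ _ _ tendsto_add_zero[OF asympD[OF assms(1)] asympD[OF assms(2)]]])
    (simp_all add: asymp_closed[OF assms(1)] asymp_closed[OF assms(2)] norm_diff_triangle)

lemma
  assumes "asymp s t" "asymp s' t'"
  shows asymp_add: "asymp (\<lambda>n. vadd X (s n) (s' n)) (\<lambda>n. vadd X (t n) (t' n))"
    and asymp_sup: "asymp (\<lambda>n. vsup X (s n) (s' n)) (\<lambda>n. vsup X (t n) (t' n))"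
    and asymp_inf: "asymp (\<lambda>n. vinf X (s n) (s' n)) (\<lambda>n. vinf X (t n) (t' n))"
  by (rule asympI[OF _ _ _ tendsto_add_zero[OF asympD[OF assms(1)] asympD[OF assms(2)]]],
      simp_all add: closed asymp_closed[OF assms(1)] asymp_closed[OF assms(2)]
        norm_diff_add norm_diff_sup norm_diff_inf)+

lemma asymp_scale:
  assumes "asymp s t"
  shows "asymp (\<lambda>n. vscale X r (s n)) (\<lambda>n. vscale X r (t n))"
  by (rule asympI[OF _ _ _ tendsto_mult_right_zero[OF asympD[OF assms], of "\<bar>r\<bar>"]])
    (simp_all add: closed asymp_closed[OF assms] norm_diff_scale)

lemma asymp_norm:
  assumes "asymp s t"
  shows "(\<lambda>n. \<rho> (s n) - \<rho> (t n)) \<longlonglongrightarrow> 0"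
proof (rule Lim_null_comparison[OF _ asympD[OF assms]])
  show "\<forall>\<^sub>F n in sequentially. norm (\<rho> (s n) - \<rho> (t n)) \<le> \<rho> (vdiff X (s n) (t n))"
    by (simp add: abs_norm_diff_le asymp_closed[OF assms])
qed

lemma asymp_const_iff:
  assumes "a \<in> vcarrier X" "b \<in> vcarrier X"
  shows "asymp (\<lambda>_. a) (\<lambda>_. b) \<longleftrightarrow> a = b"
  using assms by (auto simp: asymp_def tendsto_const_iff norm_diff_eq_zero_iff)

lemma asymp_limit_unique:
  assumes "asymp s (\<lambda>_. a)" "asymp s (\<lambda>_. b)"
  shows "a = b"
  using asymp_trans[OF asymp_sym[OF assms(1)] assms(2)] asymp_closed(2)[OF assms(1)]
    asymp_closed(2)[OF assms(2)] by (simp add: asymp_const_iff)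

lemma asymp_limit_norm:
  assumes "asymp s (\<lambda>_. a)"
  shows "(\<lambda>n. \<rho> (s n)) \<longlonglongrightarrow> \<rho> a"
  using tendsto_add[OF asymp_norm[OF assms] tendsto_const[of "\<rho> a"]] by simp

section \<open>Cauchy sequences and termwise operations on them\<close>

lemma cauchy_seqs_closed: "s \<in> cauchy_seqs X \<rho> \<Longrightarrow> s n \<in> vcarrier X"
  by (simp add: cauchy_seqs_def)

lemma cauchy_seqsI:
  assumes "\<And>n. s n \<in> vcarrier X"
    and "\<And>e. 0 < e \<Longrightarrow> \<exists>N. \<forall>m\<ge>N. \<forall>n\<ge>N. \<rho> (vdiff X (s m) (s n)) \<le> e"
  shows "s \<in> cauchy_seqs X \<rho>"
  unfolding cauchy_seqs_def
proof (intro CollectI conjI allI impI assms(1))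
  fix e :: real assume "0 < e"
  then obtain N where "\<forall>m\<ge>N. \<forall>n\<ge>N. \<rho> (vdiff X (s m) (s n)) \<le> e / 2"
    using assms(2)[of "e / 2"] by auto
  moreover have "e / 2 < e" using \<open>0 < e\<close> by simp
  ultimately show "\<exists>N. \<forall>m\<ge>N. \<forall>n\<ge>N. \<rho> (vdiff X (s m) (s n)) < e"
    by (meson order_le_less_trans)
qed

text \<open>\<open>C = 1\<close> serves sums, suprema and infima; \<open>C = \<bar>r\<bar>\<close>
  with twice the same sequence serves scalar multiples.\<close>

lemma cauchy_seqs_dominated:
  assumes "\<And>n. s n \<in> vcarrier X" "t \<in> cauchy_seqs X \<rho>" "u \<in> cauchy_seqs X \<rho>" "0 \<le> C"
    and le: "\<And>m n. \<rho> (vdiff X (s m) (s n)) \<le> C * (\<rho> (vdiff X (t m) (t n)) + \<rho> (vdiff X (u m) (u n)))"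
  shows "s \<in> cauchy_seqs X \<rho>"
proof (rule cauchy_seqsI)
  fix e :: real assume "0 < e"
  \<comment> \<open>The summand 1 keeps the denominator positive when \<open>C = 0\<close>.\<close>
  then have "0 < e / (2 * (C + 1))" using \<open>0 \<le> C\<close> by simp
  then obtain M N where M: "\<forall>m\<ge>M. \<forall>n\<ge>M. \<rho> (vdiff X (t m) (t n)) < e / (2 * (C + 1))"
    and N: "\<forall>m\<ge>N. \<forall>n\<ge>N. \<rho> (vdiff X (u m) (u n)) < e / (2 * (C + 1))"
    using assms(2,3) unfolding cauchy_seqs_def by blast
  have "\<rho> (vdiff X (s m) (s n)) \<le> e" if mn: "m \<ge> max M N" "n \<ge> max M N" for m n
  proof -
    have *: "D * (e / (2 * D) + e / (2 * D)) = e" if "0 < D" for D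
      using that by (simp add: field_simps)
    have "\<rho> (vdiff X (t m) (t n)) \<le> e / (2 * (C + 1))" "\<rho> (vdiff X (u m) (u n)) \<le> e / (2 * (C + 1))"
      using M N mn by (simp_all add: less_imp_le)
    then have "C * (\<rho> (vdiff X (t m) (t n)) + \<rho> (vdiff X (u m) (u n)))
        \<le> (C + 1) * (e / (2 * (C + 1)) + e / (2 * (C + 1)))"
      using \<open>0 \<le> C\<close> mn assms(2,3)
      by (intro mult_mono add_mono_thms_linordered_semiring(1) conjI add_nonneg_nonneg norm_nonneg
          closed cauchy_seqs_closed) auto
    moreover have "(C + 1) * (e / (2 * (C + 1)) + e / (2 * (C + 1))) = e"
      using \<open>0 \<le> C\<close> by (intro *) simp
    ultimately show ?thesis using le[of m n] by linarith
  qed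
  then show "\<exists>N. \<forall>m\<ge>N. \<forall>n\<ge>N. \<rho> (vdiff X (s m) (s n)) \<le> e" by blast
qed (rule assms(1))

lemma cauchy_const: "a \<in> vcarrier X \<Longrightarrow> (\<lambda>_. a) \<in> cauchy_seqs X \<rho>"
  by (rule cauchy_seqsI) (simp_all add: norm_diff_eq_zero_iff[THEN iffD2])

lemma
  assumes s: "s \<in> cauchy_seqs X \<rho>" and t: "t \<in> cauchy_seqs X \<rho>"
  shows cauchy_add: "(\<lambda>n. vadd X (s n) (t n)) \<in> cauchy_seqs X \<rho>"
    and cauchy_sup: "(\<lambda>n. vsup X (s n) (t n)) \<in> cauchy_seqs X \<rho>"
    and cauchy_inf: "(\<lambda>n. vinf X (s n) (t n)) \<in> cauchy_seqs X \<rho>"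
  by (rule cauchy_seqs_dominated[OF _ s t zero_le_one],
      simp_all add: closed cauchy_seqs_closed[OF s] cauchy_seqs_closed[OF t]
        norm_diff_add norm_diff_sup norm_diff_inf)+

lemma cauchy_scale:
  assumes s: "s \<in> cauchy_seqs X \<rho>"
  shows "(\<lambda>n. vscale X r (s n)) \<in> cauchy_seqs X \<rho>"
  by (rule cauchy_seqs_dominated[OF _ s s abs_ge_zero[of r]])
    (simp_all add: closed cauchy_seqs_closed[OF s] norm_diff_scale norm_nonneg mult_left_mono)

lemma cauchy_neg: "s \<in> cauchy_seqs X \<rho> \<Longrightarrow> (\<lambda>n. vneg X (s n)) \<in> cauchy_seqs X \<rho>"
  unfolding vneg_def by (rule cauchy_scale)

lemma cauchy_diff: "\<lbrakk>s \<in> cauchy_seqs X \<rho>; t \<in> cauchy_seqs X \<rho>\<rbrakk>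
    \<Longrightarrow> (\<lambda>n. vdiff X (s n) (t n)) \<in> cauchy_seqs X \<rho>"
  unfolding vdiff_def by (intro cauchy_add cauchy_neg)

lemmas cauchy_intros = cauchy_const cauchy_add cauchy_sup cauchy_inf cauchy_scale cauchy_neg
  cauchy_diff

lemma cauchy_norm_LIMSEQ:
  assumes "s \<in> cauchy_seqs X \<rho>"
  shows "(\<lambda>n. \<rho> (s n)) \<longlonglongrightarrow> lim (\<lambda>n. \<rho> (s n))"
proof -
  have "Cauchy (\<lambda>n. \<rho> (s n))"
    unfolding Cauchy_def
  proof (intro allI impI)
    fix e :: real assume "0 < e"
    then obtain N where "\<forall>m\<ge>N. \<forall>n\<ge>N. \<rho> (vdiff X (s m) (s n)) < e"
      using assms unfolding cauchy_seqs_def by blast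
    then show "\<exists>N. \<forall>m\<ge>N. \<forall>n\<ge>N. dist (\<rho> (s m)) (\<rho> (s n)) < e"
      using abs_norm_diff_le cauchy_seqs_closed[OF assms]
      by (auto simp: dist_real_def intro!: exI[of _ N] order_le_less_trans[OF abs_norm_diff_le])
  qed
  then show ?thesis by (simp add: real_Cauchy_convergent convergent_LIMSEQ_iff[symmetric])
qed

lemma asymp_cauchy:
  assumes st: "asymp s t" and t: "t \<in> cauchy_seqs X \<rho>"
  shows "s \<in> cauchy_seqs X \<rho>"
proof (rule cauchy_seqsI)
  fix e :: real assume "0 < e"
  then have "\<forall>\<^sub>F n in sequentially. \<rho> (vdiff X (s n) (t n)) < e / 3"
    using asympD[OF st] by (intro order_tendstoD) auto
  then obtain M where M: "\<And>n. n \<ge> M \<Longrightarrow> \<rho> (vdiff X (s n) (t n)) < e / 3"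
    by (auto simp: eventually_sequentially)
  have "0 < e / 3" using \<open>0 < e\<close> by simp
  then obtain N where N: "\<And>m n. \<lbrakk>m \<ge> N; n \<ge> N\<rbrakk> \<Longrightarrow> \<rho> (vdiff X (t m) (t n)) < e / 3"
    using t unfolding cauchy_seqs_def by blast
  have "\<rho> (vdiff X (s m) (s n)) \<le> e" if "m \<ge> max M N" "n \<ge> max M N" for m n
    using norm_diff_triangle[of "s m" "t m" "s n"] norm_diff_triangle[of "t m" "t n" "s n"]
      norm_diff_commute[of "s n" "t n"] M[of m] M[of n] N[of m n] that
    by (simp add: asymp_closed[OF st])
  then show "\<exists>N. \<forall>m\<ge>N. \<forall>n\<ge>N. \<rho> (vdiff X (s m) (s n)) \<le> e" by blast
qed (rule asymp_closed[OF st])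

end

lemma banach_lattice_normed: "banach_lattice G \<Longrightarrow> normed_vector_lattice G (vnorm G)"
  by (simp add: banach_lattice_def banach_lattice_axioms_def normed_vector_lattice_def
      normed_vector_lattice_axioms_def)


section \<open>The completion of a normed vector lattice\<close>

context normed_vector_lattice
begin

abbreviation completion :: "((nat \<Rightarrow> 'a) set) nvlat"
  where "completion \<equiv> norm_completion X \<rho>"

abbreviation cls :: "(nat \<Rightarrow> 'a) \<Rightarrow> (nat \<Rightarrow> 'a) set"
  where "cls \<equiv> seq_class X \<rho>"

lemma null_rel_iff:
  "(s, t) \<in> null_rel X \<rho> \<longleftrightarrow> s \<in> cauchy_seqs X \<rho> \<and> t \<in> cauchy_seqs X \<rho> \<and> asymp s t"
  by (auto simp: null_rel_def asymp_def cauchy_seqs_closed)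

lemma equiv_null_rel: "equiv (cauchy_seqs X \<rho>) (null_rel X \<rho>)"
proof (rule equivI)
  show "null_rel X \<rho> \<subseteq> cauchy_seqs X \<rho> \<times> cauchy_seqs X \<rho>"
    by (auto simp: null_rel_iff)
  show "refl_on (cauchy_seqs X \<rho>) (null_rel X \<rho>)"
    by (auto simp: refl_on_def null_rel_iff intro: asymp_refl cauchy_seqs_closed)
  show "sym (null_rel X \<rho>)" by (auto simp: sym_def null_rel_iff intro: asymp_sym)
  show "trans (null_rel X \<rho>)" by (auto simp: trans_def null_rel_iff intro: asymp_trans)
qed

lemma cls_eq_iff:
  "\<lbrakk>s \<in> cauchy_seqs X \<rho>; t \<in> cauchy_seqs X \<rho>\<rbrakk> \<Longrightarrow> cls s = cls t \<longleftrightarrow> asymp s t"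
  unfolding seq_class_def using eq_equiv_class_iff[OF equiv_null_rel] by (simp add: null_rel_iff)

lemma mem_cls_iff: "t \<in> cls s \<longleftrightarrow> s \<in> cauchy_seqs X \<rho> \<and> t \<in> cauchy_seqs X \<rho> \<and> asymp s t"
  by (simp add: seq_class_def null_rel_iff)

lemma completion_carrier: "vcarrier completion = cls ` cauchy_seqs X \<rho>"
  by (auto simp: norm_completion_def quotient_def seq_class_def)

lemma cls_closed: "s \<in> cauchy_seqs X \<rho> \<Longrightarrow> cls s \<in> vcarrier completion"
  by (simp add: completion_carrier)

lemma
  assumes "s \<in> cauchy_seqs X \<rho>"
  shows seq_rep_cauchy: "seq_rep (cls s) \<in> cauchy_seqs X \<rho>"
    and seq_rep_asymp: "asymp (seq_rep (cls s)) s"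
proof -
  have "s \<in> cls s" using assms by (auto simp: mem_cls_iff intro: asymp_refl cauchy_seqs_closed)
  then have "seq_rep (cls s) \<in> cls s" unfolding seq_rep_def by (rule someI[of "\<lambda>t. t \<in> cls s"])
  then show "seq_rep (cls s) \<in> cauchy_seqs X \<rho>" "asymp (seq_rep (cls s)) s"
    by (auto simp: mem_cls_iff intro: asymp_sym)
qed

lemma completion_zero: "vzero completion = cls (\<lambda>_. vzero X)"
  by (simp add: norm_completion_def)

lemma completion_scale:
  assumes "s \<in> cauchy_seqs X \<rho>"
  shows "vscale completion r (cls s) = cls (\<lambda>n. vscale X r (s n))"
  using assms by (simp add: norm_completion_def cls_eq_iff cauchy_scale seq_rep_cauchy
      asymp_scale seq_rep_asymp)

lemma completion_neg:
  assumes "s \<in> cauchy_seqs X \<rho>"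
  shows "vneg completion (cls s) = cls (\<lambda>n. vneg X (s n))"
  using completion_scale[OF assms] by (simp add: vneg_def)

text \<open>The norm of a class is defined by its chosen representative, and the norms along two
  equivalent sequences differ by a null sequence.\<close>

lemma completion_norm_LIMSEQ:
  assumes "s \<in> cauchy_seqs X \<rho>"
  shows "(\<lambda>n. \<rho> (s n)) \<longlonglongrightarrow> vnorm completion (cls s)"
proof -
  have "(\<lambda>n. \<rho> (seq_rep (cls s) n) - (\<rho> (seq_rep (cls s) n) - \<rho> (s n)))
      \<longlonglongrightarrow> lim (\<lambda>n. \<rho> (seq_rep (cls s) n)) - 0"
    by (intro tendsto_diff cauchy_norm_LIMSEQ asymp_norm seq_rep_cauchy seq_rep_asymp assms)
  then show ?thesis by (simp add: norm_completion_def)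
qed

context
  fixes s t
  assumes st: "s \<in> cauchy_seqs X \<rho>" "t \<in> cauchy_seqs X \<rho>"
begin

lemma completion_add: "vadd completion (cls s) (cls t) = cls (\<lambda>n. vadd X (s n) (t n))"
  using st by (simp add: norm_completion_def cls_eq_iff cauchy_add seq_rep_cauchy
      asymp_add seq_rep_asymp)

lemma completion_diff: "vdiff completion (cls s) (cls t) = cls (\<lambda>n. vdiff X (s n) (t n))"
proof -
  have "vdiff completion (cls s) (cls t) = vadd completion (cls s) (cls (\<lambda>n. vneg X (t n)))"
    using st by (simp add: vdiff_def completion_neg)
  also have "\<dots> = cls (\<lambda>n. vdiff X (s n) (t n))"
    using st by (simp add: norm_completion_def cls_eq_iff cauchy_add cauchy_neg cauchy_diff
        seq_rep_cauchy asymp_add seq_rep_asymp vdiff_def)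
  finally show ?thesis .
qed

text \<open>Turns the existence of some termwise ordered representatives into a condition on given
  ones. In one direction, equivalent sequences have equivalent suprema; in the other,
  \<open>s\<close> and the termwise supremum of \<open>s\<close> and \<open>t\<close> are the
  ordered representatives.\<close>

lemma completion_le_iff:
  "vle completion (cls s) (cls t) \<longleftrightarrow> asymp (\<lambda>n. vsup X (s n) (t n)) t"
proof
  assume "vle completion (cls s) (cls t)"
  then obtain s' t' where *: "s' \<in> cls s" "t' \<in> cls t" "\<And>n. vle X (s' n) (t' n)"
    by (auto simp: norm_completion_def)
  then have st': "asymp s s'" "asymp t t'" by (auto simp: mem_cls_iff)
  have "(\<lambda>n. vsup X (s' n) (t' n)) = t'"
    using * st' by (auto simp: vsup_absorb asymp_closed)
  then have "asymp (\<lambda>n. vsup X (s n) (t n)) t'"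
    using asymp_sup[OF st'] by simp
  then show "asymp (\<lambda>n. vsup X (s n) (t n)) t"
    using st' asymp_sym asymp_trans by blast
next
  assume "asymp (\<lambda>n. vsup X (s n) (t n)) t"
  then have "(\<lambda>n. vsup X (s n) (t n)) \<in> cls t" "s \<in> cls s"
    using st by (auto simp: mem_cls_iff cauchy_sup asymp_sym asymp_refl cauchy_seqs_closed)
  moreover have "\<forall>n. vle X (s n) (vsup X (s n) (t n))"
    using st by (simp add: sup_ge1 cauchy_seqs_closed)
  ultimately have "\<exists>s'\<in>cls s. \<exists>t'\<in>cls t. \<forall>n. vle X (s' n) (t' n)"
    by (intro bexI[of _ s] bexI[of _ "\<lambda>n. vsup X (s n) (t n)"])
  then show "vle completion (cls s) (cls t)"
    by (simp add: norm_completion_def)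
qed

lemma completion_leI: "(\<And>n. vle X (s n) (t n)) \<Longrightarrow> vle completion (cls s) (cls t)"
  using st by (simp add: completion_le_iff vsup_absorb cauchy_seqs_closed asymp_refl)

end

text \<open>The difference of \<open>sup a c\<close> and \<open>c\<close> is the positive part of
  \<open>a - c\<close>; its norm measures how far \<open>a \<le> c\<close> fails. Positive parts
  satisfy the triangle inequality along \<open>a, b, c\<close>.\<close>

lemma gap_sup_trans:
  assumes "a \<in> vcarrier X" "b \<in> vcarrier X" "c \<in> vcarrier X"
  shows "\<rho> (vdiff X (vsup X a c) c) \<le> \<rho> (vdiff X (vsup X a b) b) + \<rho> (vdiff X (vsup X b c) c)"
  by (rule norm_le_add, (intro closed assms)+, rule vl_expr_le[of a b c a],
      (rule vl_expr_intros assms)+, linarith)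

lemma completion_le_trans:
  assumes "s \<in> cauchy_seqs X \<rho>" "t \<in> cauchy_seqs X \<rho>" "u \<in> cauchy_seqs X \<rho>"
    and "vle completion (cls s) (cls t)" "vle completion (cls t) (cls u)"
  shows "vle completion (cls s) (cls u)"
proof -
  have "asymp (\<lambda>n. vsup X (s n) (t n)) t" "asymp (\<lambda>n. vsup X (t n) (u n)) u"
    using assms by (simp_all add: completion_le_iff)
  from tendsto_add_zero[OF this[THEN asympD]]
  have "asymp (\<lambda>n. vsup X (s n) (u n)) u"
    by (rule asympI[rotated 3])
      (use assms in \<open>simp_all add: closed cauchy_seqs_closed gap_sup_trans\<close>)
  then show ?thesis using assms by (simp add: completion_le_iff)
qed

text \<open>The least upper bound property comes from the estimate of the positive part of
  \<open>sup s t - u\<close> by the sum of those of \<open>s - u\<close> and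
  \<open>t - u\<close>.\<close>

lemma is_vsup_completion:
  assumes s: "s \<in> cauchy_seqs X \<rho>" and t: "t \<in> cauchy_seqs X \<rho>"
  shows "is_vsup completion (cls s) (cls t) (cls (\<lambda>n. vsup X (s n) (t n)))"
  unfolding is_vsup_def
proof (intro conjI ballI impI)
  show "vle completion (cls s) (cls (\<lambda>n. vsup X (s n) (t n)))"
    "vle completion (cls t) (cls (\<lambda>n. vsup X (s n) (t n)))"
    using s t by (auto intro!: completion_leI simp: cauchy_sup sup_ge1 sup_ge2 cauchy_seqs_closed)
next
  fix U assume "U \<in> vcarrier completion" and le: "vle completion (cls s) U \<and> vle completion (cls t) U"
  then obtain u where u: "u \<in> cauchy_seqs X \<rho>" "U = cls u" by (auto simp: completion_carrier)
  then have "asymp (\<lambda>n. vsup X (s n) (u n)) u" "asymp (\<lambda>n. vsup X (t n) (u n)) u"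
    using le s t by (auto simp: completion_le_iff)
  from tendsto_add_zero[OF this[THEN asympD]]
  have "asymp (\<lambda>n. vsup X (vsup X (s n) (t n)) (u n)) u"
  proof (rule asympI[rotated 3])
    fix n
    have c: "s n \<in> vcarrier X" "t n \<in> vcarrier X" "u n \<in> vcarrier X"
      using s t u by (simp_all add: cauchy_seqs_closed)
    show "\<rho> (vdiff X (vsup X (vsup X (s n) (t n)) (u n)) (u n))
        \<le> \<rho> (vdiff X (vsup X (s n) (u n)) (u n)) + \<rho> (vdiff X (vsup X (t n) (u n)) (u n))"
      by (rule norm_le_add, (intro closed c)+, rule vl_expr_le[of "s n" "t n" "u n" "u n"],
          (rule vl_expr_intros c)+, linarith)
  qed (use s t u in \<open>simp_all add: closed cauchy_seqs_closed\<close>)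
  then show "vle completion (cls (\<lambda>n. vsup X (s n) (t n))) U"
    using s t u by (simp add: completion_le_iff cauchy_sup)
qed (use s t in \<open>simp add: cls_closed cauchy_sup\<close>)

text \<open>Dually, the positive part of \<open>u - inf s t\<close> is at most the sum of those of
  \<open>u - s\<close> and \<open>u - t\<close>.\<close>

lemma is_vinf_completion:
  assumes s: "s \<in> cauchy_seqs X \<rho>" and t: "t \<in> cauchy_seqs X \<rho>"
  shows "is_vinf completion (cls s) (cls t) (cls (\<lambda>n. vinf X (s n) (t n)))"
  unfolding is_vinf_def
proof (intro conjI ballI impI)
  show "vle completion (cls (\<lambda>n. vinf X (s n) (t n))) (cls s)"
    "vle completion (cls (\<lambda>n. vinf X (s n) (t n))) (cls t)"
    using s t by (auto intro!: completion_leI simp: cauchy_inf inf_le1 inf_le2 cauchy_seqs_closed)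
next
  fix U assume "U \<in> vcarrier completion" and le: "vle completion U (cls s) \<and> vle completion U (cls t)"
  then obtain u where u: "u \<in> cauchy_seqs X \<rho>" "U = cls u" by (auto simp: completion_carrier)
  then have "asymp (\<lambda>n. vsup X (u n) (s n)) s" "asymp (\<lambda>n. vsup X (u n) (t n)) t"
    using le s t by (auto simp: completion_le_iff)
  from tendsto_add_zero[OF this[THEN asympD]]
  have "asymp (\<lambda>n. vsup X (u n) (vinf X (s n) (t n))) (\<lambda>n. vinf X (s n) (t n))"
  proof (rule asympI[rotated 3])
    fix n
    have c: "s n \<in> vcarrier X" "t n \<in> vcarrier X" "u n \<in> vcarrier X"
      using s t u by (simp_all add: cauchy_seqs_closed)
    show "\<rho> (vdiff X (vsup X (u n) (vinf X (s n) (t n))) (vinf X (s n) (t n)))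
        \<le> \<rho> (vdiff X (vsup X (u n) (s n)) (s n)) + \<rho> (vdiff X (vsup X (u n) (t n)) (t n))"
      by (rule norm_le_add, (intro closed c)+, rule vl_expr_le[of "s n" "t n" "u n" "u n"],
          (rule vl_expr_intros c)+, linarith)
  qed (use s t u in \<open>simp_all add: closed cauchy_seqs_closed\<close>)
  then show "vle completion U (cls (\<lambda>n. vinf X (s n) (t n)))"
    using s t u by (simp add: completion_le_iff cauchy_inf)
qed (use s t in \<open>simp add: cls_closed cauchy_inf\<close>)

lemma vector_lattice_completion: "vector_lattice completion"
proof -
  have carrierE: "\<exists>s\<in>cauchy_seqs X \<rho>. A = cls s" if "A \<in> vcarrier completion" for A
    using that by (auto simp: completion_carrier)
  note ops = completion_zero completion_add completion_scale completion_neg cauchy_intros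
    closed
  show ?thesis
  proof
    fix A B C assume "A \<in> vcarrier completion" "B \<in> vcarrier completion" "C \<in> vcarrier completion"
    then obtain s t u where st: "s \<in> cauchy_seqs X \<rho>" "t \<in> cauchy_seqs X \<rho>" "u \<in> cauchy_seqs X \<rho>"
      and [simp]: "A = cls s" "B = cls t" "C = cls u"
      using carrierE by meson
    note ops = ops st[THEN cauchy_seqs_closed]
    show "vadd completion (vadd completion A B) C = vadd completion A (vadd completion B C)"
      using st by (simp add: ops add_assoc)
    show "vle completion A B \<Longrightarrow> vle completion B C \<Longrightarrow> vle completion A C"
      using completion_le_trans[OF st] by simp
    assume "vle completion A B"
    then have *: "asymp (\<lambda>n. vsup X (s n) (t n)) t" using st by (simp add: completion_le_iff)
    \<comment> \<open>By \<open>add_sup\<close> the left-hand sequence is the termwise supremum of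
      the translated sequences, so this is the order criterion after translation.\<close>
    have "asymp (\<lambda>n. vadd X (u n) (vsup X (s n) (t n))) (\<lambda>n. vadd X (u n) (t n))"
      using st by (intro asymp_add asymp_refl *) (rule cauchy_seqs_closed)
    then show "vle completion (vadd completion A C) (vadd completion B C)"
      using st by (simp add: ops completion_le_iff add_sup add_comm[of _ "u _"])
  next
    fix A B assume "A \<in> vcarrier completion" "B \<in> vcarrier completion"
    then obtain s t where st: "s \<in> cauchy_seqs X \<rho>" "t \<in> cauchy_seqs X \<rho>"
      and [simp]: "A = cls s" "B = cls t"
      using carrierE by meson
    note ops = ops st[THEN cauchy_seqs_closed]
    show "vadd completion A B \<in> vcarrier completion"
      using st by (simp add: ops cls_closed)
    show "vadd completion A B = vadd completion B A"
      using st add_comm[of "s _" "t _"] by (simp add: ops)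
    show "vscale completion r (vadd completion A B)
        = vadd completion (vscale completion r A) (vscale completion r B)" for r
      using st by (simp add: ops scale_add_right)
    show "\<exists>S. is_vsup completion A B S" "\<exists>S. is_vinf completion A B S"
      using is_vsup_completion[OF st] is_vinf_completion[OF st] by auto
    assume le: "vle completion A B"
    then have *: "asymp (\<lambda>n. vsup X (s n) (t n)) t" using st by (simp add: completion_le_iff)
    \<comment> \<open>The same termwise supremum is equivalent to \<open>t\<close> by one inequality
      and to \<open>s\<close> by the other.\<close>
    show "A = B" if "vle completion B A"
    proof -
      have "asymp (\<lambda>n. vsup X (s n) (t n)) s"
        using that st by (simp add: completion_le_iff vsup_commute)
      then show ?thesis using asymp_trans[OF asymp_sym *] st by (simp add: cls_eq_iff)
    qed
    show "vle completion (vscale completion r A) (vscale completion r B)" if "0 \<le> r" for r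
      using asymp_scale[OF *, of r]
      by (simp add: st completion_scale completion_le_iff[OF st[THEN cauchy_scale]]
          scale_sup[OF that] st[THEN cauchy_seqs_closed])
  next
    fix A assume "A \<in> vcarrier completion"
    then obtain s where st: "s \<in> cauchy_seqs X \<rho>" and [simp]: "A = cls s"
      using carrierE by meson
    note ops = ops st[THEN cauchy_seqs_closed]
    show "vscale completion r A \<in> vcarrier completion" for r
      using st by (simp add: ops cls_closed)
    show "vadd completion A (vzero completion) = A" "vadd completion A (vneg completion A) = vzero completion"
      using st by (simp_all add: ops add_zero add_neg)
    show "vscale completion (r + q) A = vadd completion (vscale completion r A) (vscale completion q A)"
      "vscale completion r (vscale completion q A) = vscale completion (r * q) A" for r q
      using st by (simp_all add: ops scale_add_left scale_scale)
    show "vscale completion 1 A = A" using st by (simp add: ops scale_one)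
    show "vle completion A A" using st by (simp add: completion_leI ops le_refl)
  qed (simp add: ops cls_closed)
qed

lemma vsup_completion: "\<lbrakk>s \<in> cauchy_seqs X \<rho>; t \<in> cauchy_seqs X \<rho>\<rbrakk>
    \<Longrightarrow> vsup completion (cls s) (cls t) = cls (\<lambda>n. vsup X (s n) (t n))"
  using vector_lattice.vsup_eqI[OF vector_lattice_completion] is_vsup_completion by blast

lemma vinf_completion: "\<lbrakk>s \<in> cauchy_seqs X \<rho>; t \<in> cauchy_seqs X \<rho>\<rbrakk>
    \<Longrightarrow> vinf completion (cls s) (cls t) = cls (\<lambda>n. vinf X (s n) (t n))"
  using vector_lattice.vinf_eqI[OF vector_lattice_completion] is_vinf_completion by blast

lemma vabs_completion: "s \<in> cauchy_seqs X \<rho> \<Longrightarrow> vabs completion (cls s) = cls (\<lambda>n. vabs X (s n))"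
  by (simp add: vabs_def completion_neg vsup_completion cauchy_neg)

lemma cauchy_abs: "s \<in> cauchy_seqs X \<rho> \<Longrightarrow> (\<lambda>n. vabs X (s n)) \<in> cauchy_seqs X \<rho>"
  unfolding vabs_def by (intro cauchy_sup cauchy_neg)

lemma norm_completion_norm: "vector_lattice_norm completion (vnorm completion)"
  unfolding vector_lattice_norm_def
proof (intro conjI ballI allI impI)
  fix A assume "A \<in> vcarrier completion"
  then obtain s where s: "s \<in> cauchy_seqs X \<rho>" "A = cls s" by (auto simp: completion_carrier)
  note lim = completion_norm_LIMSEQ[OF s(1)]
  show "0 \<le> vnorm completion A"
    using s by (auto intro!: LIMSEQ_le_const[OF lim] norm_nonneg cauchy_seqs_closed)
  have diff: "vdiff X (s n) (vzero X) = s n" for n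
    using cauchy_seqs_closed[OF s(1), of n] scale_zero_right
    by (simp add: vdiff_def vneg_def add_zero)
  have "vnorm completion A = 0 \<longleftrightarrow> (\<lambda>n. \<rho> (s n)) \<longlonglongrightarrow> 0"
    using lim s LIMSEQ_unique by auto
  also have "\<dots> \<longleftrightarrow> asymp s (\<lambda>_. vzero X)"
    using s by (auto simp: asymp_def diff zero_closed cauchy_seqs_closed)
  also have "\<dots> \<longleftrightarrow> A = vzero completion"
    using s by (simp add: completion_zero cls_eq_iff cauchy_const zero_closed)
  finally show "vnorm completion A = 0 \<longleftrightarrow> A = vzero completion" .
  fix r
  have "(\<lambda>n. \<rho> (vscale X r (s n))) \<longlonglongrightarrow> \<bar>r\<bar> * vnorm completion A"
    using tendsto_mult_left[OF lim, of "\<bar>r\<bar>"] s by (simp add: norm_scale cauchy_seqs_closed)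
  then show "vnorm completion (vscale completion r A) = \<bar>r\<bar> * vnorm completion A"
    using completion_norm_LIMSEQ[OF cauchy_scale[OF s(1)]] LIMSEQ_unique s
    by (auto simp: completion_scale)
next
  fix A B assume "A \<in> vcarrier completion" "B \<in> vcarrier completion"
  then obtain s t where st: "s \<in> cauchy_seqs X \<rho>" "t \<in> cauchy_seqs X \<rho>" "A = cls s" "B = cls t"
    by (auto simp: completion_carrier)
  note lim = completion_norm_LIMSEQ[OF st(1)] completion_norm_LIMSEQ[OF st(2)]
  have "vnorm completion (cls (\<lambda>n. vadd X (s n) (t n))) \<le> vnorm completion A + vnorm completion B"
    unfolding st(3,4)
    by (rule LIMSEQ_le[OF completion_norm_LIMSEQ[OF cauchy_add[OF st(1,2)]] tendsto_add[OF lim]])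
      (use st in \<open>simp add: norm_triangle cauchy_seqs_closed\<close>)
  then show "vnorm completion (vadd completion A B) \<le> vnorm completion A + vnorm completion B"
    using st by (simp add: completion_add)
  assume "vle completion (vabs completion A) (vabs completion B)"
  then have "asymp (\<lambda>n. vsup X (vabs X (s n)) (vabs X (t n))) (\<lambda>n. vabs X (t n))"
    using st by (simp add: vabs_completion completion_le_iff cauchy_abs)
  note lim' = tendsto_add[OF lim(2) asympD[OF this]]
  \<comment> \<open>The order between the absolute values holds for the representatives only up to a
    gap; its norm is an error term that vanishes in the limit.\<close>
  have "\<rho> (s n) \<le> \<rho> (t n) + \<rho> (vdiff X (vsup X (vabs X (s n)) (vabs X (t n))) (vabs X (t n)))" for n
  proof -
    have c: "s n \<in> vcarrier X" "t n \<in> vcarrier X"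
      using st by (simp_all add: cauchy_seqs_closed)
    show ?thesis
      by (rule norm_le_add, (intro closed c)+, rule vl_expr_le[of "s n" "t n" "t n" "t n"],
          (rule vl_expr_intros c)+, linarith)
  qed
  then show "vnorm completion A \<le> vnorm completion B"
    using LIMSEQ_le[OF lim(1) lim'] st by auto
qed

lemma normed_vector_lattice_completion: "normed_vector_lattice completion (vnorm completion)"
  by (intro normed_vector_lattice.intro vector_lattice_completion
      normed_vector_lattice_axioms.intro norm_completion_norm)

section \<open>Isometric embedding, density and completeness\<close>

abbreviation embed :: "'a \<Rightarrow> (nat \<Rightarrow> 'a) set"
  where "embed \<equiv> completion_embed X \<rho>"

lemma embed_closed: "a \<in> vcarrier X \<Longrightarrow> embed a \<in> vcarrier completion"
  by (simp add: completion_embed_def cls_closed cauchy_const)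

lemma norm_embed: "a \<in> vcarrier X \<Longrightarrow> vnorm completion (embed a) = \<rho> a"
  using LIMSEQ_unique[OF completion_norm_LIMSEQ[OF cauchy_const] tendsto_const]
  by (simp add: completion_embed_def)

lemma embed_ops:
  "\<lbrakk>a \<in> vcarrier X; b \<in> vcarrier X\<rbrakk> \<Longrightarrow> embed (vadd X a b) = vadd completion (embed a) (embed b)"
  "a \<in> vcarrier X \<Longrightarrow> embed (vscale X r a) = vscale completion r (embed a)"
  "\<lbrakk>a \<in> vcarrier X; b \<in> vcarrier X\<rbrakk> \<Longrightarrow> embed (vsup X a b) = vsup completion (embed a) (embed b)"
  "\<lbrakk>a \<in> vcarrier X; b \<in> vcarrier X\<rbrakk> \<Longrightarrow> embed (vinf X a b) = vinf completion (embed a) (embed b)"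
  "\<lbrakk>a \<in> vcarrier X; b \<in> vcarrier X\<rbrakk> \<Longrightarrow> embed (vdiff X a b) = vdiff completion (embed a) (embed b)"
  by (simp_all add: completion_embed_def completion_add completion_scale vsup_completion
      vinf_completion completion_diff cauchy_const)

text \<open>Density with an explicit approximating sequence: a Cauchy sequence in \<open>X\<close>
  converges, in the completion, to its own class.\<close>

lemma embed_tendsto_cls:
  assumes s: "s \<in> cauchy_seqs X \<rho>"
  shows "normed_vector_lattice.asymp completion (vnorm completion) (\<lambda>n. embed (s n)) (\<lambda>_. cls s)"
proof -
  interpret Q: normed_vector_lattice completion "vnorm completion"
    by (rule normed_vector_lattice_completion)
  have sn: "s n \<in> vcarrier X" for n using s by (rule cauchy_seqs_closed)
  have "(\<lambda>n. vnorm completion (vdiff completion (embed (s n)) (cls s))) \<longlonglongrightarrow> 0"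
  proof (rule LIMSEQ_I)
    fix e :: real assume "0 < e"
    then have "0 < e / 2" by simp
    then obtain N where N: "\<forall>m\<ge>N. \<forall>n\<ge>N. \<rho> (vdiff X (s m) (s n)) < e / 2"
      using s unfolding cauchy_seqs_def by blast
    have "vnorm completion (vdiff completion (embed (s n)) (cls s)) < e" if "n \<ge> N" for n
    proof -
      \<comment> \<open>With \<open>n\<close> fixed, the difference is the class of the sequence in
        \<open>m\<close>, so its norm is a limit of distances below \<open>e / 2\<close>. Limits
        keep only the weak inequality, hence the half.\<close>
      have "(\<lambda>m. \<rho> (vdiff X (s n) (s m))) \<longlonglongrightarrow> vnorm completion (vdiff completion (embed (s n)) (cls s))"
        using completion_norm_LIMSEQ[OF cauchy_diff[OF cauchy_const[OF sn[of n]] s]]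
        by (simp add: completion_embed_def completion_diff cauchy_const sn s)
      then have "vnorm completion (vdiff completion (embed (s n)) (cls s)) \<le> e / 2"
        using N that by (intro LIMSEQ_le_const2) (auto intro: less_imp_le)
      then show ?thesis using \<open>0 < e\<close> by simp
    qed
    moreover have "0 \<le> vnorm completion (vdiff completion (embed (s n)) (cls s))" for n
      by (intro Q.norm_nonneg Q.closed embed_closed cls_closed sn s)
    ultimately show "\<exists>N. \<forall>n\<ge>N. norm (vnorm completion (vdiff completion (embed (s n)) (cls s)) - 0) < e"
      by auto
  qed
  then show ?thesis
    by (auto simp: Q.asymp_def embed_closed cls_closed sn s)
qed

text \<open>Pick \<open>x k\<close> in \<open>X\<close> within \<open>1 / (k + 1)\<close> of
  \<open>S k\<close>. The embedded sequence is equivalent to \<open>S\<close> and therefore Cauchy;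
  as the embedding is isometric, \<open>x\<close> is Cauchy in \<open>X\<close>, and its class is
  the limit of \<open>S\<close>.\<close>

lemma banach_lattice_completion: "banach_lattice completion"
proof -
  interpret Q: normed_vector_lattice completion "vnorm completion"
    by (rule normed_vector_lattice_completion)
  show ?thesis
  proof (intro banach_lattice.intro banach_lattice_axioms.intro vector_lattice_completion
      norm_completion_norm)
    fix S assume S: "S \<in> cauchy_seqs completion (vnorm completion)"
    have SC: "S k \<in> vcarrier completion" for k using S by (rule Q.cauchy_seqs_closed)
    have "\<exists>a\<in>vcarrier X. vnorm completion (vdiff completion (embed a) (S k)) < inverse (real (Suc k))" for k
    proof -
      obtain s where s: "s \<in> cauchy_seqs X \<rho>" "S k = cls s"
        using SC[of k] by (auto simp: completion_carrier)
      have "\<forall>\<^sub>F n in sequentially. vnorm completion (vdiff completion (embed (s n)) (S k)) < inverse (real (Suc k))"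
        using Q.asympD[OF embed_tendsto_cls[OF s(1)]] s(2) by (intro order_tendstoD) auto
      then obtain n where "vnorm completion (vdiff completion (embed (s n)) (S k)) < inverse (real (Suc k))"
        by (auto simp: eventually_sequentially)
      then show ?thesis using cauchy_seqs_closed[OF s(1)] by blast
    qed
    then obtain x where x: "\<And>k. x k \<in> vcarrier X"
      and xS: "\<And>k. vnorm completion (vdiff completion (embed (x k)) (S k)) < inverse (real (Suc k))"
      by metis
    have asymp: "Q.asymp (\<lambda>k. embed (x k)) S"
      by (rule Q.asympI[of _ _ "\<lambda>k. inverse (real (Suc k))"])
        (use x xS SC in \<open>simp_all add: embed_closed less_imp_le LIMSEQ_inverse_real_of_nat
          del: of_nat_Suc\<close>)
    have "(\<lambda>k. embed (x k)) \<in> cauchy_seqs completion (vnorm completion)"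
      by (rule Q.asymp_cauchy[OF asymp S])
    then have "x \<in> cauchy_seqs X \<rho>"
      unfolding cauchy_seqs_def
      by (simp add: x norm_embed closed flip: embed_ops)
    then have "Q.asymp S (\<lambda>_. cls x)" "cls x \<in> vcarrier completion"
      using Q.asymp_trans[OF Q.asymp_sym[OF asymp] embed_tendsto_cls] by (simp_all add: cls_closed)
    then show "\<exists>A\<in>vcarrier completion. (\<lambda>n. vnorm completion (vdiff completion (S n) A)) \<longlonglongrightarrow> 0"
      using Q.asympD by blast
  qed
qed

end


section \<open>Homomorphisms\<close>

lemma vlat_homD:
  assumes "h \<in> vlat_hom X Y"
  shows vlat_hom_closed: "a \<in> vcarrier X \<Longrightarrow> h a \<in> vcarrier Y"
    and vlat_hom_add: "\<lbrakk>a \<in> vcarrier X; b \<in> vcarrier X\<rbrakk> \<Longrightarrow> h (vadd X a b) = vadd Y (h a) (h b)"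
    and vlat_hom_scale: "a \<in> vcarrier X \<Longrightarrow> h (vscale X r a) = vscale Y r (h a)"
    and vlat_hom_sup: "\<lbrakk>a \<in> vcarrier X; b \<in> vcarrier X\<rbrakk> \<Longrightarrow> h (vsup X a b) = vsup Y (h a) (h b)"
    and vlat_hom_inf: "\<lbrakk>a \<in> vcarrier X; b \<in> vcarrier X\<rbrakk> \<Longrightarrow> h (vinf X a b) = vinf Y (h a) (h b)"
  using assms by (auto simp: vlat_hom_def)

locale vlat_homomorphism = X: vector_lattice X + Y: vector_lattice Y
  for X :: "('a, 'm) vlat_scheme" and Y :: "('b, 'n) vlat_scheme" +
  fixes h :: "'a \<Rightarrow> 'b"
  assumes hom: "h \<in> vlat_hom X Y"
begin

lemmas hom_closed = vlat_hom_closed[OF hom]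
lemmas hom_add = vlat_hom_add[OF hom]
lemmas hom_scale = vlat_hom_scale[OF hom]
lemmas hom_sup = vlat_hom_sup[OF hom]
lemmas hom_inf = vlat_hom_inf[OF hom]

lemma hom_zero: "h (vzero X) = vzero Y"
  using hom_scale[OF X.zero_closed, of 0]
  by (simp add: X.scale_zero_right Y.scale_zero_left hom_closed X.zero_closed)

lemma hom_neg: "a \<in> vcarrier X \<Longrightarrow> h (vneg X a) = vneg Y (h a)"
  by (simp add: vneg_def hom_scale)

lemma hom_diff:
  "\<lbrakk>a \<in> vcarrier X; b \<in> vcarrier X\<rbrakk> \<Longrightarrow> h (vdiff X a b) = vdiff Y (h a) (h b)"
  by (simp add: vdiff_def hom_add hom_neg X.closed)

lemma hom_abs: "a \<in> vcarrier X \<Longrightarrow> h (vabs X a) = vabs Y (h a)"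
  by (simp add: vabs_def hom_sup hom_neg X.closed)

lemma hom_mono:
  assumes "a \<in> vcarrier X" "b \<in> vcarrier X" "vle X a b"
  shows "vle Y (h a) (h b)"
  using Y.sup_ge1[of "h a" "h b"] hom_sup[of a b] assms by (simp add: X.vsup_absorb hom_closed)

end

locale contractive_vlat_homomorphism =
  X: normed_vector_lattice X \<rho> + Y: normed_vector_lattice Y \<sigma> + vlat_homomorphism X Y h
  for X :: "('a, 'm) vlat_scheme" and \<rho> and Y :: "('b, 'n) vlat_scheme" and \<sigma> and h +
  assumes contractive: "a \<in> vcarrier X \<Longrightarrow> \<sigma> (h a) \<le> \<rho> a"
begin

lemma hom_asymp:
  assumes "X.asymp s t"
  shows "Y.asymp (\<lambda>n. h (s n)) (\<lambda>n. h (t n))"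
  by (rule Y.asympI[OF _ _ _ X.asympD[OF assms]])
    (simp_all add: hom_closed X.asymp_closed[OF assms] X.closed contractive flip: hom_diff)

lemma hom_cauchy:
  assumes "s \<in> cauchy_seqs X \<rho>"
  shows "(\<lambda>n. h (s n)) \<in> cauchy_seqs Y \<sigma>"
proof -
  have s: "s n \<in> vcarrier X" for n using assms by (rule X.cauchy_seqs_closed)
  have "\<sigma> (vdiff Y (h (s m)) (h (s n))) \<le> \<rho> (vdiff X (s m) (s n))" for m n
    using contractive[of "vdiff X (s m) (s n)"] by (simp add: s X.closed hom_diff)
  then show ?thesis
    using assms s unfolding cauchy_seqs_def by (auto simp: hom_closed) (meson order_le_less_trans)
qed

end

text \<open>Reduces uniqueness on the completion to uniqueness of homomorphisms on \<open>X\<close>;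
  the restriction keeps the composite extensional.\<close>

lemma (in normed_vector_lattice) embed_hom_compose:
  assumes "h \<in> vlat_hom completion G"
  shows "(\<lambda>a\<in>vcarrier X. h (embed a)) \<in> vlat_hom X G"
  using assms
  by (auto simp: vlat_hom_def embed_ops embed_closed closed)

text \<open>A contractive homomorphism preserves Cauchy sequences and their equivalence, so the
  limit of \<open>k\<close> along a representative exists and depends only on the class. Continuity
  of the operations makes this limit a homomorphism, and density of \<open>X\<close> forces
  it.\<close>

lemma (in normed_vector_lattice) ex1_extension_to_completion:
  fixes G :: "('g, 'n) nvlat_scheme"
  assumes G: "banach_lattice G" and k: "k \<in> vlat_hom X G"
    and le: "\<And>a. a \<in> vcarrier X \<Longrightarrow> vnorm G (k a) \<le> \<rho> a"
  shows "\<exists>!h. h \<in> contractive_vlat_hom completion G \<and> (\<forall>a\<in>vcarrier X. h (embed a) = k a)"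
proof -
  interpret G: normed_vector_lattice G "vnorm G" using G by (rule banach_lattice_normed)
  interpret k: contractive_vlat_homomorphism X \<rho> G "vnorm G" k
    by unfold_locales (use k le in auto)
  interpret Q: normed_vector_lattice completion "vnorm completion"
    by (rule normed_vector_lattice_completion)
  have ex: "\<exists>g. G.asymp (\<lambda>n. k (s n)) (\<lambda>_. g)" if s: "s \<in> cauchy_seqs X \<rho>" for s
  proof -
    obtain g where "g \<in> vcarrier G" "(\<lambda>n. vnorm G (vdiff G (k (s n)) g)) \<longlonglongrightarrow> 0"
      using banach_lattice.complete[OF G k.hom_cauchy[OF s]] by blast
    then show ?thesis using k.hom_closed cauchy_seqs_closed[OF s] by (auto simp: G.asymp_def)
  qed
  define h where "h = (\<lambda>A\<in>vcarrier completion. THE g. G.asymp (\<lambda>n. k (seq_rep A n)) (\<lambda>_. g))"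
  have h_eq: "h (cls s) = g" if s: "s \<in> cauchy_seqs X \<rho>" and g: "G.asymp (\<lambda>n. k (s n)) (\<lambda>_. g)" for s g
  proof -
    have "G.asymp (\<lambda>n. k (seq_rep (cls s) n)) (\<lambda>_. g)"
      using G.asymp_trans[OF k.hom_asymp[OF seq_rep_asymp[OF s]] g] .
    then show ?thesis
      using cls_closed[OF s] G.asymp_limit_unique by (auto simp: h_def intro!: the_equality)
  qed
  have h_lim: "G.asymp (\<lambda>n. k (s n)) (\<lambda>_. h (cls s))" if s: "s \<in> cauchy_seqs X \<rho>" for s
    using ex[OF s] h_eq[OF s] by auto
  have kk: "k (vadd X (s n) (t n)) = vadd G (k (s n)) (k (t n))"
    "k (vscale X r (s n)) = vscale G r (k (s n))"
    "k (vsup X (s n) (t n)) = vsup G (k (s n)) (k (t n))"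
    "k (vinf X (s n) (t n)) = vinf G (k (s n)) (k (t n))"
    if "s \<in> cauchy_seqs X \<rho>" "t \<in> cauchy_seqs X \<rho>" for s t n r
    using that[THEN cauchy_seqs_closed]
    by (simp_all add: k.hom_add k.hom_scale k.hom_sup k.hom_inf)
  have "h \<in> vlat_hom completion G"
    unfolding vlat_hom_def
  proof (intro CollectI conjI ballI allI)
    show "h \<in> vcarrier completion \<rightarrow>\<^sub>E vcarrier G"
      using G.asymp_closed(2)[OF h_lim] by (auto simp: h_def completion_carrier)
  next
    fix A B assume "A \<in> vcarrier completion" "B \<in> vcarrier completion"
    then obtain s t where st: "s \<in> cauchy_seqs X \<rho>" "t \<in> cauchy_seqs X \<rho>"
      and [simp]: "A = cls s" "B = cls t"
      by (auto simp: completion_carrier)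
    note lim = h_lim[OF st(1)] h_lim[OF st(2)]
    show "h (vadd completion A B) = vadd G (h A) (h B)"
      using h_eq[OF cauchy_add[OF st]] G.asymp_add[OF lim] by (simp add: completion_add st kk)
    show "h (vsup completion A B) = vsup G (h A) (h B)"
      using h_eq[OF cauchy_sup[OF st]] G.asymp_sup[OF lim] by (simp add: vsup_completion st kk)
    show "h (vinf completion A B) = vinf G (h A) (h B)"
      using h_eq[OF cauchy_inf[OF st]] G.asymp_inf[OF lim] by (simp add: vinf_completion st kk)
  next
    fix r A assume "A \<in> vcarrier completion"
    then obtain s where s: "s \<in> cauchy_seqs X \<rho>" "A = cls s"
      by (auto simp: completion_carrier)
    show "h (vscale completion r A) = vscale G r (h A)"
      using h_eq[OF cauchy_scale[OF s(1)]] G.asymp_scale[OF h_lim[OF s(1)]]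
      by (simp add: completion_scale s kk[OF s(1) s(1)])
  qed
  moreover have "vnorm G (h A) \<le> vnorm completion A" if A: "A \<in> vcarrier completion" for A
  proof -
    obtain s where s: "s \<in> cauchy_seqs X \<rho>" "A = cls s"
      using A by (auto simp: completion_carrier)
    show ?thesis unfolding s(2)
      by (rule LIMSEQ_le[OF G.asymp_limit_norm[OF h_lim[OF s(1)]] completion_norm_LIMSEQ[OF s(1)]])
        (use cauchy_seqs_closed[OF s(1)] le in auto)
  qed
  moreover have "h (embed a) = k a" if "a \<in> vcarrier X" for a
    unfolding completion_embed_def using that
    by (intro h_eq cauchy_const G.asymp_refl k.hom_closed)
  moreover have "h' = h"
    if h': "h' \<in> contractive_vlat_hom completion G" "\<forall>a\<in>vcarrier X. h' (embed a) = k a" for h'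
  proof (rule PiE_ext)
    show "h' \<in> vcarrier completion \<rightarrow>\<^sub>E vcarrier G"
      using h' by (simp add: contractive_vlat_hom_def vlat_hom_def)
    show "h \<in> vcarrier completion \<rightarrow>\<^sub>E vcarrier G"
      using \<open>h \<in> vlat_hom completion G\<close> by (simp add: vlat_hom_def)
    fix A assume "A \<in> vcarrier completion"
    then obtain s where s: "s \<in> cauchy_seqs X \<rho>" "A = cls s"
      unfolding completion_carrier by blast
    interpret h': contractive_vlat_homomorphism completion "vnorm completion" G "vnorm G" h'
      by unfold_locales (use h' in \<open>auto simp: contractive_vlat_hom_def\<close>)
    \<comment> \<open>The embedded terms of \<open>s\<close> converge to \<open>cls s\<close>, and
      \<open>h'\<close> is contractive; on embedded elements it is \<open>k\<close>.\<close>
    have "G.asymp (\<lambda>n. k (s n)) (\<lambda>_. h' (cls s))"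
      using h'.hom_asymp[OF embed_tendsto_cls[OF s(1)]] h'(2) cauchy_seqs_closed[OF s(1)] by simp
    then show "h' A = h A" using h_eq[OF s(1)] s(2) by simp
  qed
  ultimately show ?thesis
    by (intro ex1I[of _ h]) (auto simp: contractive_vlat_hom_def)
qed


section \<open>Transport of a closed sublattice\<close>

text \<open>A copy of \<open>C\<close> inside another type, with \<open>e\<close> as encoding. The
  change of type is the purpose: \<open>rho\<close> ranges over Banach lattices with carriers in one
  fixed type only.\<close>

definition transport :: "('a \<Rightarrow> 'b) \<Rightarrow> 'a set \<Rightarrow> ('a, 'm) nvlat_scheme \<Rightarrow> 'b nvlat"
  where "transport e C G =
    \<lparr> vcarrier = e ` C, vzero = e (vzero G),
      vadd = (\<lambda>a b. e (vadd G (inv_into C e a) (inv_into C e b))),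
      vscale = (\<lambda>r a. e (vscale G r (inv_into C e a))),
      vle = (\<lambda>a b. vle G (inv_into C e a) (inv_into C e b)),
      vnorm = (\<lambda>a. vnorm G (inv_into C e a)) \<rparr>"

locale closed_sublattice = G: banach_lattice G for G :: "('a, 'm) nvlat_scheme" +
  fixes C :: "'a set" and e :: "'a \<Rightarrow> 'b"
  assumes sublattice: "vector_sublattice G C" and inj: "inj_on e C"
    and C_complete: "\<And>s. \<lbrakk>s \<in> cauchy_seqs G (vnorm G); range s \<subseteq> C\<rbrakk>
      \<Longrightarrow> \<exists>a\<in>C. (\<lambda>n. vnorm G (vdiff G (s n) a)) \<longlonglongrightarrow> 0"
begin

interpretation G: normed_vector_lattice G "vnorm G"
  by (intro banach_lattice_normed G.banach_lattice_axioms)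

abbreviation "T \<equiv> transport e C G"

lemma C_carrier: "a \<in> C \<Longrightarrow> a \<in> vcarrier G"
  and C_closed: "vzero G \<in> C" "\<lbrakk>a \<in> C; b \<in> C\<rbrakk> \<Longrightarrow> vadd G a b \<in> C" "a \<in> C \<Longrightarrow> vscale G r a \<in> C"
    "\<lbrakk>a \<in> C; b \<in> C\<rbrakk> \<Longrightarrow> vsup G a b \<in> C" "\<lbrakk>a \<in> C; b \<in> C\<rbrakk> \<Longrightarrow> vinf G a b \<in> C"
  using sublattice by (auto simp: vector_sublattice_def)

lemma C_diff: "\<lbrakk>a \<in> C; b \<in> C\<rbrakk> \<Longrightarrow> vdiff G a b \<in> C"
  unfolding vdiff_def vneg_def by (intro C_closed)

lemma transport_simps [simp]:
  "vcarrier T = e ` C" "vzero T = e (vzero G)"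
  "\<lbrakk>a \<in> C; b \<in> C\<rbrakk> \<Longrightarrow> vadd T (e a) (e b) = e (vadd G a b)"
  "a \<in> C \<Longrightarrow> vscale T r (e a) = e (vscale G r a)"
  "\<lbrakk>a \<in> C; b \<in> C\<rbrakk> \<Longrightarrow> vle T (e a) (e b) \<longleftrightarrow> vle G a b"
  "a \<in> C \<Longrightarrow> vnorm T (e a) = vnorm G a"
  by (simp_all add: transport_def inv_into_f_f[OF inj])

lemma transport_neg_diff [simp]:
  "a \<in> C \<Longrightarrow> vneg T (e a) = e (vneg G a)"
  "\<lbrakk>a \<in> C; b \<in> C\<rbrakk> \<Longrightarrow> vdiff T (e a) (e b) = e (vdiff G a b)"
  by (simp_all add: vneg_def vdiff_def C_closed)

lemma is_vsup_transport:
  "\<lbrakk>a \<in> C; b \<in> C\<rbrakk> \<Longrightarrow> is_vsup T (e a) (e b) (e (vsup G a b))"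
  by (auto simp: is_vsup_def C_closed C_carrier G.sup_ge1 G.sup_ge2 G.sup_least)

lemma is_vinf_transport:
  "\<lbrakk>a \<in> C; b \<in> C\<rbrakk> \<Longrightarrow> is_vinf T (e a) (e b) (e (vinf G a b))"
  by (auto simp: is_vinf_def C_closed C_carrier G.inf_le1 G.inf_le2 G.inf_greatest)

lemma vector_lattice_transport: "vector_lattice T"
proof
  fix a b assume "a \<in> vcarrier T" "b \<in> vcarrier T"
  then show "\<exists>s. is_vsup T a b s" "\<exists>s. is_vinf T a b s"
    using is_vsup_transport is_vinf_transport by fastforce+
next
  fix a b assume "a \<in> vcarrier T" "b \<in> vcarrier T"
  then show "vadd T a b = vadd T b a"
    by (auto simp: C_carrier G.add_comm)
  assume le: "vle T a b" "vle T b a"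
  obtain x y where "x \<in> C" "y \<in> C" "a = e x" "b = e y"
    using \<open>a \<in> vcarrier T\<close> \<open>b \<in> vcarrier T\<close> by auto
  then show "a = b" using le G.le_antisym[of x y] by (simp add: C_carrier)
qed (auto simp: C_closed C_carrier G.add_assoc G.add_zero G.add_neg[unfolded vneg_def]
    G.scale_add_right G.scale_add_left G.scale_scale G.scale_one G.le_refl G.add_mono G.scale_mono
    vneg_def intro: G.le_trans[OF C_carrier C_carrier C_carrier])

lemma vsup_transport: "\<lbrakk>a \<in> C; b \<in> C\<rbrakk> \<Longrightarrow> vsup T (e a) (e b) = e (vsup G a b)"
  using vector_lattice.vsup_eqI[OF vector_lattice_transport] is_vsup_transport by blast

lemma vinf_transport: "\<lbrakk>a \<in> C; b \<in> C\<rbrakk> \<Longrightarrow> vinf T (e a) (e b) = e (vinf G a b)"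
  using vector_lattice.vinf_eqI[OF vector_lattice_transport] is_vinf_transport by blast

lemma vabs_transport: "a \<in> C \<Longrightarrow> vabs T (e a) = e (vabs G a)"
  by (simp add: vabs_def vsup_transport vneg_def C_closed)

lemma vabs_C: "a \<in> C \<Longrightarrow> vabs G a \<in> C"
  unfolding vabs_def vneg_def by (intro C_closed)

lemma banach_lattice_transport: "banach_lattice T"
proof (intro banach_lattice.intro banach_lattice_axioms.intro vector_lattice_transport)
  have inj_iff: "e a = e b \<longleftrightarrow> a = b" if "a \<in> C" "b \<in> C" for a b
    using inj that by (auto simp: inj_on_def)
  show "vector_lattice_norm T (vnorm T)"
    unfolding vector_lattice_norm_def
    by (auto simp: C_closed C_carrier vabs_transport vabs_C inj_iff G.norm_nonneg
        G.norm_eq_zero_iff G.norm_scale G.norm_triangle G.norm_mono)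
  fix S assume S: "S \<in> cauchy_seqs T (vnorm T)"
  define s where "s = (\<lambda>n. inv_into C e (S n))"
  have "S n \<in> e ` C" for n using S by (simp add: cauchy_seqs_def)
  then have s: "s n \<in> C" "S n = e (s n)" for n
    by (auto simp: s_def inv_into_into f_inv_into_f)
  then have "s \<in> cauchy_seqs G (vnorm G)" "range s \<subseteq> C"
    using S by (auto simp: cauchy_seqs_def C_diff C_carrier)
  then obtain a where "a \<in> C" "(\<lambda>n. vnorm G (vdiff G (s n) a)) \<longlonglongrightarrow> 0"
    using C_complete by blast
  then show "\<exists>A\<in>vcarrier T. (\<lambda>n. vnorm T (vdiff T (S n) A)) \<longlonglongrightarrow> 0"
    by (auto simp: s C_diff)
qed

lemma transport_hom:
  assumes X: "vector_lattice X" and h: "h \<in> vlat_hom X G" and hC: "\<And>x. x \<in> vcarrier X \<Longrightarrow> h x \<in> C"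
  shows "(\<lambda>x\<in>vcarrier X. e (h x)) \<in> vlat_hom X T"
proof -
  interpret X: vector_lattice X by (rule X)
  show ?thesis
    unfolding vlat_hom_def
    by (auto simp: X.closed hC vlat_homD[OF h] vsup_transport vinf_transport)
qed

end


section \<open>The supremum over all Banach lattices\<close>

lemma contraction_intoD:
  assumes "contraction_into \<phi> G"
  shows "linear_into \<phi> G" "vnorm G (\<phi> x) \<le> norm x"
  using assms by (simp_all add: contraction_into_def)

lemma vlat_homomorphism_lift:
  assumes "banach_lattice G" "contraction_into \<phi> G"
  shows "vlat_homomorphism fvl G (lift \<phi> G)"
proof -
  have "vector_lattice G" using assms(1) by (rule banach_lattice.axioms)
  then show ?thesis
    using lift_hom contraction_intoD(1)[OF assms(2)]
    by (intro vlat_homomorphism.intro vlat_homomorphism_axioms.intro fvl.vector_lattice_axioms)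
qed

text \<open>The closure of the range of \<open>lift \<phi> G\<close> is coded into the type of \<open>rho\<close> by sending each
  element to the set of sequences of \<open>fvl\<close> whose images converge to it.\<close>

lemma rho_over_le_rho:
  assumes \<xi>: "\<xi> \<in> vcarrier (fvl :: 'e::banach dual_fun vlat)"
  shows "rho_over TYPE('g) \<xi> \<le> rho \<xi>"
  unfolding rho_over_def
proof (rule Sup_least, clarify)
  fix G :: "'g nvlat" and \<phi> :: "'e \<Rightarrow> 'g"
  assume G: "banach_lattice G" and \<phi>: "contraction_into \<phi> G"
  interpret G: normed_vector_lattice G "vnorm G" using G by (rule banach_lattice_normed)
  interpret L: vlat_homomorphism fvl G "lift \<phi> G" using G \<phi> by (rule vlat_homomorphism_lift)
  define e where "e = (\<lambda>g. {s. range s \<subseteq> vcarrier fvl \<and> G.asymp (\<lambda>n. lift \<phi> G (s n)) (\<lambda>_. g)})"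
  \<comment> \<open>Exactly the limits of sequences from the range of \<open>lift \<phi> G\<close>
    have a nonempty code, so this is the closure of the range.\<close>
  define C where "C = {g. e g \<noteq> {}}"
  have C_iff: "g \<in> C \<longleftrightarrow>
      (\<exists>s. (\<forall>n. s n \<in> vcarrier fvl) \<and> G.asymp (\<lambda>n. lift \<phi> G (s n)) (\<lambda>_. g))" for g
    by (auto simp: C_def e_def)
  have C_carrier: "g \<in> vcarrier G" if "g \<in> C" for g
    using that G.asymp_closed(2) unfolding C_iff by blast
  have lift_C: "lift \<phi> G \<eta> \<in> C" if "\<eta> \<in> vcarrier fvl" for \<eta>
    using that unfolding C_iff
    by (intro exI[of _ "\<lambda>_. \<eta>"]) (simp add: G.asymp_refl L.hom_closed)
  have "vector_sublattice G C"
    unfolding vector_sublattice_def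
  proof (intro conjI ballI allI)
    show "C \<subseteq> vcarrier G" using C_carrier by blast
    show "vzero G \<in> C" using lift_C[OF zero_in_fvl] L.hom_zero by simp
  next
    fix a b assume "a \<in> C" "b \<in> C"
    then obtain s t where s: "\<And>n. s n \<in> vcarrier fvl" "G.asymp (\<lambda>n. lift \<phi> G (s n)) (\<lambda>_. a)"
      and t: "\<And>n. t n \<in> vcarrier fvl" "G.asymp (\<lambda>n. lift \<phi> G (t n)) (\<lambda>_. b)"
      unfolding C_iff by blast
    show "vadd G a b \<in> C" unfolding C_iff
      using s t G.asymp_add[OF s(2) t(2)] L.hom_add[OF s(1) t(1)] fvl.add_closed[OF s(1) t(1)]
      by (intro exI[of _ "\<lambda>n. vadd fvl (s n) (t n)"]) (simp del: fvl_ops)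
    show "vsup G a b \<in> C" unfolding C_iff
      using s t G.asymp_sup[OF s(2) t(2)] L.hom_sup[OF s(1) t(1)] fvl.sup_closed[OF s(1) t(1)]
      by (intro exI[of _ "\<lambda>n. vsup fvl (s n) (t n)"]) simp
    show "vinf G a b \<in> C" unfolding C_iff
      using s t G.asymp_inf[OF s(2) t(2)] L.hom_inf[OF s(1) t(1)] fvl.inf_closed[OF s(1) t(1)]
      by (intro exI[of _ "\<lambda>n. vinf fvl (s n) (t n)"]) simp
  next
    fix r a assume "a \<in> C"
    then obtain s where s: "\<And>n. s n \<in> vcarrier fvl" "G.asymp (\<lambda>n. lift \<phi> G (s n)) (\<lambda>_. a)"
      unfolding C_iff by blast
    show "vscale G r a \<in> C" unfolding C_iff
      using s G.asymp_scale[OF s(2)] L.hom_scale[OF s(1)] fvl.scale_closed[OF s(1)]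
      by (intro exI[of _ "\<lambda>n. vscale fvl r (s n)"]) (simp del: fvl_ops)
  qed
  moreover have "inj_on e C"
  proof (rule inj_onI)
    fix a b assume "a \<in> C" "b \<in> C" "e a = e b"
    \<comment> \<open>Codes of members of \<open>C\<close> are nonempty, and a sequence in both
      codes has both limits.\<close>
    then obtain s where "s \<in> e a" "s \<in> e b" by (auto simp: C_def)
    then show "a = b" using G.asymp_limit_unique by (auto simp: e_def)
  qed
  moreover have "\<exists>a\<in>C. (\<lambda>n. vnorm G (vdiff G (s n) a)) \<longlonglongrightarrow> 0"
    if s: "s \<in> cauchy_seqs G (vnorm G)" and sC: "range s \<subseteq> C" for s
  proof -
    obtain a where a: "a \<in> vcarrier G" "(\<lambda>n. vnorm G (vdiff G (s n) a)) \<longlonglongrightarrow> 0"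
      using banach_lattice.complete[OF G s] by blast
    then have sa: "G.asymp s (\<lambda>_. a)"
      using G.cauchy_seqs_closed[OF s] by (auto simp: G.asymp_def)
    \<comment> \<open>A limit of limits: replacing \<open>s n\<close> by an image within
      \<open>1 / (n + 1)\<close> gives a sequence from the range itself with the same limit
      \<open>a\<close>.\<close>
    have "\<exists>\<eta>\<in>vcarrier fvl. vnorm G (vdiff G (lift \<phi> G \<eta>) (s n)) < inverse (real (Suc n))" for n
    proof -
      have "s n \<in> C" using sC by blast
      then obtain t where t: "\<And>k. t k \<in> vcarrier fvl" "G.asymp (\<lambda>k. lift \<phi> G (t k)) (\<lambda>_. s n)"
        unfolding C_iff by blast
      have "\<forall>\<^sub>F k in sequentially. vnorm G (vdiff G (lift \<phi> G (t k)) (s n)) < inverse (real (Suc n))"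
        using G.asympD[OF t(2)] by (intro order_tendstoD) auto
      then show ?thesis using t(1) by (auto simp: eventually_sequentially)
    qed
    then obtain \<eta> where \<eta>: "\<And>n. \<eta> n \<in> vcarrier fvl"
      "\<And>n. vnorm G (vdiff G (lift \<phi> G (\<eta> n)) (s n)) < inverse (real (Suc n))"
      by metis
    have "G.asymp (\<lambda>n. lift \<phi> G (\<eta> n)) s"
      by (rule G.asympI[OF _ _ _ LIMSEQ_inverse_real_of_nat])
        (use \<eta> G.cauchy_seqs_closed[OF s] in \<open>simp_all add: less_imp_le L.hom_closed del: of_nat_Suc\<close>)
    then have "a \<in> C"
      unfolding C_iff using \<eta>(1) G.asymp_trans sa by blast
    then show ?thesis using a(2) by blast
  qed
  ultimately interpret C: closed_sublattice G C e
    using G by (intro closed_sublattice.intro closed_sublattice_axioms.intro)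
  have \<phi>_C: "\<phi> x \<in> C" for x
    using lift_C[OF ev_in_fvl, of x] lift_ev[OF G.vector_lattice_axioms contraction_intoD(1)[OF \<phi>]]
    by simp
  have contr: "contraction_into (\<lambda>x. e (\<phi> x)) C.T"
    using \<phi> \<phi>_C by (simp add: contraction_into_def linear_into_def)
  \<comment> \<open>Both sides are homomorphisms that agree on the generators. As \<open>e\<close>
    is isometric, the value of the norm in \<open>G\<close> also occurs in the supremum defining
    \<open>rho\<close>.\<close>
  have "lift (\<lambda>x. e (\<phi> x)) C.T = (\<lambda>\<eta>\<in>vcarrier fvl. e (lift \<phi> G \<eta>))"
    using contraction_intoD(1)[OF contr] lift_C
      lift_ev[OF G.vector_lattice_axioms contraction_intoD(1)[OF \<phi>]]
    by (intro lift_eqI C.vector_lattice_transport C.transport_hom fvl.vector_lattice_axioms L.hom)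
      (simp_all add: ev_in_fvl)
  then have "vnorm C.T (lift (\<lambda>x. e (\<phi> x)) C.T \<xi>) = vnorm G (lift \<phi> G \<xi>)"
    using lift_C \<xi> by simp
  then show "ereal (vnorm G (lift \<phi> G \<xi>)) \<le> rho \<xi>"
    unfolding rho_def rho_over_def using C.banach_lattice_transport contr
    by (intro Sup_upper) (auto intro!: exI[of _ C.T] exI[of _ "\<lambda>x. e (\<phi> x)"])
qed

section \<open>The reals as a test lattice\<close>

definition real_nvlat :: "real nvlat"
  where "real_nvlat = \<lparr> vcarrier = UNIV, vzero = 0, vadd = (+), vscale = (*), vle = (\<le>), vnorm = abs \<rparr>"

lemma real_nvlat_simps [simp]:
  "vcarrier real_nvlat = UNIV" "vzero real_nvlat = 0" "vadd real_nvlat a b = a + b"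
  "vscale real_nvlat a b = a * b" "vle real_nvlat a b \<longleftrightarrow> a \<le> b" "vnorm real_nvlat a = \<bar>a\<bar>"
  "vneg real_nvlat a = - a" "vdiff real_nvlat a b = a - b"
  by (simp_all add: real_nvlat_def vneg_def vdiff_def)

lemma is_vsup_real: "is_vsup real_nvlat a b (max a b)"
  by (simp add: is_vsup_def)

lemma is_vinf_real: "is_vinf real_nvlat a b (min a b)"
  by (simp add: is_vinf_def)

lemma vector_lattice_real: "vector_lattice real_nvlat"
proof
  show "\<exists>s. is_vsup real_nvlat a b s" "\<exists>s. is_vinf real_nvlat a b s" for a b
    using is_vsup_real is_vinf_real by blast+
qed (auto simp: algebra_simps mult_right_mono)

lemma vsup_real [simp]: "vsup real_nvlat a b = max a b"
  using vector_lattice.vsup_eqI[OF vector_lattice_real is_vsup_real] .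

lemma vinf_real [simp]: "vinf real_nvlat a b = min a b"
  using vector_lattice.vinf_eqI[OF vector_lattice_real is_vinf_real] .

lemma banach_lattice_real: "banach_lattice real_nvlat"
proof (intro banach_lattice.intro banach_lattice_axioms.intro vector_lattice_real)
  show "vector_lattice_norm real_nvlat (vnorm real_nvlat)"
    by (auto simp: vector_lattice_norm_def vabs_def abs_mult max_def split: if_splits)
  fix s assume "s \<in> cauchy_seqs real_nvlat (vnorm real_nvlat)"
  then have "Cauchy s" by (simp add: cauchy_seqs_def Cauchy_def dist_real_def)
  then obtain l where "s \<longlonglongrightarrow> l" using real_Cauchy_convergent convergent_def by blast
  then show "\<exists>a\<in>vcarrier real_nvlat. (\<lambda>n. vnorm real_nvlat (vdiff real_nvlat (s n) a)) \<longlonglongrightarrow> 0"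
    by (auto simp: tendsto_rabs_zero_iff intro!: exI[of _ l] LIM_zero)
qed

lemma contraction_into_real:
  "norm x' \<le> 1 \<Longrightarrow> contraction_into (blinfun_apply x') real_nvlat"
proof -
  assume "norm x' \<le> 1"
  then have "\<bar>blinfun_apply x' x\<bar> \<le> norm x" for x
    using norm_blinfun[of x' x] mult_right_mono[of "norm x'" 1 "norm x"] by simp
  then show ?thesis
    by (simp add: contraction_into_def linear_into_def blinfun.add_right blinfun.scaleR_right)
qed

text \<open>Evaluation at \<open>x'\<close> is a lattice homomorphism that restricts to
  \<open>x'\<close> on the generators. Through it, \<open>rho\<close> controls the values of \<xi>
  on the dual unit ball.\<close>

lemma lift_real:
  assumes "norm x' \<le> 1" "\<xi> \<in> vcarrier fvl"
  shows "lift (blinfun_apply x') real_nvlat \<xi> = \<xi> x'"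
proof -
  have "lift (blinfun_apply x') real_nvlat = (\<lambda>\<xi>\<in>vcarrier fvl. \<xi> x')"
    using contraction_intoD(1)[OF contraction_into_real[OF assms(1)]]
    by (intro lift_eqI vector_lattice_real)
      (simp_all add: vlat_hom_fvl_iff fvl_closed, simp add: ev_def)
  then show ?thesis using assms(2) by simp
qed

lemma norm_lift_le_rho_over:
  fixes G :: "'g nvlat"
  assumes "banach_lattice G" "contraction_into \<phi> G"
  shows "ereal (vnorm G (lift \<phi> G \<xi>)) \<le> rho_over TYPE('g) \<xi>"
  unfolding rho_over_def using assms by (intro Sup_upper) blast

text \<open>The reals are not carried by the type of \<open>rho\<close>, so the bound passes through
  \<open>rho_over_le_rho\<close>.\<close>

lemma abs_eval_le_rho:
  assumes "\<xi> \<in> vcarrier fvl" "norm x' \<le> 1"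
  shows "ereal \<bar>\<xi> x'\<bar> \<le> rho \<xi>"
  using norm_lift_le_rho_over[OF banach_lattice_real contraction_into_real[OF assms(2)], of \<xi>]
    rho_over_le_rho[OF assms(1), where ?'g = real] lift_real[OF assms(2,1)] by simp

text \<open>The bound follows the construction of \<xi>: \<open>norm x\<close> for
  \<open>ev x\<close>, a factor \<open>\<bar>r\<bar>\<close> for multiples, and the sum of two
  bounds for sums, suprema and infima. At no stage does it depend on \<open>G\<close> or
  \<phi>.\<close>

lemma ex_norm_lift_bound:
  assumes "\<xi> \<in> vcarrier (fvl :: 'e::banach dual_fun vlat)"
  shows "\<exists>K. \<forall>(G :: 'g nvlat) \<phi>. banach_lattice G \<longrightarrow> contraction_into \<phi> G \<longrightarrow>
    vnorm G (lift \<phi> G \<xi>) \<le> K"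
  using assms
proof (induction rule: fvl_induct)
  case (ev x)
  have "vnorm G (lift \<phi> G (ev x)) \<le> norm x"
    if "banach_lattice G" "contraction_into \<phi> G" for G :: "'g nvlat" and \<phi> :: "'e \<Rightarrow> _"
    using contraction_intoD(2)[OF that(2), of x]
      lift_ev[OF banach_lattice.axioms(1)[OF that(1)] contraction_intoD(1)[OF that(2)], of x] by simp
  then show ?case by blast
next
  case (scale r \<xi>)
  then obtain K where K: "\<And>(G :: 'g nvlat) \<phi>. \<lbrakk>banach_lattice G; contraction_into \<phi> G\<rbrakk>
      \<Longrightarrow> vnorm G (lift \<phi> G \<xi>) \<le> K" by blast
  have "vnorm G (lift \<phi> G (\<lambda>x'. r * \<xi> x')) \<le> \<bar>r\<bar> * K"
    if *: "banach_lattice G" "contraction_into \<phi> G" for G :: "'g nvlat" and \<phi> :: "'e \<Rightarrow> _"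
  proof -
    interpret G: normed_vector_lattice G "vnorm G" using *(1) by (rule banach_lattice_normed)
    interpret L: vlat_homomorphism fvl G "lift \<phi> G" using * by (rule vlat_homomorphism_lift)
    show ?thesis
      using L.hom_scale[OF scale.hyps] K[OF *] scale.hyps
      by (simp add: G.norm_scale L.hom_closed mult_left_mono)
  qed
  then show ?case by blast
next
  case (add \<xi> \<eta>)
  then obtain K M where K: "\<And>(G :: 'g nvlat) \<phi>. \<lbrakk>banach_lattice G; contraction_into \<phi> G\<rbrakk>
      \<Longrightarrow> vnorm G (lift \<phi> G \<xi>) \<le> K \<and> vnorm G (lift \<phi> G \<eta>) \<le> M" by meson
  have "vnorm G (lift \<phi> G (\<lambda>x'. \<xi> x' + \<eta> x')) \<le> K + M"
    if *: "banach_lattice G" "contraction_into \<phi> G" for G :: "'g nvlat" and \<phi> :: "'e \<Rightarrow> _"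
  proof -
    interpret G: normed_vector_lattice G "vnorm G" using *(1) by (rule banach_lattice_normed)
    interpret L: vlat_homomorphism fvl G "lift \<phi> G" using * by (rule vlat_homomorphism_lift)
    have "vnorm G (lift \<phi> G (\<lambda>x'. \<xi> x' + \<eta> x')) \<le> vnorm G (lift \<phi> G \<xi>) + vnorm G (lift \<phi> G \<eta>)"
      using L.hom_add[OF add.hyps] add.hyps by (simp add: G.norm_triangle L.hom_closed)
    then show ?thesis using K[OF *] by simp
  qed
  then show ?case by blast
next
  case (max \<xi> \<eta>)
  then obtain K M where K: "\<And>(G :: 'g nvlat) \<phi>. \<lbrakk>banach_lattice G; contraction_into \<phi> G\<rbrakk>
      \<Longrightarrow> vnorm G (lift \<phi> G \<xi>) \<le> K \<and> vnorm G (lift \<phi> G \<eta>) \<le> M" by meson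
  have "vnorm G (lift \<phi> G (\<lambda>x'. max (\<xi> x') (\<eta> x'))) \<le> K + M"
    if *: "banach_lattice G" "contraction_into \<phi> G" for G :: "'g nvlat" and \<phi> :: "'e \<Rightarrow> _"
  proof -
    interpret G: normed_vector_lattice G "vnorm G" using *(1) by (rule banach_lattice_normed)
    interpret L: vlat_homomorphism fvl G "lift \<phi> G" using * by (rule vlat_homomorphism_lift)
    have "vnorm G (lift \<phi> G (\<lambda>x'. max (\<xi> x') (\<eta> x'))) \<le> vnorm G (lift \<phi> G \<xi>) + vnorm G (lift \<phi> G \<eta>)"
      using L.hom_sup[OF max.hyps] max.hyps by (simp add: vsup_fvl G.norm_sup_le L.hom_closed)
    then show ?thesis using K[OF *] by simp
  qed
  then show ?case by blast
next
  case (min \<xi> \<eta>)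
  then obtain K M where K: "\<And>(G :: 'g nvlat) \<phi>. \<lbrakk>banach_lattice G; contraction_into \<phi> G\<rbrakk>
      \<Longrightarrow> vnorm G (lift \<phi> G \<xi>) \<le> K \<and> vnorm G (lift \<phi> G \<eta>) \<le> M" by meson
  have "vnorm G (lift \<phi> G (\<lambda>x'. min (\<xi> x') (\<eta> x'))) \<le> K + M"
    if *: "banach_lattice G" "contraction_into \<phi> G" for G :: "'g nvlat" and \<phi> :: "'e \<Rightarrow> _"
  proof -
    interpret G: normed_vector_lattice G "vnorm G" using *(1) by (rule banach_lattice_normed)
    interpret L: vlat_homomorphism fvl G "lift \<phi> G" using * by (rule vlat_homomorphism_lift)
    have "vnorm G (lift \<phi> G (\<lambda>x'. min (\<xi> x') (\<eta> x'))) \<le> vnorm G (lift \<phi> G \<xi>) + vnorm G (lift \<phi> G \<eta>)"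
      using L.hom_inf[OF min.hyps] min.hyps by (simp add: vinf_fvl G.norm_inf_le L.hom_closed)
    then show ?thesis using K[OF *] by simp
  qed
  then show ?case by blast
qed

section \<open>From the extended-real supremum to a real-valued norm\<close>

lemma rho_finite:
  assumes "\<xi> \<in> vcarrier (fvl :: 'e::banach dual_fun vlat)"
  shows "\<bar>rho \<xi>\<bar> \<noteq> \<infinity>"
proof -
  obtain K where K: "\<And>(G :: (nat \<Rightarrow> 'e dual_fun) set nvlat) \<phi>.
      \<lbrakk>banach_lattice G; contraction_into \<phi> G\<rbrakk> \<Longrightarrow> vnorm G (lift \<phi> G \<xi>) \<le> K"
    using ex_norm_lift_bound[OF assms] by blast
  then have "rho \<xi> \<le> ereal K"
    unfolding rho_def rho_over_def by (intro Sup_least) auto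
  \<comment> \<open>The zero functional is a contraction; this excludes the value of an empty
    supremum.\<close>
  moreover have "ereal \<bar>\<xi> 0\<bar> \<le> rho \<xi>" using assms by (rule abs_eval_le_rho) simp
  ultimately show ?thesis by (cases "rho \<xi>") auto
qed

lemma rho_eq: "\<xi> \<in> vcarrier fvl \<Longrightarrow> rho \<xi> = ereal (rho_norm \<xi>)"
  unfolding rho_norm_def using rho_finite ereal_real' by metis

lemma abs_eval_le_rho_norm:
  "\<lbrakk>\<xi> \<in> vcarrier fvl; norm x' \<le> 1\<rbrakk> \<Longrightarrow> \<bar>\<xi> x'\<bar> \<le> rho_norm \<xi>"
  using abs_eval_le_rho[of \<xi> x'] by (simp add: rho_eq)

lemma norm_lift_le_rho_norm:
  assumes "banach_lattice G" "contraction_into \<phi> G" "\<xi> \<in> vcarrier fvl"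
  shows "vnorm G (lift \<phi> G \<xi>) \<le> rho_norm \<xi>"
  using order_trans[OF norm_lift_le_rho_over[OF assms(1,2)] rho_over_le_rho[OF assms(3)]]
    rho_eq[OF assms(3)] by simp

lemma rho_norm_le:
  assumes "\<xi> \<in> vcarrier (fvl :: 'e::banach dual_fun vlat)"
    and "\<And>(G :: (nat \<Rightarrow> 'e dual_fun) set nvlat) \<phi>.
      \<lbrakk>banach_lattice G; contraction_into \<phi> G\<rbrakk> \<Longrightarrow> vnorm G (lift \<phi> G \<xi>) \<le> K"
  shows "rho_norm \<xi> \<le> K"
proof -
  have "rho \<xi> \<le> ereal K"
    unfolding rho_def rho_over_def using assms(2) by (intro Sup_least) auto
  then show ?thesis by (simp add: rho_eq[OF assms(1)])
qed

text \<open>Makes a member of \<open>fvl\<close> determined by its values on the dual unit ball, the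
  part visible to contractions into the reals.\<close>

lemma fvl_pos_homogeneous:
  assumes "\<xi> \<in> vcarrier fvl" "0 \<le> r"
  shows "\<xi> (r *\<^sub>R x') = r * \<xi> x'"
  using assms(1)
proof (induction rule: fvl_induct)
  case (ev x)
  show ?case by (simp add: ev_def blinfun.scaleR_left)
qed (use assms(2) in \<open>simp_all add: algebra_simps max_mult_distrib_left min_mult_distrib_left\<close>)

text \<open>The half of homogeneity that passes through the supremum directly. The other half is
  this one for \<open>inverse r\<close>, and \<open>r = 0\<close> shows that the zero function has
  norm 0.\<close>

lemma rho_norm_scale_le:
  assumes "\<xi> \<in> vcarrier (fvl :: 'e::banach dual_fun vlat)"
  shows "rho_norm (\<lambda>x'. r * \<xi> x') \<le> \<bar>r\<bar> * rho_norm \<xi>"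
proof (rule rho_norm_le)
  fix G :: "(nat \<Rightarrow> 'e dual_fun) set nvlat" and \<phi> :: "'e \<Rightarrow> _"
  assume *: "banach_lattice G" "contraction_into \<phi> G"
  interpret G: normed_vector_lattice G "vnorm G" using *(1) by (rule banach_lattice_normed)
  interpret L: vlat_homomorphism fvl G "lift \<phi> G" using * by (rule vlat_homomorphism_lift)
  show "vnorm G (lift \<phi> G (\<lambda>x'. r * \<xi> x')) \<le> \<bar>r\<bar> * rho_norm \<xi>"
    using L.hom_scale[OF assms] norm_lift_le_rho_norm[OF * assms] assms
    by (simp add: G.norm_scale L.hom_closed mult_left_mono)
qed (use assms in \<open>rule scale_in_fvl\<close>)

lemma vector_lattice_norm_rho_norm:
  "vector_lattice_norm (fvl :: 'e::banach dual_fun vlat) rho_norm"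
  unfolding vector_lattice_norm_def
proof (intro conjI ballI allI impI)
  fix \<xi> :: "'e dual_fun" assume \<xi>: "\<xi> \<in> vcarrier fvl"
  show nonneg: "0 \<le> rho_norm \<xi>"
    using abs_eval_le_rho_norm[OF \<xi>, of 0] by simp
  show "rho_norm \<xi> = 0 \<longleftrightarrow> \<xi> = vzero fvl"
  proof
    assume 0: "rho_norm \<xi> = 0"
    have "\<xi> x' = 0" for x'
    proof -
      \<comment> \<open>Scales \<open>x'\<close> into the unit ball; the summand 1 keeps
        \<open>r\<close> defined and positive at \<open>x' = 0\<close>.\<close>
      define r where "r = inverse (1 + norm x')"
      have r: "0 < r" "norm (r *\<^sub>R x') \<le> 1"
        by (simp_all add: r_def field_simps add_pos_nonneg)
      have "\<bar>\<xi> (r *\<^sub>R x')\<bar> \<le> 0" using abs_eval_le_rho_norm[OF \<xi> r(2)] 0 by simp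
      then show ?thesis using fvl_pos_homogeneous[OF \<xi>, of r x'] r(1) by simp
    qed
    then show "\<xi> = vzero fvl" by (simp add: fun_eq_iff)
  next
    assume 0: "\<xi> = vzero fvl"
    \<comment> \<open>The zero function is 0 times itself.\<close>
    have "rho_norm \<xi> \<le> 0"
      using rho_norm_scale_le[OF \<xi>, of 0] 0 by simp
    with nonneg show "rho_norm \<xi> = 0" by simp
  qed
  fix r
  show "rho_norm (vscale fvl r \<xi>) = \<bar>r\<bar> * rho_norm \<xi>"
  proof (cases "r = 0")
    case True
    then show ?thesis
      using rho_norm_scale_le[OF \<xi>, of 0] abs_eval_le_rho_norm[OF scale_in_fvl[OF \<xi>, of 0], of 0] True
      by simp
  next
    case False
    have "rho_norm (\<lambda>x'. inverse r * (r * \<xi> x')) \<le> \<bar>inverse r\<bar> * rho_norm (\<lambda>x'. r * \<xi> x')"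
      using \<xi> by (intro rho_norm_scale_le scale_in_fvl)
    also have "(\<lambda>x'. inverse r * (r * \<xi> x')) = \<xi>" using False by (simp add: fun_eq_iff field_simps)
    finally show ?thesis
      using rho_norm_scale_le[OF \<xi>, of r] False by (simp add: field_simps)
  qed
next
  fix \<xi> \<eta> :: "'e dual_fun" assume \<xi>: "\<xi> \<in> vcarrier fvl" and \<eta>: "\<eta> \<in> vcarrier fvl"
  show "rho_norm (vadd fvl \<xi> \<eta>) \<le> rho_norm \<xi> + rho_norm \<eta>"
  proof (rule rho_norm_le)
    fix G :: "(nat \<Rightarrow> 'e dual_fun) set nvlat" and \<phi> :: "'e \<Rightarrow> _"
    assume *: "banach_lattice G" "contraction_into \<phi> G"
    interpret G: normed_vector_lattice G "vnorm G" using *(1) by (rule banach_lattice_normed)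
    interpret L: vlat_homomorphism fvl G "lift \<phi> G" using * by (rule vlat_homomorphism_lift)
    have "vnorm G (lift \<phi> G (vadd fvl \<xi> \<eta>)) \<le> vnorm G (lift \<phi> G \<xi>) + vnorm G (lift \<phi> G \<eta>)"
      using \<xi> \<eta> by (simp add: L.hom_add G.norm_triangle L.hom_closed del: fvl_ops)
    then show "vnorm G (lift \<phi> G (vadd fvl \<xi> \<eta>)) \<le> rho_norm \<xi> + rho_norm \<eta>"
      using norm_lift_le_rho_norm[OF * \<xi>] norm_lift_le_rho_norm[OF * \<eta>] by linarith
  qed (use \<xi> \<eta> in \<open>rule fvl.add_closed\<close>)
  assume le: "vle fvl (vabs fvl \<xi>) (vabs fvl \<eta>)"
  show "rho_norm \<xi> \<le> rho_norm \<eta>"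
  proof (rule rho_norm_le[OF \<xi>])
    fix G :: "(nat \<Rightarrow> 'e dual_fun) set nvlat" and \<phi> :: "'e \<Rightarrow> _"
    assume *: "banach_lattice G" "contraction_into \<phi> G"
    interpret G: normed_vector_lattice G "vnorm G" using *(1) by (rule banach_lattice_normed)
    interpret L: vlat_homomorphism fvl G "lift \<phi> G" using * by (rule vlat_homomorphism_lift)
    have "vnorm G (lift \<phi> G \<xi>) \<le> vnorm G (lift \<phi> G \<eta>)"
      \<comment> \<open>Homomorphisms preserve order and absolute values, so the inequality between
        absolute values holds in every target, where the norm is monotone.\<close>
      using L.hom_mono[OF fvl.abs_closed[OF \<xi>] fvl.abs_closed[OF \<eta>] le] \<xi> \<eta>
      by (intro G.norm_mono) (simp_all add: L.hom_closed L.hom_abs)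
    then show "vnorm G (lift \<phi> G \<xi>) \<le> rho_norm \<eta>"
      using norm_lift_le_rho_norm[OF * \<eta>] by linarith
  qed
qed


section \<open>The free Banach lattice\<close>

interpretation fvl: normed_vector_lattice fvl rho_norm
  by unfold_locales (rule vector_lattice_norm_rho_norm)

lemma contraction_into_completion:
  "contraction_into (completion_embed fvl rho_norm \<circ> (ev :: 'e::banach \<Rightarrow> 'e dual_fun))
    (norm_completion fvl rho_norm)"
proof -
  have "rho_norm (ev x) \<le> norm x" for x :: 'e
    using ev_in_fvl
  proof (rule rho_norm_le)
    fix G :: "(nat \<Rightarrow> 'e dual_fun) set nvlat" and \<phi> :: "'e \<Rightarrow> _"
    assume "banach_lattice G" "contraction_into \<phi> G"
    then show "vnorm G (lift \<phi> G (ev x)) \<le> norm x"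
      using contraction_intoD lift_ev[OF banach_lattice.axioms(1)] by metis
  qed
  moreover have "linear_into ev (fvl :: 'e dual_fun vlat)" by (rule linear_into_ev)
  ultimately show ?thesis
    by (simp add: contraction_into_def linear_into_def fvl.embed_closed fvl.norm_embed
        fvl.embed_ops ev_in_fvl del: fvl_ops)
qed

text \<open>By uniqueness of extensions from the generators, a homomorphism on the completion agrees
  with \<phi> on \<open>E\<close> if and only if it agrees with \<open>lift \<phi> G\<close> on all
  of \<open>fvl\<close>. This turns the universal property over \<open>E\<close> into unique
  extension from \<open>fvl\<close> to its completion.\<close>

lemma free_banach_lattice_completion:
  "free_banach_lattice TYPE('h) (completion_embed fvl rho_norm \<circ> (ev :: 'e::banach \<Rightarrow> 'e dual_fun))
    (norm_completion fvl rho_norm)"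
  unfolding free_banach_lattice_def
proof (intro conjI allI impI fvl.banach_lattice_completion contraction_into_completion)
  fix G :: "'h nvlat" and \<phi> :: "'e \<Rightarrow> 'h"
  assume "banach_lattice G \<and> contraction_into \<phi> G"
  then have G: "banach_lattice G" and \<phi>: "contraction_into \<phi> G" by auto
  interpret L: vlat_homomorphism fvl G "lift \<phi> G" using G \<phi> by (rule vlat_homomorphism_lift)
  note lin = L.Y.vector_lattice_axioms contraction_intoD(1)[OF \<phi>]
  have "h \<circ> (completion_embed fvl rho_norm \<circ> ev) = \<phi> \<longleftrightarrow>
      (\<forall>\<xi>\<in>vcarrier fvl. h (completion_embed fvl rho_norm \<xi>) = lift \<phi> G \<xi>)" (is "?l \<longleftrightarrow> ?r")
    if h: "h \<in> contractive_vlat_hom (norm_completion fvl rho_norm) G" for h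
  proof
    assume ?l
    have "lift \<phi> G = (\<lambda>\<xi>\<in>vcarrier fvl. h (completion_embed fvl rho_norm \<xi>))"
      using h fun_cong[OF \<open>?l\<close>]
      by (intro lift_eqI lin fvl.embed_hom_compose) (auto simp: contractive_vlat_hom_def ev_in_fvl)
    then show ?r by simp
  next
    assume ?r
    then show ?l using lift_ev[OF lin] by (auto simp: ev_in_fvl)
  qed
  then show "\<exists>!h. h \<in> contractive_vlat_hom (norm_completion fvl rho_norm) G \<and>
      h \<circ> (completion_embed fvl rho_norm \<circ> ev) = \<phi>"
    using fvl.ex1_extension_to_completion[OF G L.hom norm_lift_le_rho_norm[OF G \<phi>]]
    by (simp cong: conj_cong)
qed

text \<open>The type variables \<open>'f\<close>, \<open>'g\<close> and \<open>'h\<close> are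
  independent, so each clause about test lattices holds for carriers of arbitrary type.\<close>

theorem mainTheorem4:
  shows "free_vector_lattice TYPE('f) (ev :: 'e::banach \<Rightarrow> 'e dual_fun) fvl \<and>
    (\<forall>\<xi>\<in>vcarrier (fvl :: 'e dual_fun vlat). rho_over TYPE('g) \<xi> \<le> rho \<xi>) \<and>
    (\<forall>\<xi>\<in>vcarrier (fvl :: 'e dual_fun vlat). \<bar>rho \<xi>\<bar> \<noteq> \<infinity>) \<and>
    vector_lattice_norm (fvl :: 'e dual_fun vlat) rho_norm \<and>
    free_banach_lattice TYPE('h)
      (completion_embed fvl rho_norm \<circ> (ev :: 'e \<Rightarrow> 'e dual_fun))
      (norm_completion fvl rho_norm)"
  by (intro conjI ballI free_vector_lattice_fvl rho_over_le_rho rho_finite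
      vector_lattice_norm_rho_norm free_banach_lattice_completion)

end
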